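(* In each of the cases S and L described in the context, the maps $\mathcal I_{\mathcal A}$ and $\mathcal V$ are mutually inverse bijections between the set of superalgebraic subsets of $X$ and the set of radical ideals of $\mathcal A$. Both maps are order reversing (with respect to inclusion).
   Context: Let $\mathtt k$ be an algebraically closed field of characteristic zero, let $m,n\ge 0$ be integers, and let $W=\mathcal S_m\times \mathcal S_n$ (product of symmetric groups) act on polynomials or Laurent polynomials in $x_1,\dots,x_m,y_1,\dots,y_n$ by permuting the $x_i$ and the $y_j$ separately. Case S (supersymmetric polynomials): $X=\mathtt k^m\times\mathtt k^n$, and $\mathcal A$ is the algebra of supersymmetric polynomials over $\mathtt k$, i.e. of all $f\in \mathtt k[x_1,\dots,x_m,y_1,\dots,y_n]^{W}$ such that the polynomial obtained from $f$ by substituting $x_1=t$, $y_1=-t$ is independent of $t$. Case L (Laurent supersymmetric polynomials): $X=(\mathtt k^* )^m\times(\mathtt k^* )^n$, and $\mathcal A$ is the algebra of all $f\in \mathtt k[x_1^{\pm1},\dots,x_m^{\pm1},y_1^{\pm1},\dots,y_n^{\pm1}]^{W}$ such that $x_i\frac{\partial f}{\partial x_i}+y_j\frac{\partial f}{\partial y_j}$ lies in the ideal $(x_i-y_j)$ of the Laurent polynomial ring for all $i,j$. If $mn=0$ the supersymmetry condition is vacuous. An ideal $I$ of a commutative ring $A$ is radical if $I=\operatorname{rad}(I)=\{f\in A: f^N\in I \text{ for some } N>0\}$ (in particular the unit ideal is radical). For a subset $I\subseteq \mathcal A$ put $\mathcal V(I)=\{x\in X: f(x)=0 \text{ for all } f\in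 I\}$; sets of this form are called superalgebraic sets. For $V\subseteq X$ put $\mathcal I_{\mathcal A}(V)=\{f\in\mathcal A: f(x)=0\text{ for all }x\in V\}$. *)

theory Defs
  imports
    "HOL-Library.Poly_Mapping"
    "HOL-Library.FuncSet"
    "HOL-Combinatorics.Permutations"
    "HOL-Computational_Algebra.Polynomial"
    "HOL-Algebra.Algebraic_Closure_Type"
begin

text \<open>
  A monomial is a finitely supported exponent function and a polynomial is a finitely supported
  coefficient function on monomials; the ring structure is the convolution product of
  \<^theory>\<open>HOL-Library.Poly_Mapping\<close>. Exponents in \<open>nat\<close> give polynomials, exponents in \<open>int\<close> give
  Laurent polynomials. The variable \<open>x\<^sub>i\<close> is \<open>Inl i\<close> and \<open>y\<^sub>j\<close> is \<open>Inr j\<close>.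
\<close>

type_synonym ('e, 'k) gpoly = "((nat + nat) \<Rightarrow>\<^sub>0 'e) \<Rightarrow>\<^sub>0 'k"

definition variables :: "nat \<Rightarrow> nat \<Rightarrow> (nat + nat) set" where
  "variables m n = {1..m} <+> {1..n}"

definition polys_in :: "nat \<Rightarrow> nat \<Rightarrow> ('e::zero, 'k::zero) gpoly set" where
  "polys_in m n = {f. \<forall>\<mu>\<in>Poly_Mapping.keys f. Poly_Mapping.keys \<mu> \<subseteq> variables m n}"

definition Var :: "nat + nat \<Rightarrow> ('e::zero_neq_one, 'k::zero_neq_one) gpoly" where
  "Var v = Poly_Mapping.single (Poly_Mapping.single v 1) 1"

definition Const :: "'k \<Rightarrow> ('e::zero, 'k::zero) gpoly" where
  "Const c = Poly_Mapping.single 0 c"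

text \<open>The action of a permutation \<open>\<pi>\<close> of the variables; it sends \<open>Var v\<close> to \<open>Var (\<pi> v)\<close>.\<close>

definition permute_vars ::
    "(nat + nat \<Rightarrow> nat + nat) \<Rightarrow> ('e::zero, 'k::zero) gpoly \<Rightarrow> ('e, 'k) gpoly" where
  "permute_vars \<pi> f = Poly_Mapping.map_key (Poly_Mapping.map_key \<pi>) f"

definition W_invariants :: "nat \<Rightarrow> nat \<Rightarrow> ('e::zero, 'k::zero) gpoly set" where
  "W_invariants m n = {f \<in> polys_in m n.
     \<forall>\<sigma> \<tau>. \<sigma> permutes {1..m} \<longrightarrow> \<tau> permutes {1..n} \<longrightarrow> permute_vars (map_sum \<sigma> \<tau>) f = f}"

definition subring_of_type :: "'r::ring_1 set \<Rightarrow> 'r ring" where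
  "subring_of_type S = ring_of_type_algebra\<lparr>carrier := S\<rparr>"

text \<open>Substitution of \<open>\<rho> v\<close> for each variable \<open>v\<close>, the coefficients being mapped by \<open>h\<close>.\<close>

definition subst_poly ::
    "('k::zero \<Rightarrow> 'c::comm_ring_1) \<Rightarrow> (nat + nat \<Rightarrow> 'c) \<Rightarrow> (nat, 'k) gpoly \<Rightarrow> 'c" where
  "subst_poly h \<rho> f = (\<Sum>\<mu>\<in>Poly_Mapping.keys f. h (Poly_Mapping.lookup f \<mu>) *
     (\<Prod>v\<in>Poly_Mapping.keys \<mu>. \<rho> v ^ Poly_Mapping.lookup \<mu> v))"

type_synonym 'k point = "(nat \<Rightarrow> 'k) \<times> (nat \<Rightarrow> 'k)"

definition eval_poly :: "(nat, 'k::field) gpoly \<Rightarrow> 'k point \<Rightarrow> 'k" where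
  "eval_poly f p = subst_poly (\<lambda>c. c) (case_sum (fst p) (snd p)) f"

definition eval_laurent :: "(int, 'k::field) gpoly \<Rightarrow> 'k point \<Rightarrow> 'k" where
  "eval_laurent f p = (\<Sum>\<mu>\<in>Poly_Mapping.keys f. Poly_Mapping.lookup f \<mu> *
     (\<Prod>v\<in>Poly_Mapping.keys \<mu>. case_sum (fst p) (snd p) v powi Poly_Mapping.lookup \<mu> v))"

text \<open>
  The result of substituting \<open>x\<^sub>1 = t\<close> and \<open>y\<^sub>1 = -t\<close>, as a polynomial in the new variable \<open>t\<close>
  with coefficients in the polynomial ring in the remaining variables.
\<close>

definition subst_t :: "(nat, 'k::field) gpoly \<Rightarrow> (nat, 'k) gpoly poly" where
  "subst_t = subst_poly (\<lambda>c. [:Const c:])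
     ((\<lambda>v. [:Var v:])(Inl 1 := [:0, 1:], Inr 1 := - [:0, 1:]))"

definition supersym_polys :: "nat \<Rightarrow> nat \<Rightarrow> (nat, 'k::field) gpoly set" where
  "supersym_polys m n = {f \<in> W_invariants m n.
     1 \<le> m \<longrightarrow> 1 \<le> n \<longrightarrow> Polynomial.degree (subst_t f) = 0}"

definition partial_deriv :: "nat + nat \<Rightarrow> (int, 'k::field) gpoly \<Rightarrow> (int, 'k) gpoly" where
  "partial_deriv v f = (\<Sum>\<mu>\<in>Poly_Mapping.keys f.
     Poly_Mapping.single (\<mu> - Poly_Mapping.single v 1)
       (of_int (Poly_Mapping.lookup \<mu> v) * Poly_Mapping.lookup f \<mu>))"

definition laurent_ring :: "nat \<Rightarrow> nat \<Rightarrow> (int, 'k::field) gpoly ring" where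
  "laurent_ring m n = subring_of_type (polys_in m n)"

definition laurent_supersym_polys :: "nat \<Rightarrow> nat \<Rightarrow> (int, 'k::field) gpoly set" where
  "laurent_supersym_polys m n = {f \<in> W_invariants m n.
     \<forall>i\<in>{1..m}. \<forall>j\<in>{1..n}.
       Var (Inl i) * partial_deriv (Inl i) f + Var (Inr j) * partial_deriv (Inr j) f
         \<in> PIdl\<^bsub>laurent_ring m n\<^esub> (Var (Inl i) - Var (Inr j))}"

definition supersym_ring :: "nat \<Rightarrow> nat \<Rightarrow> (nat, 'k::field) gpoly ring" where
  "supersym_ring m n = subring_of_type (supersym_polys m n)"

definition laurent_supersym_ring :: "nat \<Rightarrow> nat \<Rightarrow> (int, 'k::field) gpoly ring" where
  "laurent_supersym_ring m n = subring_of_type (laurent_supersym_polys m n)"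

definition affine_points :: "nat \<Rightarrow> nat \<Rightarrow> 'k point set" where
  "affine_points m n = ({1..m} \<rightarrow>\<^sub>E UNIV) \<times> ({1..n} \<rightarrow>\<^sub>E UNIV)"

definition torus_points :: "nat \<Rightarrow> nat \<Rightarrow> 'k::zero point set" where
  "torus_points m n = ({1..m} \<rightarrow>\<^sub>E - {0}) \<times> ({1..n} \<rightarrow>\<^sub>E - {0})"

definition radical :: "('r, 'b) ring_scheme \<Rightarrow> 'r set \<Rightarrow> 'r set" where
  "radical A I = {f \<in> carrier A. \<exists>N::nat. N > 0 \<and> f [^]\<^bsub>A\<^esub> N \<in> I}"

definition radical_ideals :: "('r, 'b) ring_scheme \<Rightarrow> 'r set set" where
  "radical_ideals A = {I. ideal I A \<and> I = radical A I}"

text \<open>In the following, \<open>ev f x\<close> is the value of \<open>f\<close> at the point \<open>x \<in> pts\<close>.\<close>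

definition zero_locus :: "'x set \<Rightarrow> ('r \<Rightarrow> 'x \<Rightarrow> 'k::zero) \<Rightarrow> 'r set \<Rightarrow> 'x set" where
  "zero_locus pts ev I = {x \<in> pts. \<forall>f\<in>I. ev f x = 0}"

definition vanishing_ideal ::
    "('r, 'b) ring_scheme \<Rightarrow> ('r \<Rightarrow> 'x \<Rightarrow> 'k::zero) \<Rightarrow> 'x set \<Rightarrow> 'r set" where
  "vanishing_ideal A ev V = {f \<in> carrier A. \<forall>x\<in>V. ev f x = 0}"

definition superalgebraic_sets ::
    "('r, 'b) ring_scheme \<Rightarrow> 'x set \<Rightarrow> ('r \<Rightarrow> 'x \<Rightarrow> 'k::zero) \<Rightarrow> 'x set set" where
  "superalgebraic_sets A pts ev = {zero_locus pts ev I | I. I \<subseteq> carrier A}"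

end

theory Submission
  imports Defs "HOL-Library.Function_Algebras"
begin

text \<open>
  Work with functions on \<open>X\<close> and write \<open>\<rho>\<close> for the restriction that sets \<open>x\<^sub>m = t\<close>, \<open>y\<^sub>n = \<epsilon> t\<close>
  (\<open>\<epsilon> = -1\<close> in case S, \<open>\<epsilon> = 1\<close> in case L); it maps the algebra \<open>A(m, n)\<close> to \<open>A(m - 1, n - 1)\<close>.
  Every \<open>W\<close>-invariant multiple of an element of the kernel of \<open>\<rho>\<close> is again supersymmetric.

  The map \<open>\<rho>\<close> is onto: the operator
  \<open>(L g)(x, y) = \<Sum>\<^sub>i\<^sub>,\<^sub>j \<Prod>\<^sub>l\<^sub>\<noteq>\<^sub>i (x\<^sub>l - \<epsilon> y\<^sub>j)/(x\<^sub>l - x\<^sub>i) \<Prod>\<^sub>l\<^sub>\<noteq>\<^sub>j (y\<^sub>l - \<epsilon> x\<^sub>i)/(y\<^sub>l - y\<^sub>j) g(x without x\<^sub>i, y without y\<^sub>j)\<close>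
  takes \<open>A(m - 1, n - 1)\<close> to \<open>A(m, n)\<close> and satisfies \<open>\<rho> L = 1 + L \<rho>\<close>, which makes \<open>\<rho> L\<close> onto in
  characteristic zero.

  Let \<open>f\<close> vanish on the zeros of an ideal \<open>I\<close> of \<open>A(m, n)\<close>. By the classical Nullstellensatz and
  averaging over \<open>W\<close>, \<open>f\<^sup>N = \<Sum> g\<^sub>i r\<^sub>i\<close> with \<open>g\<^sub>i \<in> I\<close> and \<open>r\<^sub>i\<close> invariant under \<open>W\<close>. By induction on
  \<open>m\<close> and surjectivity of \<open>\<rho>\<close>, \<open>f\<^sup>M = g + h\<close> with \<open>g \<in> I\<close> and \<open>\<rho> h = 0\<close>. Then
  \<open>f\<^sup>N\<^sup>+\<^sup>M = f\<^sup>N g + \<Sum> g\<^sub>i (h r\<^sub>i)\<close> lies in \<open>I\<close>.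
\<close>

section \<open>The Nullstellensatz for polynomial functions\<close>

text \<open>A(m, n) is not Noetherian in general: for m = n = 1 in case S it is k + (x + y) k[x, y],
  which does not even separate the points of the line x + y = 0. So neither finite generation nor
  integrality carries the classical theorem over to it. Averaging only yields coefficients invariant
  under W; multiplying them by the kernel of \<rho> is what makes them supersymmetric. L is modelled
  on Lagrange interpolation in both sets of variables. The poles of its weights are only apparent,
  because a symmetrized numerator is divisible by the square of a Vandermonde product. Surjectivity
  is proved for all operators c + L \<rho> with a positive integer c, since the induction raises c
  by one and divides by c. Functions stand in for formal polynomials so that both cases share one
  proof; over an infinite field this loses nothing.\<close>

definition is_subring :: "'a::comm_ring_1 set \<Rightarrow> bool" where
  "is_subring S \<longleftrightarrow> 1 \<in> S \<and> (\<forall>a\<in>S. \<forall>b\<in>S. a - b \<in> S \<and> a * b \<in> S)"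

text \<open>Rings and ideals are sets inside one ambient ring type, because the rings in question,
  functions of fewer coordinates and polynomials over these, vary along the inductions.\<close>

definition ideal_in :: "'a::comm_ring_1 set \<Rightarrow> 'a set \<Rightarrow> bool" where
  "ideal_in S J \<longleftrightarrow> J \<subseteq> S \<and> 0 \<in> J \<and> (\<forall>a\<in>J. \<forall>b\<in>J. a + b \<in> J) \<and> (\<forall>s\<in>S. \<forall>a\<in>J. s * a \<in> J)"

definition prime_in :: "'a::comm_ring_1 set \<Rightarrow> 'a set \<Rightarrow> bool" where
  "prime_in S P \<longleftrightarrow> ideal_in S P \<and> 1 \<notin> P \<and> (\<forall>a\<in>S. \<forall>b\<in>S. a * b \<in> P \<longrightarrow> a \<in> P \<or> b \<in> P)"

lemma subringD:
  assumes "is_subring S"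
  shows subring_one: "1 \<in> S"
    and subring_diff: "a \<in> S \<Longrightarrow> b \<in> S \<Longrightarrow> a - b \<in> S"
    and subring_mult: "a \<in> S \<Longrightarrow> b \<in> S \<Longrightarrow> a * b \<in> S"
    and subring_zero: "0 \<in> S"
    and subring_uminus: "a \<in> S \<Longrightarrow> - a \<in> S"
    and subring_add: "a \<in> S \<Longrightarrow> b \<in> S \<Longrightarrow> a + b \<in> S"
proof -
  show 1: "1 \<in> S" and d: "\<And>a b. a \<in> S \<Longrightarrow> b \<in> S \<Longrightarrow> a - b \<in> S"
    and "a \<in> S \<Longrightarrow> b \<in> S \<Longrightarrow> a * b \<in> S"
    using assms by (auto simp: is_subring_def)
  show 0: "0 \<in> S" using d[OF 1 1] by simp
  show m: "- a \<in> S" if "a \<in> S" for a using d[OF 0 that] by simp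
  show "a \<in> S \<Longrightarrow> b \<in> S \<Longrightarrow> a + b \<in> S" using d[of a "- b"] m[of b] by simp
qed

lemma subring_power: "is_subring S \<Longrightarrow> a \<in> S \<Longrightarrow> a ^ n \<in> S"
  by (induction n) (auto intro: subring_one subring_mult)

lemma subring_sum: "is_subring S \<Longrightarrow> (\<And>i. i \<in> A \<Longrightarrow> f i \<in> S) \<Longrightarrow> sum f A \<in> S"
  by (induction A rule: infinite_finite_induct) (auto intro: subring_zero subring_add)

lemma ideal_inD:
  assumes "ideal_in S J"
  shows ideal_in_subset: "a \<in> J \<Longrightarrow> a \<in> S"
    and ideal_in_zero: "0 \<in> J"
    and ideal_in_add: "a \<in> J \<Longrightarrow> b \<in> J \<Longrightarrow> a + b \<in> J"
    and ideal_in_mult: "s \<in> S \<Longrightarrow> a \<in> J \<Longrightarrow> s * a \<in> J"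
  using assms by (auto simp: ideal_in_def)

lemma ideal_in_mult': "ideal_in S J \<Longrightarrow> a \<in> J \<Longrightarrow> s \<in> S \<Longrightarrow> a * s \<in> J"
  using ideal_in_mult[of S J s a] by (simp add: mult.commute)

lemma ideal_in_diff:
  "is_subring S \<Longrightarrow> ideal_in S J \<Longrightarrow> a \<in> J \<Longrightarrow> b \<in> J \<Longrightarrow> a - b \<in> J"
  using ideal_in_add[of S J a "- 1 * b"] ideal_in_mult[of S J "-1" b]
  by (simp add: subring_uminus subring_one)

lemma ideal_in_adjoin:
  assumes S: "is_subring S" and J: "ideal_in S J" and a: "a \<in> S"
  shows "ideal_in S {x + s * a | x s. x \<in> J \<and> s \<in> S}"
  unfolding ideal_in_def
proof (intro conjI ballI)
  show "{x + s * a | x s. x \<in> J \<and> s \<in> S} \<subseteq> S"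
    using a by (auto intro: subring_add[OF S] subring_mult[OF S] dest: ideal_in_subset[OF J])
  show "0 \<in> {x + s * a | x s. x \<in> J \<and> s \<in> S}"
    using ideal_in_zero[OF J] subring_zero[OF S] by force
next
  fix y z assume "y \<in> {x + s * a | x s. x \<in> J \<and> s \<in> S}" "z \<in> {x + s * a | x s. x \<in> J \<and> s \<in> S}"
  then obtain x s x' s' where "y = x + s * a" "z = x' + s' * a" "x \<in> J" "x' \<in> J" "s \<in> S" "s' \<in> S"
    by blast
  moreover from this have "y + z = (x + x') + (s + s') * a" by (simp add: algebra_simps)
  ultimately show "y + z \<in> {x + s * a | x s. x \<in> J \<and> s \<in> S}"
    using subring_add[OF S] ideal_in_add[OF J] by blast
next
  fix t y assume "y \<in> {x + s * a | x s. x \<in> J \<and> s \<in> S}" and t: "t \<in> S"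
  then obtain x s where "y = x + s * a" "x \<in> J" "s \<in> S" by blast
  moreover from this have "t * y = t * x + (t * s) * a" by (simp add: algebra_simps)
  ultimately show "t * y \<in> {x + s * a | x s. x \<in> J \<and> s \<in> S}"
    using t subring_mult[OF S] ideal_in_mult[OF J] by blast
qed

text \<open>Krull's argument: an ideal maximal among those that contain \<open>J\<close> and miss
  every power of \<open>f\<close> is prime, since two elements outside it each bring in a power of
  \<open>f\<close>, and the product of these powers falls into the ideal once the product of the
  elements does. Zorn's lemma replaces a chain condition on \<open>S\<close>.\<close>

lemma prime_in_avoiding_powers:
  assumes S: "is_subring S" and J: "ideal_in S J" and f: "f \<in> S" and nJ: "\<And>N. f ^ N \<notin> J"
  shows "\<exists>P. prime_in S P \<and> J \<subseteq> P \<and> f \<notin> P"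
proof -
  define A where "A = {K. ideal_in S K \<and> J \<subseteq> K \<and> (\<forall>N. f ^ N \<notin> K)}"
  have "\<exists>M\<in>A. \<forall>K\<in>A. M \<subseteq> K \<longrightarrow> K = M"
  proof (rule subset_Zorn_nonempty)
    show "A \<noteq> {}" using J nJ by (auto simp: A_def)
  next
    fix C assume C: "C \<noteq> {}" "subset.chain A C"
    have id: "ideal_in S K" if "K \<in> C" for K using C that by (auto simp: subset.chain_def A_def)
    have "ideal_in S (\<Union>C)" unfolding ideal_in_def
    proof (intro conjI ballI)
      show "\<Union>C \<subseteq> S" using id ideal_in_subset by blast
      show "0 \<in> \<Union>C" using C(1) id by (auto simp: ideal_in_def)
    next
      fix a b assume "a \<in> \<Union>C" "b \<in> \<Union>C"
      then obtain K L where KL: "K \<in> C" "L \<in> C" "a \<in> K" "b \<in> L" by blast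
      then consider "K \<subseteq> L" | "L \<subseteq> K" using C(2) by (auto simp: subset.chain_def)
      then show "a + b \<in> \<Union>C" using KL id ideal_in_add by cases blast+
    next
      fix s a assume "s \<in> S" "a \<in> \<Union>C"
      then show "s * a \<in> \<Union>C" using id ideal_in_mult by blast
    qed
    then show "\<Union>C \<in> A" using C by (auto simp: A_def subset.chain_def)
  qed
  then obtain P where P: "P \<in> A" and max: "\<And>K. K \<in> A \<Longrightarrow> P \<subseteq> K \<Longrightarrow> K = P" by blast
  have PI: "ideal_in S P" "J \<subseteq> P" and nP: "\<And>N. f ^ N \<notin> P" using P by (auto simp: A_def)
  \<comment> \<open>Adjoining \<open>a\<close> to \<open>P\<close> gives a strictly larger ideal,
    which by maximality contains a power of \<open>f\<close>.\<close>
  have ex: "\<exists>N x s. x \<in> P \<and> s \<in> S \<and> f ^ N = x + s * a" if a: "a \<in> S" "a \<notin> P" for a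
  proof (rule ccontr)
    assume *: "\<not> ?thesis"
    let ?K = "{x + s * a | x s. x \<in> P \<and> s \<in> S}"
    have sub: "P \<subseteq> ?K"
    proof
      fix x assume "x \<in> P"
      then show "x \<in> ?K" using subring_zero[OF S] by (intro CollectI exI[of _ x] exI[of _ 0]) auto
    qed
    have "?K \<in> A" using * ideal_in_adjoin[OF S PI(1) a(1)] sub PI(2) unfolding A_def by blast
    from max[OF this sub] have "?K = P" .
    moreover have "0 + 1 * a \<in> ?K" using ideal_in_zero[OF PI(1)] subring_one[OF S] by blast
    ultimately show False using a(2) by simp
  qed
  have "a \<in> P \<or> b \<in> P" if ab: "a \<in> S" "b \<in> S" "a * b \<in> P" for a b
  proof (rule ccontr)
    assume "\<not> ?thesis"
    then obtain N x s M y t where 1: "x \<in> P" "s \<in> S" "f ^ N = x + s * a" "y \<in> P" "t \<in> S" "f ^ M = y + t * b"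
      using ex ab by meson
    have "f ^ (N + M) = f ^ M * x + s * a * y + s * t * (a * b)"
      unfolding power_add 1(3) by (subst 1(6)) (simp add: 1(6) algebra_simps)
    also have "\<dots> \<in> P"
      by (intro ideal_in_add[OF PI(1)] ideal_in_mult[OF PI(1)] subring_mult[OF S] subring_power[OF S] 1 ab f)
    finally show False using nP by blast
  qed
  then have "prime_in S P" using PI nP[of 0] by (auto simp: prime_in_def)
  then show ?thesis using PI nP[of 1] by auto
qed

section \<open>Pseudo-division and the elimination of one variable\<close>

definition polys_over :: "'a::comm_ring_1 set \<Rightarrow> 'a poly set" where
  "polys_over S = {q. \<forall>i. coeff q i \<in> S}"

lemma polys_over_monom: "is_subring S \<Longrightarrow> a \<in> S \<Longrightarrow> monom a i \<in> polys_over S"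
  by (auto simp: polys_over_def subring_zero)

lemma polys_over_const: "is_subring S \<Longrightarrow> a \<in> S \<Longrightarrow> [:a:] \<in> polys_over S"
  using polys_over_monom[of S a 0] by (simp add: monom_0)

lemma polys_over_smult: "is_subring S \<Longrightarrow> a \<in> S \<Longrightarrow> q \<in> polys_over S \<Longrightarrow> smult a q \<in> polys_over S"
  by (auto simp: polys_over_def subring_mult)

lemma is_subring_polys_over: "is_subring S \<Longrightarrow> is_subring (polys_over S)"
  unfolding is_subring_def[of "polys_over S"]
  by (auto simp: polys_over_def coeff_mult one_pCons coeff_pCons split: nat.splits
      intro!: subring_diff subring_mult subring_sum subring_zero subring_one)

text \<open>The leading coefficient is not inverted; each round multiplies by it once more. The
  ambient ring may have zero divisors, so the degree of \<open>q * e\<close> does not control that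
  of \<open>q\<close>; the bound on \<open>q\<close> is carried along because the elimination
  argument needs a quotient of small degree.\<close>

lemma pseudo_division_polys_over:
  assumes S: "is_subring S" and e: "e \<in> polys_over S" "e \<noteq> 0" and h: "h \<in> polys_over S"
  shows "\<exists>s q r. q \<in> polys_over S \<and> r \<in> polys_over S \<and> smult (lead_coeff e ^ s) h = q * e + r \<and>
    degree q \<le> degree h - degree e \<and> (r = 0 \<or> degree r < degree e)"
proof -
  note SP = is_subring_polys_over[OF S]
  have *: "\<exists>s q r. q \<in> polys_over S \<and> r \<in> polys_over S \<and> smult (lead_coeff e ^ s) h = q * e + r \<and>
    degree q \<le> degree h - degree e \<and> (r = 0 \<or> degree r < degree e)"
    if "h \<in> polys_over S" "h = 0 \<or> degree h < n" for n h
    using that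
  proof (induction n arbitrary: h)
    case 0
    then show ?case by (intro exI[of _ 0]) (auto simp: subring_zero[OF SP])
  next
    case (Suc n)
    show ?case
    proof (cases "h = 0 \<or> degree h < degree e")
      case True
      then show ?thesis
        using Suc.prems by (intro exI[of _ 0] exI[of _ h]) (auto simp: subring_zero[OF SP])
    next
      case False
      define b where "b = lead_coeff e"
      define M where "M = monom (lead_coeff h) (degree h - degree e)"
      define h' where "h' = smult b h - M * e"
      have bS: "b \<in> S" "lead_coeff h \<in> S" using e Suc.prems by (auto simp: b_def polys_over_def)
      have MS: "M \<in> polys_over S" using bS polys_over_monom[OF S] by (simp add: M_def)
      have h'S: "h' \<in> polys_over S" unfolding h'_def
        using Suc.prems by (intro subring_diff[OF SP] subring_mult[OF SP] polys_over_smult[OF S] bS MS e) auto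
      have degM: "degree M \<le> degree h - degree e" by (simp add: M_def degree_monom_le)
      have dMe: "degree (M * e) \<le> degree h"
        using degree_mult_le[of M e] degM False by linarith
      have top: "coeff h' (degree h) = 0"
      proof -
        have "coeff (M * e) (degree h - degree e + degree e) = lead_coeff h * b"
          unfolding M_def b_def by (subst coeff_monom_mult) (use False in auto)
        then show ?thesis using False by (simp add: h'_def mult.commute)
      qed
      have dh': "degree h' \<le> degree h"
        unfolding h'_def by (rule degree_diff_le) (use dMe degree_smult_le in auto)
      have "h' = 0 \<or> degree h' < degree h"
        using top dh' by (metis leading_coeff_0_iff nless_le)
      then have "h' = 0 \<or> degree h' < n" using Suc.prems False by auto
      from Suc.IH[OF h'S this] obtain s q r where
        *: "q \<in> polys_over S" "r \<in> polys_over S" "smult (b ^ s) h' = q * e + r"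
           "degree q \<le> degree h' - degree e" "r = 0 \<or> degree r < degree e"
        unfolding b_def by blast
      have "smult (b ^ Suc s) h = (q + smult (b ^ s) M) * e + r"
      proof -
        have "smult (b ^ Suc s) h = smult (b ^ s) (h' + M * e)"
          by (simp add: h'_def mult.commute)
        then show ?thesis by (simp add: smult_add_right *(3) algebra_simps)
      qed
      moreover have "degree (q + smult (b ^ s) M) \<le> degree h - degree e"
        using *(4) dh' degM degree_smult_le[of "b ^ s" M] by (intro degree_add_le) linarith+
      moreover have "q + smult (b ^ s) M \<in> polys_over S"
        by (intro subring_add[OF SP] * polys_over_smult[OF S] subring_power[OF S] bS MS)
      ultimately show ?thesis using * unfolding b_def by blast
    qed
  qed
  show ?thesis by (rule *[OF h, of "Suc (degree h)"]) simp
qed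


text \<open>Over a ring of functions the variable is set to the constant function \<open>t\<close>.
  At each point \<open>p\<close> this becomes an ordinary univariate polynomial over the field,
  whose roots can be counted and found.\<close>

lemma poly_map_at_point:
  "poly (map_poly (\<lambda>a. a p) q) t = poly q (\<lambda>_. t) p" for q :: "('x \<Rightarrow> 'k::field) poly"
  by (induction q rule: pCons_induct) (auto simp: map_poly_pCons)

text \<open>Let \<open>Q\<close> be the contraction of \<open>P\<close> to \<open>S\<close>. A zero
  \<open>p\<close> of \<open>Q\<close> lifts to a zero of \<open>P\<close> where \<open>f\<close> is
  nonzero, as long as one element \<alpha> outside \<open>Q\<close> does not vanish at
  \<open>p\<close>. Over the fraction field of \<open>S/Q\<close>, the extension of \<open>P\<close>
  is either zero, when \<alpha> is a coefficient of \<open>f\<close> and almost every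
  \<open>t\<close> will do, or generated by an irreducible \<open>g\<close> coprime to
  \<open>f\<close>, when \<open>t\<close> is a root of \<open>g\<close>. Pseudo-division avoids
  fractions, and \<alpha> collects the denominators.\<close>

lemma prime_extends_over_generic_point:
  fixes S :: "('x \<Rightarrow> 'k::{alg_closed_field, field_char_0}) set"
  assumes S: "is_subring S" and P: "prime_in (polys_over S) P" and f: "f \<in> polys_over S" "f \<notin> P"
  shows "\<exists>\<alpha>\<in>S. [:\<alpha>:] \<notin> P \<and> (\<forall>p. (\<forall>a\<in>S. [:a:] \<in> P \<longrightarrow> a p = 0) \<longrightarrow> \<alpha> p \<noteq> 0 \<longrightarrow>
    (\<exists>t. (\<forall>q\<in>P. poly q (\<lambda>_. t) p = 0) \<and> poly f (\<lambda>_. t) p \<noteq> 0))"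
proof -
  note SP = is_subring_polys_over[OF S]
  have PI: "ideal_in (polys_over S) P" using P by (simp add: prime_in_def)
  have Pprime: "a \<in> P \<or> b \<in> P" if "a \<in> polys_over S" "b \<in> polys_over S" "a * b \<in> P" for a b
    using P that by (auto simp: prime_in_def)
  define Q where "Q = {a \<in> S. [:a:] \<in> P}"
  have Qprime: "a \<in> Q \<or> b \<in> Q" if "a \<in> S" "b \<in> S" "a * b \<in> Q" for a b
    using Pprime[of "[:a:]" "[:b:]"] that polys_over_const[OF S] by (auto simp: Q_def mult.commute)
  have Q1: "1 \<notin> Q" using P by (auto simp: Q_def prime_in_def one_pCons)
  have Qpow: "a \<in> Q" if "a ^ n \<in> Q" "a \<in> S" for a n
    using that
  proof (induction n)
    case (Suc n)
    then show ?case using Qprime[of a "a ^ n"] subring_power[OF S, of a n] unfolding power_Suc by blast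
  qed (use Q1 in auto)
  \<comment> \<open>The ideal of the polynomial ring generated by \<open>Q\<close>; working modulo
    it replaces the passage to coefficients in \<open>S/Q\<close>.\<close>
  define QP where "QP = {q. \<forall>i. coeff q i \<in> Q}"
  have QI: "ideal_in S Q"
    unfolding ideal_in_def
  proof (intro conjI ballI)
    show "0 \<in> Q" using ideal_in_zero[OF PI] subring_zero[OF S] by (simp add: Q_def)
    show "a + b \<in> Q" if "a \<in> Q" "b \<in> Q" for a b
      using that ideal_in_add[OF PI, of "[:a:]" "[:b:]"] subring_add[OF S] by (simp add: Q_def)
    show "s * a \<in> Q" if "s \<in> S" "a \<in> Q" for s a
      using that ideal_in_mult[OF PI polys_over_const[OF S that(1)], of "[:a:]"] subring_mult[OF S]
      by (simp add: Q_def mult.commute)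
  qed (auto simp: Q_def)
  have QPS: "QP \<subseteq> polys_over S" by (auto simp: QP_def Q_def polys_over_def)
  have QPmult: "q * r \<in> QP" if "q \<in> QP" "r \<in> polys_over S" for q r
  proof -
    have sum: "sum g A \<in> Q" if "\<And>i. i \<in> A \<Longrightarrow> g i \<in> Q" for g and A :: "nat set"
      using that by (induction A rule: infinite_finite_induct)
        (auto intro: ideal_in_zero[OF QI] ideal_in_add[OF QI])
    then show ?thesis using that
      by (auto simp: QP_def coeff_mult polys_over_def intro!: sum ideal_in_mult'[OF QI])
  qed
  have QPadd: "q + r \<in> QP" if "q \<in> QP" "r \<in> QP" for q r
    using that by (auto simp: QP_def intro: ideal_in_add[OF QI])
  have QPP: "QP \<subseteq> P"
  proof
    fix q assume q: "q \<in> QP"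
    have "monom (coeff q i) i \<in> P" for i
    proof -
      have "[:coeff q i:] * monom 1 i \<in> P"
        using q by (intro ideal_in_mult'[OF PI] polys_over_monom[OF S] subring_one[OF S]) (auto simp: QP_def Q_def)
      then show ?thesis by (simp add: smult_monom)
    qed
    then have "(\<Sum>i\<in>A. monom (coeff q i) i) \<in> P" for A
      by (induction A rule: infinite_finite_induct) (auto intro: ideal_in_zero[OF PI] ideal_in_add[OF PI])
    then show "q \<in> P" using poly_as_sum_of_monoms[of q] by metis
  qed
  have QPev: "poly q (\<lambda>_. t) p = 0" if "q \<in> QP" "\<forall>a\<in>S. [:a:] \<in> P \<longrightarrow> a p = 0" for q t p
  proof -
    have "coeff q i p = 0" for i using that by (auto simp: QP_def Q_def)
    then have "map_poly (\<lambda>a. a p) q = 0" by (intro poly_eqI) (simp add: coeff_map_poly)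
    then show ?thesis using poly_map_at_point[of p q t] by simp
  qed
  have minimal: "\<exists>g\<in>J - QP. lead_coeff g \<in> S - Q \<and> (\<forall>h\<in>J. degree h < degree g \<longrightarrow> h \<in> QP) \<and>
      (\<forall>h\<in>J. \<exists>s q r. q \<in> polys_over S \<and> r \<in> QP \<and> smult (lead_coeff g ^ s) h = q * g + r \<and>
        degree q \<le> degree h - degree g)"
    if J: "ideal_in (polys_over S) J" and ne: "J - QP \<noteq> {}" and sub: "QP \<subseteq> J" for J
  proof -
    obtain g where g: "g \<in> J - QP" and min: "\<And>h. h \<in> J - QP \<Longrightarrow> degree g \<le> degree h"
      using ne ex_has_least_nat[of "\<lambda>g. g \<in> J - QP" _ degree] by blast
    have gS: "g \<in> polys_over S" using g J by (auto dest: ideal_in_subset)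
    have g0: "g \<noteq> 0" using g ideal_in_zero[OF QI] by (auto simp: QP_def)
    have low: "h \<in> QP" if "h \<in> J" "h = 0 \<or> degree h < degree g" for h
    proof (cases "h = 0")
      case True
      then show ?thesis using ideal_in_zero[OF QI] by (simp add: QP_def)
    next
      case False
      then show ?thesis using that min[of h] by (meson DiffI not_le)
    qed
    have lcS: "lead_coeff g \<in> S" using gS by (auto simp: polys_over_def)
    have lc: "lead_coeff g \<notin> Q"
    proof
      assume lQ: "lead_coeff g \<in> Q"
      define m where "m = monom (lead_coeff g) (degree g)"
      have m: "m \<in> QP" using lQ ideal_in_zero[OF QI] by (auto simp: QP_def m_def)
      have "g - m \<in> J" using g m sub by (intro ideal_in_diff[OF SP J]) auto
      moreover have "g - m = 0 \<or> degree (g - m) < degree g"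
      proof -
        have "degree (g - m) \<le> degree g"
          by (rule degree_diff_le) (auto simp: m_def degree_monom_le)
        moreover have "coeff (g - m) (degree g) = 0" by (simp add: m_def)
        ultimately show ?thesis by (metis leading_coeff_0_iff nless_le)
      qed
      ultimately have "g - m \<in> QP" by (rule low)
      then have "(g - m) + m \<in> QP" using m by (rule QPadd)
      then show False using g by simp
    qed
    have "\<exists>s q r. q \<in> polys_over S \<and> r \<in> QP \<and> smult (lead_coeff g ^ s) h = q * g + r \<and>
        degree q \<le> degree h - degree g" if h: "h \<in> J" for h
    proof -
      obtain s q r where *: "q \<in> polys_over S" "r \<in> polys_over S" "smult (lead_coeff g ^ s) h = q * g + r"
        "degree q \<le> degree h - degree g" "r = 0 \<or> degree r < degree g"
        using pseudo_division_polys_over[OF S gS g0] ideal_in_subset[OF J h] by blast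
      have "r = [:lead_coeff g ^ s:] * h - q * g" using *(3) by simp
      also have "\<dots> \<in> J"
        using g h by (intro ideal_in_diff[OF SP J] ideal_in_mult[OF J] polys_over_const[OF S]
            subring_power[OF S] lcS *) auto
      finally have "r \<in> QP" using low *(5) by blast
      then show ?thesis using * by blast
    qed
    then show ?thesis using g lcS lc low by blast
  qed
  show ?thesis
  proof (cases "P \<subseteq> QP")
    \<comment> \<open>\<open>P\<close> imposes no equation on the new variable: the fibre over a
      zero of \<open>Q\<close> is a whole line, on which \<open>f\<close> is a nonzero polynomial as
      soon as its chosen coefficient is nonzero at \<open>p\<close>.\<close>
    case True
    then obtain i where i: "coeff f i \<notin> Q" using f QPP by (auto simp: QP_def)
    have iS: "coeff f i \<in> S" using f by (auto simp: polys_over_def)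
    show ?thesis
    proof (intro bexI conjI allI impI)
      show "[:coeff f i:] \<notin> P" using i iS by (auto simp: Q_def)
      fix p assume p: "\<forall>a\<in>S. [:a:] \<in> P \<longrightarrow> a p = 0" "coeff f i p \<noteq> 0"
      have "coeff (map_poly (\<lambda>a. a p) f) i \<noteq> 0" using p(2) by (simp add: coeff_map_poly)
      then have "map_poly (\<lambda>a. a p) f \<noteq> 0" by auto
      from poly_roots_finite[OF this] obtain t where "poly (map_poly (\<lambda>a. a p) f) t \<noteq> 0"
        using infinite_UNIV_char_0 by (metis (mono_tags, lifting) UNIV_I ex_new_if_finite mem_Collect_eq)
      then show "\<exists>t. (\<forall>q\<in>P. poly q (\<lambda>_. t) p = 0) \<and> poly f (\<lambda>_. t) p \<noteq> 0"
        using True QPev[OF _ p(1)] unfolding poly_map_at_point by blast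
    qed (rule iS)
  next
    case False
    then have "P - QP \<noteq> {}" by blast
    from minimal[OF PI this QPP] obtain g where g: "g \<in> P - QP" "lead_coeff g \<in> S - Q"
      "\<And>h. h \<in> P \<Longrightarrow> degree h < degree g \<Longrightarrow> h \<in> QP"
      "\<And>h. h \<in> P \<Longrightarrow> \<exists>s q r. q \<in> polys_over S \<and> r \<in> QP \<and> smult (lead_coeff g ^ s) h = q * g + r \<and>
          degree q \<le> degree h - degree g"
      by (elim bexE conjE) (rule that; blast)
    have gS: "g \<in> polys_over S" using g(1) ideal_in_subset[OF PI] by blast
    have dg: "degree g > 0"
    proof (rule ccontr)
      assume "\<not> ?thesis"
      then have "degree g = 0" by simp
      then obtain a where "g = [:a:]" by (auto elim: degree_eq_zeroE)
      then show False using g by (simp add: Q_def)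
    qed
    \<comment> \<open>The ideal generated by \<open>P\<close> and \<open>f\<close>. Its least
      element \<open>e\<close> is a greatest common divisor of \<open>g\<close> and \<open>f\<close>
      over the fraction field, and primality of \<open>P\<close> forces it to be constant.\<close>
    define J where "J = {x + s * f | x s. x \<in> P \<and> s \<in> polys_over S}"
    have JI: "ideal_in (polys_over S) J" unfolding J_def by (rule ideal_in_adjoin[OF SP PI f(1)])
    have PJ: "P \<subseteq> J"
    proof
      fix x assume "x \<in> P"
      then have "x + 0 * f \<in> J" using subring_zero[OF SP] unfolding J_def by blast
      then show "x \<in> J" by simp
    qed
    have fJ: "f \<in> J"
    proof -
      have "0 + 1 * f \<in> J" unfolding J_def using subring_one[OF SP] ideal_in_zero[OF PI] by blast
      then show ?thesis by simp
    qed
    have "J - QP \<noteq> {}" "QP \<subseteq> J" using PJ QPP g(1) by blast+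
    from minimal[OF JI this] obtain e where e: "e \<in> J - QP" "lead_coeff e \<in> S - Q"
      "\<And>h. h \<in> J \<Longrightarrow> \<exists>s q r. q \<in> polys_over S \<and> r \<in> QP \<and> smult (lead_coeff e ^ s) h = q * e + r \<and>
          degree q \<le> degree h - degree e"
      by (elim bexE conjE) (rule that; blast)
    have eS: "e \<in> polys_over S" using e(1) ideal_in_subset[OF JI] by blast
    have powS: "[:lead_coeff e ^ s:] \<in> polys_over S" for s
      using e(2) by (intro polys_over_const[OF S] subring_power[OF S]) auto
    have eP: "e \<notin> P"
    proof
      assume eP: "e \<in> P"
      obtain s q r where *: "q \<in> polys_over S" "r \<in> QP" "smult (lead_coeff e ^ s) f = q * e + r"
        using e(3)[OF fJ] by blast
      have "[:lead_coeff e ^ s:] * f = q * e + r" using * by simp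
      also have "\<dots> \<in> P" using * eP QPP by (intro ideal_in_add[OF PI] ideal_in_mult[OF PI]) auto
      finally have "[:lead_coeff e ^ s:] \<in> P" using Pprime[OF powS f(1)] f(2) by blast
      then have "lead_coeff e ^ s \<in> Q" using e(2) subring_power[OF S] by (auto simp: Q_def)
      then show False using e(2) Qpow by blast
    qed
    \<comment> \<open>If \<open>e\<close> had positive degree, dividing \<open>g\<close> by it would
      give a quotient in \<open>P\<close> of degree below that of \<open>g\<close>, hence in
      \<open>QP\<close>; then a power of the leading coefficient of \<open>e\<close> times that of
      \<open>g\<close> would fall into \<open>Q\<close>.\<close>
    have de: "degree e = 0"
    proof (rule ccontr)
      assume de: "degree e \<noteq> 0"
      obtain s q r where *: "q \<in> polys_over S" "r \<in> QP" "smult (lead_coeff e ^ s) g = q * e + r"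
        "degree q \<le> degree g - degree e"
        using e(3) g(1) PJ by blast
      have "q * e = [:lead_coeff e ^ s:] * g - r" using * by simp
      also have "\<dots> \<in> P" using * g(1) QPP by (intro ideal_in_diff[OF SP PI] ideal_in_mult[OF PI] powS) auto
      finally have "q \<in> P" using Pprime[OF *(1) eS] eP by blast
      then have "q \<in> QP" using g(3) *(4) de dg by auto
      then have "smult (lead_coeff e ^ s) g \<in> QP" using * QPmult eS QPadd by simp
      then have "coeff (smult (lead_coeff e ^ s) g) (degree g) \<in> Q" unfolding QP_def by blast
      then have "lead_coeff e ^ s * lead_coeff g \<in> Q" by simp
      then have "lead_coeff e ^ s \<in> Q \<or> lead_coeff g \<in> Q"
        using Qprime e(2) g(2) subring_power[OF S] by blast
      then show False using Qpow e(2) g(2) by blast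
    qed
    then obtain b where b: "e = [:b:]" by (auto elim: degree_eq_zeroE)
    obtain u w where uw: "e = u + w * f" "u \<in> P" "w \<in> polys_over S" using e(1) by (auto simp: J_def)
    \<comment> \<open>\<open>a p \<noteq> 0\<close> keeps the degree of \<open>g\<close> positive at
      \<open>p\<close>, so that a root \<open>t\<close> exists; \<open>b p \<noteq> 0\<close> keeps
      \<open>f\<close> away from zero there, since the constant \<open>b\<close> is a multiple of
      \<open>f\<close> modulo \<open>P\<close>.\<close>
    define a where "a = lead_coeff g"
    have ab: "a \<in> S" "b \<in> S" "a \<notin> Q" "b \<notin> Q" using e(2) g(2) b by (auto simp: a_def)
    show ?thesis
    proof (intro bexI conjI allI impI)
      show abS: "a * b \<in> S" using ab subring_mult[OF S] by blast
      show "[:a * b:] \<notin> P" using ab Qprime[of a b] abS by (auto simp: Q_def)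
      fix p assume p: "\<forall>a\<in>S. [:a:] \<in> P \<longrightarrow> a p = 0" "(a * b) p \<noteq> 0"
      have ap: "a p \<noteq> 0" "b p \<noteq> 0" using p(2) by auto
      have "coeff (map_poly (\<lambda>a. a p) g) (degree g) \<noteq> 0" using ap by (simp add: coeff_map_poly a_def)
      then have "degree (map_poly (\<lambda>a. a p) g) > 0" using dg le_degree by fastforce
      then obtain t where "poly (map_poly (\<lambda>a. a p) g) t = 0"
        using alg_closed_imp_poly_has_root by blast
      then have t: "poly g (\<lambda>_. t) p = 0" by (simp add: poly_map_at_point)
      have van: "poly q (\<lambda>_. t) p = 0" if "q \<in> P" for q
      proof -
        obtain s c r where *: "r \<in> QP" "smult (a ^ s) q = c * g + r" using g(4)[OF \<open>q \<in> P\<close>] a_def by blast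
        have "poly (smult (a ^ s) q) (\<lambda>_. t) p = 0" unfolding *(2) using t QPev[OF *(1) p(1)] by simp
        moreover have "(a ^ s) p \<noteq> 0" using ap by (induction s) auto
        ultimately show ?thesis by simp
      qed
      have "poly e (\<lambda>_. t) p \<noteq> 0" using ap b by simp
      then have "poly f (\<lambda>_. t) p \<noteq> 0" using uw van by auto
      then show "\<exists>t. (\<forall>q\<in>P. poly q (\<lambda>_. t) p = 0) \<and> poly f (\<lambda>_. t) p \<noteq> 0" using van by blast
    qed
  qed
qed

section \<open>Polynomial functions and the zeros of their prime ideals\<close>

inductive_set poly_funs :: "'v set \<Rightarrow> (('v \<Rightarrow> 'k::comm_ring_1) \<Rightarrow> 'k) set" for V where
  const: "(\<lambda>_. c) \<in> poly_funs V"
| coord: "v \<in> V \<Longrightarrow> (\<lambda>p. p v) \<in> poly_funs V"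
| add: "f \<in> poly_funs V \<Longrightarrow> g \<in> poly_funs V \<Longrightarrow> (\<lambda>p. f p + g p) \<in> poly_funs V"
| mult: "f \<in> poly_funs V \<Longrightarrow> g \<in> poly_funs V \<Longrightarrow> (\<lambda>p. f p * g p) \<in> poly_funs V"

lemma is_subring_poly_funs: "is_subring (poly_funs V)"
  unfolding is_subring_def
proof (intro conjI ballI)
  show "1 \<in> poly_funs V" using poly_funs.const[of 1] by (simp add: one_fun_def)
  fix f g :: "('a \<Rightarrow> 'b) \<Rightarrow> 'b" assume fg: "f \<in> poly_funs V" "g \<in> poly_funs V"
  show "f * g \<in> poly_funs V" using poly_funs.mult[OF fg] by (simp add: times_fun_def)
  have "(\<lambda>p. f p + (\<lambda>_. - 1) p * g p) \<in> poly_funs V" by (intro poly_funs.intros fg)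
  moreover have "(\<lambda>p. f p + (\<lambda>_. - 1) p * g p) = f - g" by (auto simp: fun_eq_iff)
  ultimately show "f - g \<in> poly_funs V" by simp
qed

lemma poly_funs_update: "f \<in> poly_funs V \<Longrightarrow> v \<notin> V \<Longrightarrow> f (p(v := t)) = f p"
  by (induction rule: poly_funs.induct) auto

lemma poly_funs_mono: "f \<in> poly_funs V \<Longrightarrow> V \<subseteq> U \<Longrightarrow> f \<in> poly_funs U"
  by (induction rule: poly_funs.induct) (auto intro: poly_funs.intros)

lemma poly_at_coord:
  assumes "q \<in> polys_over (poly_funs V)" "v \<notin> V"
  shows "poly q (\<lambda>p. p v) (p(v := t)) = poly q (\<lambda>_. t) p"
  using assms(1)
proof (induction q rule: pCons_induct)
  case (pCons a q)
  have "coeff (pCons a q) i \<in> poly_funs V" for i using pCons.prems by (auto simp: polys_over_def)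
  from this[of 0] this[of "Suc _"] have "a \<in> poly_funs V" "q \<in> polys_over (poly_funs V)"
    by (auto simp: polys_over_def)
  then show ?case using pCons.IH poly_funs_update[OF _ assms(2)] by (simp del: fun_upd_apply) simp
qed simp

text \<open>Presents the ring with one more coordinate as the image of the univariate polynomials
  over the ring in \<open>V\<close>, the variable going to coordinate \<open>v\<close>. Prime ideals
  are pulled back along this map.\<close>

lemma poly_funs_insert_iff:
  "f \<in> poly_funs (insert v V) \<longleftrightarrow> (\<exists>q\<in>polys_over (poly_funs V). f = poly q (\<lambda>p. p v))"
    (is "_ \<longleftrightarrow> ?R f")
proof
  note S = is_subring_poly_funs[of V]
  note SP = is_subring_polys_over[OF S]
  show "?R f" if "f \<in> poly_funs (insert v V)" using that
  proof (induction rule: poly_funs.induct)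
    case (const c)
    show ?case by (rule bexI[of _ "[:\<lambda>_. c:]"]) (auto intro: polys_over_const[OF S] poly_funs.const)
  next
    case (coord u)
    show ?case
    proof (cases "u = v")
      case True
      then show ?thesis
        by (intro bexI[of _ "monom 1 1"]) (auto intro: polys_over_monom[OF S] subring_one[OF S] simp: poly_monom)
    next
      case False
      then show ?thesis using coord
        by (intro bexI[of _ "[:\<lambda>p. p u:]"]) (auto intro!: polys_over_const[OF S] poly_funs.coord)
    qed
  next
    case (add f g)
    then obtain q r where "q \<in> polys_over (poly_funs V)" "r \<in> polys_over (poly_funs V)"
      "f = poly q (\<lambda>p. p v)" "g = poly r (\<lambda>p. p v)" by blast
    then show ?case
      by (intro bexI[of _ "q + r"]) (auto simp: fun_eq_iff intro: subring_add[OF SP])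
  next
    case (mult f g)
    then obtain q r where "q \<in> polys_over (poly_funs V)" "r \<in> polys_over (poly_funs V)"
      "f = poly q (\<lambda>p. p v)" "g = poly r (\<lambda>p. p v)" by blast
    then show ?case
      by (intro bexI[of _ "q * r"]) (auto simp: fun_eq_iff intro: subring_mult[OF SP])
  qed
  assume "?R f"
  then obtain q where q: "q \<in> polys_over (poly_funs V)" "f = poly q (\<lambda>p. p v)" by blast
  show "f \<in> poly_funs (insert v V)" unfolding q(2) poly_altdef
    using q(1) by (intro subring_sum subring_mult subring_power is_subring_poly_funs poly_funs.coord)
      (auto simp: polys_over_def intro: poly_funs_mono)
qed

text \<open>Induction on the coordinates: \<open>P\<close> is pulled back to univariate polynomials,
  its contraction \<open>Q\<close> has a zero where \<alpha> does not vanish, and this zero lifts.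
  Carrying a function \<open>f\<close> outside \<open>P\<close> makes the induction work, because
  lifting has to avoid the zeros of \<alpha>. Without coordinates the ring is the field and
  \<open>P\<close> is zero.\<close>

lemma prime_in_poly_funs_has_point:
  fixes P :: "(('v \<Rightarrow> 'k::{alg_closed_field, field_char_0}) \<Rightarrow> 'k) set"
  assumes "finite V" "prime_in (poly_funs V) P" "f \<in> poly_funs V" "f \<notin> P"
  shows "\<exists>p. (\<forall>g\<in>P. g p = 0) \<and> f p \<noteq> 0"
  using assms
proof (induction V arbitrary: P f rule: finite_induct)
  case empty
  have c: "\<exists>c. g = (\<lambda>_. c)" if "g \<in> poly_funs {}" for g :: "('v \<Rightarrow> 'k) \<Rightarrow> 'k"
    using that by (induction rule: poly_funs.induct) auto
  have PI: "ideal_in (poly_funs {}) P" using empty.prems by (simp add: prime_in_def)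
  have "g p = 0" if g: "g \<in> P" for g p
  proof (rule ccontr)
    assume "g p \<noteq> 0"
    obtain c where c: "g = (\<lambda>_. c)" using g ideal_in_subset[OF PI] c by blast
    have "(\<lambda>_. inverse c) * g \<in> P" by (intro ideal_in_mult[OF PI] g poly_funs.const)
    moreover have "(\<lambda>_. inverse c) * g = 1" using c \<open>g p \<noteq> 0\<close> by (auto simp: fun_eq_iff)
    ultimately show False using empty.prems by (simp add: prime_in_def)
  qed
  moreover have "f \<noteq> 0" using empty.prems ideal_in_zero[OF PI] by auto
  then have "\<exists>p. f p \<noteq> 0" by (auto simp: fun_eq_iff)
  ultimately show ?case by blast
next
  case (insert v V)
  note S = is_subring_poly_funs[of V]
  note SP = is_subring_polys_over[OF S]
  define ev where "ev = (\<lambda>q::(('v \<Rightarrow> 'k) \<Rightarrow> 'k) poly. poly q (\<lambda>p. p v))"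
  have ev: "ev (q + r) = ev q + ev r" "ev (q * r) = ev q * ev r" "ev 0 = 0" "ev 1 = 1" "ev [:a:] = a" for q r a
    by (auto simp: ev_def)
  have evS: "ev q \<in> poly_funs (insert v V)" if "q \<in> polys_over (poly_funs V)" for q
    using that poly_funs_insert_iff[of _ v V] ev_def by blast
  define P' where "P' = {q \<in> polys_over (poly_funs V). ev q \<in> P}"
  have PI: "ideal_in (poly_funs (insert v V)) P" using insert.prems by (simp add: prime_in_def)
  have prime: "prime_in (polys_over (poly_funs V)) P'"
    unfolding prime_in_def ideal_in_def
  proof (intro conjI ballI impI)
    show "1 \<notin> P'" using insert.prems by (auto simp: P'_def ev prime_in_def)
    show "a \<in> P' \<or> b \<in> P'" if "a \<in> polys_over (poly_funs V)" "b \<in> polys_over (poly_funs V)" "a * b \<in> P'" for a b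
      using that insert.prems(1) evS by (auto simp: P'_def ev prime_in_def)
  qed (auto simp: P'_def ev subring_zero[OF SP] subring_add[OF SP] subring_mult[OF SP] evS
      intro: ideal_in_zero[OF PI] ideal_in_add[OF PI] ideal_in_mult[OF PI])
  obtain f' where f': "f' \<in> polys_over (poly_funs V)" "f = ev f'"
    using insert.prems poly_funs_insert_iff[of f v V] unfolding ev_def by blast
  then have "f' \<notin> P'" using insert.prems by (auto simp: P'_def)
  from prime_extends_over_generic_point[OF S prime f'(1) this] obtain \<alpha> where
    \<alpha>: "\<alpha> \<in> poly_funs V" "[:\<alpha>:] \<notin> P'"
    "\<And>p. (\<forall>a\<in>poly_funs V. [:a:] \<in> P' \<longrightarrow> a p = 0) \<Longrightarrow> \<alpha> p \<noteq> 0 \<Longrightarrow>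
      (\<exists>t. (\<forall>q\<in>P'. poly q (\<lambda>_. t) p = 0) \<and> poly f' (\<lambda>_. t) p \<noteq> 0)" by blast
  define Q where "Q = P \<inter> poly_funs V"
  have mono: "a \<in> poly_funs (insert v V)" if "a \<in> poly_funs V" for a :: "('v \<Rightarrow> 'k) \<Rightarrow> 'k"
    using poly_funs_mono[OF that] by blast
  have cP: "[:a:] \<in> P' \<longleftrightarrow> a \<in> Q" if "a \<in> poly_funs V" for a
    using that polys_over_const[OF S] by (auto simp: P'_def Q_def ev)
  have "prime_in (poly_funs V) Q"
    using insert.prems(1) mono subringD[OF S] unfolding prime_in_def ideal_in_def Q_def by auto
  moreover have "\<alpha> \<notin> Q" using \<alpha> cP by blast
  ultimately obtain p where p: "\<forall>g\<in>Q. g p = 0" "\<alpha> p \<noteq> 0" using insert.IH \<alpha>(1) by blast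
  have "\<forall>a\<in>poly_funs V. [:a:] \<in> P' \<longrightarrow> a p = 0" using p cP by blast
  from \<alpha>(3)[OF this p(2)] obtain t where
    t: "\<And>q. q \<in> P' \<Longrightarrow> poly q (\<lambda>_. t) p = 0" "poly f' (\<lambda>_. t) p \<noteq> 0" by blast
  have "g (p(v := t)) = 0" if g: "g \<in> P" for g
  proof -
    obtain q where q: "q \<in> polys_over (poly_funs V)" "g = ev q"
      using ideal_in_subset[OF PI g] poly_funs_insert_iff[of g v V] unfolding ev_def by blast
    then have "q \<in> P'" using g by (simp add: P'_def)
    then show ?thesis using t(1) poly_at_coord[OF q(1) insert.hyps(2)] q(2) by (simp add: ev_def)
  qed
  moreover have "f (p(v := t)) \<noteq> 0"
    using t(2) poly_at_coord[OF f'(1) insert.hyps(2)] f'(2) by (simp add: ev_def)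
  ultimately show ?case by blast
qed

text \<open>If no power of \<open>f\<close> lay in the ideal \<open>J\<close> generated by
  \<open>G\<close>, a prime ideal over \<open>J\<close> would avoid \<open>f\<close> and have a zero
  where \<open>f\<close> does not vanish. The set \<open>G\<close> may be infinite; \<open>N\<close>
  may come out as 0, which happens only if \<open>J\<close> is the whole ring.\<close>

theorem Nullstellensatz_poly_funs:
  fixes f :: "('v \<Rightarrow> 'k::{alg_closed_field, field_char_0}) \<Rightarrow> 'k"
  assumes V: "finite V" and G: "G \<subseteq> poly_funs V" and f: "f \<in> poly_funs V"
    and van: "\<And>p. (\<And>g. g \<in> G \<Longrightarrow> g p = 0) \<Longrightarrow> f p = 0"
  shows "\<exists>N T r. finite T \<and> T \<subseteq> G \<and> (\<forall>g\<in>T. r g \<in> poly_funs V) \<and> (\<forall>p. f p ^ N = (\<Sum>g\<in>T. g p * r g p))"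
proof -
  note S = is_subring_poly_funs[of V]
  define J where "J = {h. \<exists>T r. finite T \<and> T \<subseteq> G \<and> (\<forall>g\<in>T. r g \<in> poly_funs V) \<and> h = (\<Sum>g\<in>T. g * r g)}"
  have GJ: "G \<subseteq> J"
  proof
    fix g assume "g \<in> G"
    then show "g \<in> J" unfolding J_def
      by (intro CollectI exI[of _ "{g}"] exI[of _ "\<lambda>_. 1"]) (auto intro: subring_one[OF S])
  qed
  have J: "ideal_in (poly_funs V) J"
    unfolding ideal_in_def
  proof (intro conjI ballI)
    show "J \<subseteq> poly_funs V"
      using G unfolding J_def by (auto intro!: subring_sum[OF S] subring_mult[OF S])
    show "0 \<in> J" unfolding J_def by (intro CollectI exI[of _ "{}"]) auto
  next
    fix a b :: "('v \<Rightarrow> 'k) \<Rightarrow> 'k" assume "a \<in> J" "b \<in> J"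
    then obtain T r U s where *: "finite T" "T \<subseteq> G" "\<forall>g\<in>T. r g \<in> poly_funs V" "a = (\<Sum>g\<in>T. g * r g)"
      "finite U" "U \<subseteq> G" "\<forall>g\<in>U. s g \<in> poly_funs V" "b = (\<Sum>g\<in>U. g * s g)"
      by (auto simp: J_def)
    \<comment> \<open>A function in both \<open>T\<close> and \<open>U\<close> has to receive the
      sum of its two coefficients.\<close>
    define w where "w = (\<lambda>g. (if g \<in> T then r g else 0) + (if g \<in> U then s g else 0))"
    have "a = (\<Sum>g\<in>T \<union> U. g * (if g \<in> T then r g else 0))" unfolding *(4)
      using *(1,5) by (intro sum.mono_neutral_cong_left) auto
    moreover have "b = (\<Sum>g\<in>T \<union> U. g * (if g \<in> U then s g else 0))" unfolding *(8)
      using *(1,5) by (intro sum.mono_neutral_cong_left) auto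
    ultimately have "a + b = (\<Sum>g\<in>T \<union> U. g * w g)"
      by (simp add: w_def distrib_left sum.distrib)
    moreover have "\<forall>g\<in>T \<union> U. w g \<in> poly_funs V"
      using * by (auto simp: w_def intro!: subring_add[OF S] subring_zero[OF S])
    ultimately show "a + b \<in> J" unfolding J_def using *
      by (intro CollectI exI[of _ "T \<union> U"] exI[of _ w]) auto
  next
    fix s a :: "('v \<Rightarrow> 'k) \<Rightarrow> 'k" assume s: "s \<in> poly_funs V" and "a \<in> J"
    then obtain T r where *: "finite T" "T \<subseteq> G" "\<forall>g\<in>T. r g \<in> poly_funs V" "a = (\<Sum>g\<in>T. g * r g)"
      by (auto simp: J_def)
    then have "s * a = (\<Sum>g\<in>T. g * (s * r g))" by (simp add: sum_distrib_left algebra_simps)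
    then show "s * a \<in> J" unfolding J_def using * s
      by (intro CollectI exI[of _ T] exI[of _ "\<lambda>g. s * r g"]) (auto intro: subring_mult[OF S])
  qed
  have "\<exists>N. f ^ N \<in> J"
  proof (rule ccontr)
    assume "\<not> ?thesis"
    then obtain P where P: "prime_in (poly_funs V) P" "J \<subseteq> P" "f \<notin> P"
      using prime_in_avoiding_powers[OF S J f] by blast
    from prime_in_poly_funs_has_point[OF V P(1) f P(3)] show False using GJ P(2) van by blast
  qed
  then obtain N T r where *: "finite T" "T \<subseteq> G" "\<forall>g\<in>T. r g \<in> poly_funs V" "f ^ N = (\<Sum>g\<in>T. g * r g)"
    by (auto simp: J_def)
  have "f p ^ N = (\<Sum>g\<in>T. g p * r g p)" for p
  proof -
    have "(f ^ N) p = f p ^ N" by (induction N) auto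
    moreover have "(\<Sum>g\<in>T. g * r g) p = (\<Sum>g\<in>T. g p * r g p)"
      using *(1) by (induction T rule: finite_induct) auto
    ultimately show ?thesis using *(4) by simp
  qed
  then show ?thesis using * by blast
qed

section \<open>Function rings on affine space and on the torus\<close>

type_synonym 'k valuation = "nat + nat \<Rightarrow> 'k"

text \<open>
  \<open>E\<close> is the range of a coordinate and \<open>pw t e\<close> the power \<open>t\<^sup>e\<close>; case S is \<open>E = UNIV\<close>, \<open>\<epsilon> = -1\<close>, case L is
  \<open>E = - {0}\<close>, \<open>\<epsilon> = 1\<close>.
\<close>

locale point_functions =
  fixes E :: "'k::{alg_closed_field, field_char_0} set"
    and pw :: "'k \<Rightarrow> 'e::comm_semiring_1 \<Rightarrow> 'k"
    and \<epsilon> :: 'k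
  assumes eps_sq: "\<epsilon> * \<epsilon> = 1"
    and pw_0: "pw t 0 = 1"
    and pw_1: "pw t 1 = t"
    and pw_add: "t \<in> E \<Longrightarrow> pw t (a + b) = pw t a * pw t b"
    and pw_mult: "pw (s * t) e = pw s e * pw t e"
    and pw_indep: "finite S \<Longrightarrow> infinite {t \<in> E. (\<Sum>e\<in>S. c e * pw t e) = 0} \<Longrightarrow> e \<in> S \<Longrightarrow> c e = 0"
    and pw_diff: "\<exists>A c a b. finite (A :: nat set) \<and>
      (\<forall>s\<in>E. \<forall>t\<in>E. pw t e - pw s e = (t - s) * (\<Sum>i\<in>A. c i * pw t (a i) * pw s (b i)))"
    and E_cases: "E = UNIV \<and> (\<forall>e. \<exists>n. \<forall>t. pw t e = t ^ n) \<or>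
      E = - {0} \<and> (\<exists>e. \<forall>t\<in>E. pw t e * t = 1) \<and> (\<forall>e. \<exists>K n. \<forall>t\<in>E. t ^ K * pw t e = t ^ n)"
begin

lemma E_mult: "s \<in> E \<Longrightarrow> t \<in> E \<Longrightarrow> s * t \<in> E"
  using E_cases by auto

lemma one_E: "1 \<in> E"
  using E_cases by auto

lemma eps_E: "\<epsilon> \<in> E"
  using E_cases eps_sq by auto

lemma infinite_E: "infinite E"
  using E_cases infinite_UNIV_char_0[where 'a = 'k] by (auto simp: Compl_eq_Diff_UNIV)

text \<open>Every variable gets a value in \<open>E\<close>, also one that does not occur in the
  functions considered, so that changing or permuting coordinates never leaves \<open>pts\<close>.
  Points of X itself reappear only in the final correspondence.\<close>

definition pts :: "'k valuation set" where
  "pts = {p. \<forall>v. p v \<in> E}"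

lemma pts_update: "p \<in> pts \<Longrightarrow> t \<in> E \<Longrightarrow> p(v := t) \<in> pts"
  by (auto simp: pts_def)

lemma pts_comp: "p \<in> pts \<Longrightarrow> p \<circ> \<pi> \<in> pts"
  by (auto simp: pts_def)

lemma pts_E: "p \<in> pts \<Longrightarrow> p v \<in> E"
  by (auto simp: pts_def)

text \<open>Only the values on \<open>pts\<close> matter, which rule \<open>ext\<close> builds into the definition.\<close>

inductive_set RF :: "(nat + nat) set \<Rightarrow> ('k valuation \<Rightarrow> 'k) set" for V where
  const: "(\<lambda>_. c) \<in> RF V"
| gen: "v \<in> V \<Longrightarrow> (\<lambda>p. pw (p v) e) \<in> RF V"
| add: "f \<in> RF V \<Longrightarrow> g \<in> RF V \<Longrightarrow> (\<lambda>p. f p + g p) \<in> RF V"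
| mult: "f \<in> RF V \<Longrightarrow> g \<in> RF V \<Longrightarrow> (\<lambda>p. f p * g p) \<in> RF V"
| ext: "f \<in> RF V \<Longrightarrow> (\<And>p. p \<in> pts \<Longrightarrow> g p = f p) \<Longrightarrow> g \<in> RF V"

lemma RF_coord: "v \<in> V \<Longrightarrow> (\<lambda>p. p v) \<in> RF V"
  using RF.gen[of v V 1] by (simp add: pw_1)

lemma RF_uminus: "f \<in> RF V \<Longrightarrow> (\<lambda>p. - f p) \<in> RF V"
  using RF.mult[OF RF.const[of "-1"], of f V] by simp

lemma RF_diff: "f \<in> RF V \<Longrightarrow> g \<in> RF V \<Longrightarrow> (\<lambda>p. f p - g p) \<in> RF V"
  using RF.add[OF _ RF_uminus, of f V g] by simp

lemma RF_sum: "(\<And>i. i \<in> A \<Longrightarrow> f i \<in> RF V) \<Longrightarrow> (\<lambda>p. \<Sum>i\<in>A. f i p) \<in> RF V"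
  by (induction A rule: infinite_finite_induct) (auto intro: RF.const RF.add)

lemma RF_prod: "(\<And>i. i \<in> A \<Longrightarrow> f i \<in> RF V) \<Longrightarrow> (\<lambda>p. \<Prod>i\<in>A. f i p) \<in> RF V"
  by (induction A rule: infinite_finite_induct) (auto intro: RF.const RF.mult)

lemma RF_power: "f \<in> RF V \<Longrightarrow> (\<lambda>p. f p ^ n) \<in> RF V"
  by (induction n) (auto intro: RF.const RF.mult)

lemmas RF_intros = RF.const RF_coord RF.add RF.mult RF_diff RF_uminus RF_sum RF_prod RF_power

lemma RF_mono: "f \<in> RF V \<Longrightarrow> V \<subseteq> U \<Longrightarrow> f \<in> RF U"
  by (induction rule: RF.induct) (auto intro: RF.intros)

lemma RF_cong:
  assumes "f \<in> RF V" "p \<in> pts" "q \<in> pts" "\<And>v. v \<in> V \<Longrightarrow> p v = q v"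
  shows "f p = f q"
  using assms by (induction rule: RF.induct) auto

text \<open>A variable may become a constant or a scalar multiple of a variable, because
  \<open>pw\<close> is multiplicative in its base; a sum of variables could not be put under a
  negative power. Permutations, the substitution \<open>p a := c * p b\<close> and the restriction
  map all have this shape.\<close>

lemma RF_subst:
  assumes "f \<in> RF V" and pts: "\<And>p. p \<in> pts \<Longrightarrow> \<theta> p \<in> pts"
    and \<theta>: "\<And>v. v \<in> V \<Longrightarrow> (\<exists>c. \<forall>p\<in>pts. \<theta> p v = c) \<or> (\<exists>c. \<exists>u\<in>U. \<forall>p\<in>pts. \<theta> p v = c * p u)"
  shows "(\<lambda>p. f (\<theta> p)) \<in> RF U"
  using assms(1)
proof (induction rule: RF.induct)
  case (gen v e)
  from \<theta>[OF gen] show ?case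
  proof (elim disjE exE bexE)
    fix c assume "\<forall>p\<in>pts. \<theta> p v = c"
    then show ?thesis by (intro RF.ext[OF RF.const[of "pw c e"]]) auto
  next
    fix c u assume "u \<in> U" "\<forall>p\<in>pts. \<theta> p v = c * p u"
    then show ?thesis
      by (intro RF.ext[OF RF.mult[OF RF.const[of "pw c e"] RF.gen[of u U e]]]) (auto simp: pw_mult)
  qed
next
  case (ext f g)
  then show ?case using pts by (intro RF.ext[OF ext.IH]) auto
qed (auto intro: RF.intros)

lemma RF_comp:
  assumes "f \<in> RF V" "\<pi> ` V \<subseteq> U"
  shows "(\<lambda>p. f (p \<circ> \<pi>)) \<in> RF U"
proof (rule RF_subst[OF assms(1)])
  show "(\<exists>c. \<forall>p\<in>pts. (p \<circ> \<pi>) v = c) \<or> (\<exists>c. \<exists>u\<in>U. \<forall>p\<in>pts. (p \<circ> \<pi>) v = c * p u)"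
    if "v \<in> V" for v
    using that assms(2) by (intro disjI2 exI[of _ 1] bexI[of _ "\<pi> v"]) auto
qed (auto simp: pts_comp)

lemma RF_update_coord:
  assumes "f \<in> RF V" "b \<in> U" "V - {a} \<subseteq> U" "c \<in> E"
  shows "(\<lambda>p. f (p(a := c * p b))) \<in> RF U"
proof (rule RF_subst[OF assms(1)])
  show "(\<exists>d. \<forall>p\<in>pts. (p(a := c * p b)) v = d) \<or> (\<exists>d. \<exists>u\<in>U. \<forall>p\<in>pts. (p(a := c * p b)) v = d * p u)"
    if "v \<in> V" for v
  proof (cases "v = a")
    case True
    then show ?thesis using assms(2) by auto
  next
    case False
    then show ?thesis using assms(3) that by (intro disjI2 exI[of _ 1] bexI[of _ v]) auto
  qed
qed (auto intro: pts_update E_mult pts_E assms)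

text \<open>Along a coordinate line every function is a finite combination of powers, to which
  \<open>pw_indep\<close> applies: infinitely many zeros force all coefficients to vanish.\<close>

lemma RF_univariate:
  assumes "f \<in> RF V" "p \<in> pts"
  shows "\<exists>S c. finite S \<and> (\<forall>t\<in>E. f (p(v := t)) = (\<Sum>e\<in>S. c e * pw t e))"
  using assms
proof (induction rule: RF.induct)
  case (const c)
  show ?case by (intro exI[of _ "{0}"] exI[of _ "\<lambda>_. c"]) (auto simp: pw_0)
next
  case (gen u e)
  show ?case
  proof (cases "u = v")
    case True
    then show ?thesis by (intro exI[of _ "{e}"] exI[of _ "\<lambda>_. 1"]) auto
  next
    case False
    then show ?thesis by (intro exI[of _ "{0}"] exI[of _ "\<lambda>_. pw (p u) e"]) (auto simp: pw_0)
  qed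
next
  case (add f g)
  then obtain S c T d where *: "finite S" "finite T"
    "\<forall>t\<in>E. f (p(v := t)) = (\<Sum>e\<in>S. c e * pw t e)" "\<forall>t\<in>E. g (p(v := t)) = (\<Sum>e\<in>T. d e * pw t e)"
    by blast
  define h where "h = (\<lambda>e. (if e \<in> S then c e else 0) + (if e \<in> T then d e else 0))"
  have "f (p(v := t)) + g (p(v := t)) = (\<Sum>e\<in>S \<union> T. h e * pw t e)" if "t \<in> E" for t
  proof -
    have "(\<Sum>e\<in>S. c e * pw t e) = (\<Sum>e\<in>S \<union> T. (if e \<in> S then c e else 0) * pw t e)"
      using * by (intro sum.mono_neutral_cong_left) auto
    moreover have "(\<Sum>e\<in>T. d e * pw t e) = (\<Sum>e\<in>S \<union> T. (if e \<in> T then d e else 0) * pw t e)"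
      using * by (intro sum.mono_neutral_cong_left) auto
    ultimately show ?thesis using * that by (simp add: h_def distrib_right sum.distrib del: fun_upd_apply)
  qed
  moreover have "finite (S \<union> T)" using * by simp
  ultimately show ?case by blast
next
  case (mult f g)
  then obtain S c T d where *: "finite S" "finite T"
    "\<forall>t\<in>E. f (p(v := t)) = (\<Sum>e\<in>S. c e * pw t e)" "\<forall>t\<in>E. g (p(v := t)) = (\<Sum>e\<in>T. d e * pw t e)"
    by blast
  define R where "R = (\<lambda>(a, b). a + b) ` (S \<times> T)"
  define h where "h = (\<lambda>e. \<Sum>(a, b)\<in>{x \<in> S \<times> T. (case x of (a, b) \<Rightarrow> a + b) = e}. c a * d b)"
  have "f (p(v := t)) * g (p(v := t)) = (\<Sum>e\<in>R. h e * pw t e)" if t: "t \<in> E" for t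
  proof -
    have "f (p(v := t)) * g (p(v := t)) = (\<Sum>a\<in>S. c a * pw t a) * (\<Sum>b\<in>T. d b * pw t b)"
      using * t by (simp del: fun_upd_apply)
    also have "\<dots> = (\<Sum>(a, b)\<in>S \<times> T. c a * d b * pw t (a + b))"
      by (simp add: sum_product sum.cartesian_product pw_add[OF t] algebra_simps)
    also have "\<dots> = (\<Sum>e\<in>R. \<Sum>(a, b)\<in>{x \<in> S \<times> T. (case x of (a, b) \<Rightarrow> a + b) = e}. c a * d b * pw t (a + b))"
      unfolding R_def using * by (intro sum.image_gen) auto
    also have "\<dots> = (\<Sum>e\<in>R. h e * pw t e)"
      unfolding h_def sum_distrib_right by (intro sum.cong) auto
    finally show ?thesis .
  qed
  moreover have "finite R" using * by (simp add: R_def)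
  ultimately show ?case by blast
next
  case (ext f g)
  then show ?case by (metis pts_update)
qed

lemma RF_finite_zeros:
  assumes f: "f \<in> RF V" and p: "p \<in> pts" "f p \<noteq> 0"
  shows "finite {t \<in> E. f (p(v := t)) = 0}"
proof (rule ccontr)
  assume inf: "infinite {t \<in> E. f (p(v := t)) = 0}"
  obtain S c where *: "finite S" "\<And>t. t \<in> E \<Longrightarrow> f (p(v := t)) = (\<Sum>e\<in>S. c e * pw t e)"
    using RF_univariate[OF f p(1), of v] by blast
  have "{t \<in> E. f (p(v := t)) = 0} = {t \<in> E. (\<Sum>e\<in>S. c e * pw t e) = 0}"
    by (intro Collect_cong conj_cong refl) (simp only: *(2))
  then have inf': "infinite {t \<in> E. (\<Sum>e\<in>S. c e * pw t e) = 0}" using inf by argo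
  have "c e = 0" if "e \<in> S" for e by (rule pw_indep[OF *(1) inf' that])
  then have "f (p(v := p v)) = 0" unfolding *(2)[OF pts_E[OF p(1), of v]] by (intro sum.neutral) simp
  then show False using p by (simp only: fun_upd_triv)
qed

text \<open>A point where \<open>f\<close> is nonzero and one where \<open>g\<close> is nonzero are
  moved together, one coordinate at a time: the common new value only has to avoid finitely many
  zeros on each of two lines. So \<open>RF V\<close>, seen on \<open>pts\<close>, has no zero
  divisors.\<close>

lemma RF_domain:
  assumes "finite V" and f: "f \<in> RF V" and g: "g \<in> RF V"
    and pf: "p \<in> pts" "f p \<noteq> 0" and pg: "q \<in> pts" "g q \<noteq> 0"
  shows "\<exists>p\<in>pts. f p \<noteq> 0 \<and> g p \<noteq> 0"
proof -
  have "\<exists>r\<in>pts. \<exists>s\<in>pts. f r \<noteq> 0 \<and> g s \<noteq> 0 \<and> (\<forall>v\<in>U. r v = s v)" if "finite U" for U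
    using that
  proof (induction U rule: finite_induct)
    case empty
    then show ?case using pf pg by blast
  next
    case (insert v U)
    then obtain r s where rs: "r \<in> pts" "s \<in> pts" "f r \<noteq> 0" "g s \<noteq> 0" "\<forall>v\<in>U. r v = s v" by blast
    have "finite ({t \<in> E. f (r(v := t)) = 0} \<union> {t \<in> E. g (s(v := t)) = 0})"
      using RF_finite_zeros[OF f] RF_finite_zeros[OF g] rs by blast
    then obtain t where "t \<in> E" "t \<notin> {t \<in> E. f (r(v := t)) = 0} \<union> {t \<in> E. g (s(v := t)) = 0}"
      using infinite_E by (meson finite_subset subsetI)
    then have "f (r(v := t)) \<noteq> 0" "g (s(v := t)) \<noteq> 0" "r(v := t) \<in> pts" "s(v := t) \<in> pts"
      using rs pts_update by blast+
    moreover have "\<forall>u\<in>insert v U. (r(v := t)) u = (s(v := t)) u" using rs by auto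
    ultimately show ?case by blast
  qed
  from this[OF assms(1)] obtain r s where "r \<in> pts" "s \<in> pts" "f r \<noteq> 0" "g s \<noteq> 0" "\<forall>v\<in>V. r v = s v" by blast
  then show ?thesis using RF_cong[OF g, of r s] by auto
qed

lemma RF_cancel:
  assumes "finite V" "f \<in> RF V" "g \<in> RF V" "q \<in> pts" "g q \<noteq> 0" "\<And>p. p \<in> pts \<Longrightarrow> g p * f p = 0" "p \<in> pts"
  shows "f p = 0"
  using RF_domain[of V f g p q] assms by force

text \<open>The points where \<open>h\<close> is nonzero are dense, so an identity with denominators
  can be checked where these do not vanish.\<close>

lemma RF_density:
  assumes "finite V" "f \<in> RF V" "g \<in> RF V" "h \<in> RF V" "q \<in> pts" "h q \<noteq> 0"
    and "\<And>p. p \<in> pts \<Longrightarrow> h p \<noteq> 0 \<Longrightarrow> f p = g p" "p \<in> pts"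
  shows "f p = g p"
  using RF_cancel[of V "\<lambda>p. f p - g p" h q p] assms RF_diff by force

lemma exists_inj_point:
  assumes "finite V"
  shows "\<exists>p\<in>pts. inj_on p V"
  using assms
proof (induction V rule: finite_induct)
  case empty
  then show ?case using one_E by (auto simp: pts_def)
next
  case (insert v V)
  then obtain p where p: "p \<in> pts" "inj_on p V" by blast
  obtain t where t: "t \<in> E" "t \<notin> p ` V"
    using infinite_E insert.hyps by (meson finite_imageI finite_subset subsetI)
  have "inj_on (p(v := t)) (insert v V)"
    using p t insert.hyps by (auto simp: inj_on_def)
  then show ?case using p t pts_update by blast
qed

text \<open>\<open>pw_diff\<close> settles a single power, and products follow by the Leibniz rule
  for the substitution \<open>p a := p b\<close>.\<close>

lemma RF_difference_quotient:
  assumes "f \<in> RF V" "a \<in> V" "b \<in> V"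
  shows "\<exists>q\<in>RF V. \<forall>p\<in>pts. f p - f (p(a := p b)) = (p a - p b) * q p"
  using assms(1)
proof (induction rule: RF.induct)
  case (const c)
  show ?case by (rule bexI[OF _ RF.const[of 0]]) auto
next
  case (gen v e)
  show ?case
  proof (cases "v = a")
    case True
    obtain A c i j where *: "finite (A :: nat set)"
      "\<forall>s\<in>E. \<forall>t\<in>E. pw t e - pw s e = (t - s) * (\<Sum>k\<in>A. c k * pw t (i k) * pw s (j k))"
      using pw_diff[of e] by blast
    have "(\<lambda>p. \<Sum>k\<in>A. c k * pw (p a) (i k) * pw (p b) (j k)) \<in> RF V"
      using assms by (intro RF_intros RF.gen)
    then show ?thesis using * True pts_E by (intro bexI) auto
  next
    case False
    then show ?thesis by (intro bexI[OF _ RF.const[of 0]]) auto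
  qed
next
  case (add f g)
  then obtain q r where "q \<in> RF V" "r \<in> RF V" "\<And>p. p \<in> pts \<Longrightarrow> f p - f (p(a := p b)) = (p a - p b) * q p"
    "\<And>p. p \<in> pts \<Longrightarrow> g p - g (p(a := p b)) = (p a - p b) * r p" by blast
  note qr = this
  show ?case
  proof (intro bexI ballI)
    show "(\<lambda>p. q p + r p) \<in> RF V" by (intro RF.add qr)
    fix p assume p: "p \<in> pts"
    have "f p + g p - (f (p(a := p b)) + g (p(a := p b))) =
      (f p - f (p(a := p b))) + (g p - g (p(a := p b)))"
      by (simp only: algebra_simps)
    then show "f p + g p - (f (p(a := p b)) + g (p(a := p b))) = (p a - p b) * (q p + r p)"
      unfolding qr(3)[OF p] qr(4)[OF p] by (simp only: algebra_simps)
  qed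
next
  case (mult f g)
  then obtain q r where *: "q \<in> RF V" "r \<in> RF V" "\<And>p. p \<in> pts \<Longrightarrow> f p - f (p(a := p b)) = (p a - p b) * q p"
    "\<And>p. p \<in> pts \<Longrightarrow> g p - g (p(a := p b)) = (p a - p b) * r p" by blast
  have f': "(\<lambda>p. f (p(a := p b))) \<in> RF V"
    using RF_update_coord[OF mult.hyps(1) assms(3) _ one_E, of a] by (simp add: Diff_subset)
  show ?case
  proof (intro bexI ballI)
    show "(\<lambda>p. q p * g p + f (p(a := p b)) * r p) \<in> RF V"
      by (intro RF.add RF.mult * f' mult.hyps)
    fix p assume p: "p \<in> pts"
    have "f p * g p - f (p(a := p b)) * g (p(a := p b)) =
      (f p - f (p(a := p b))) * g p + f (p(a := p b)) * (g p - g (p(a := p b)))"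
      by (simp add: algebra_simps del: fun_upd_apply)
    then show "f p * g p - f (p(a := p b)) * g (p(a := p b)) =
      (p a - p b) * (q p * g p + f (p(a := p b)) * r p)"
      unfolding *(3)[OF p] *(4)[OF p] by (simp add: algebra_simps del: fun_upd_apply)
  qed
next
  case (ext f g)
  then show ?case using pts_update pts_E by metis
qed

lemma RF_divide:
  assumes "f \<in> RF V" "a \<in> V" "b \<in> V" "\<And>p. p \<in> pts \<Longrightarrow> p a = p b \<Longrightarrow> f p = 0"
  shows "\<exists>q\<in>RF V. \<forall>p\<in>pts. f p = (p a - p b) * q p"
proof -
  obtain q where "q \<in> RF V" "\<forall>p\<in>pts. f p - f (p(a := p b)) = (p a - p b) * q p"
    using RF_difference_quotient[OF assms(1-3)] by blast
  moreover have "f (p(a := p b)) = 0" if "p \<in> pts" for p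
    using that pts_update pts_E by (intro assms(4)) auto
  ultimately show ?thesis by fastforce
qed

text \<open>The difference of two coordinates behaves as a prime element. On the hyperplane
  \<open>p a = p b\<close> the function \<open>u\<close> is not identically zero, as
  \<open>q\<close> witnesses, so by cancellation \<open>f\<close> vanishes there and one factor
  splits off; induction on \<open>k\<close> removes the others.\<close>

lemma RF_divide_coprime:
  assumes V: "finite V" and ab: "a \<in> V" "b \<in> V" "a \<noteq> b" and u: "u \<in> RF V" "q \<in> pts" "q a = q b" "u q \<noteq> 0"
    and f: "f \<in> RF V" and g: "g \<in> RF V" and eq: "\<And>p. p \<in> pts \<Longrightarrow> u p * f p = (p a - p b) ^ k * g p"
  shows "\<exists>h\<in>RF V. \<forall>p\<in>pts. f p = (p a - p b) ^ k * h p"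
  using f eq
proof (induction k arbitrary: f)
  case 0
  then show ?case by auto
next
  case (Suc k)
  let ?\<sigma> = "\<lambda>p. p(a := p b)"
  have pts\<sigma>: "?\<sigma> p \<in> pts" if "p \<in> pts" for p using that pts_update pts_E by blast
  have \<sigma>: "(\<lambda>p. h (?\<sigma> p)) \<in> RF V" if "h \<in> RF V" for h
    using RF_update_coord[OF that ab(2) _ one_E, of a] by (simp add: Diff_subset)
  have "f (?\<sigma> p) = 0" if p: "p \<in> pts" for p
  proof (rule RF_cancel[OF V \<sigma>[OF Suc.prems(1)] \<sigma>[OF u(1)] u(2) _ _ p])
    have "?\<sigma> q = q" using u(3) by auto
    then show "u (?\<sigma> q) \<noteq> 0" using u(4) by metis
    show "u (?\<sigma> p) * f (?\<sigma> p) = 0" if "p \<in> pts" for p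
      unfolding Suc.prems(2)[OF pts\<sigma>[OF that]] using ab by simp
  qed
  then have "f p = 0" if "p \<in> pts" "p a = p b" for p
    using that by (metis fun_upd_triv)
  then obtain f' where f': "f' \<in> RF V" "\<And>p. p \<in> pts \<Longrightarrow> f p = (p a - p b) * f' p"
    using RF_divide[OF Suc.prems(1) ab(1,2)] by blast
  obtain r where r: "r \<in> pts" "inj_on r V" using exists_inj_point[OF V] by blast
  have "u p * f' p = (p a - p b) ^ k * g p" if p: "p \<in> pts" for p
  proof -
    have "u p * f' p - (p a - p b) ^ k * g p = 0"
    proof (rule RF_cancel[OF V _ _ r(1) _ _ p])
      show "(\<lambda>p. u p * f' p - (p a - p b) ^ k * g p) \<in> RF V" "(\<lambda>p. p a - p b) \<in> RF V"
        by (intro RF_intros u f' g ab)+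
      show "r a - r b \<noteq> 0" using r ab by (auto simp: inj_on_def)
      show "(p a - p b) * (u p * f' p - (p a - p b) ^ k * g p) = 0" if "p \<in> pts" for p
        using Suc.prems(2)[OF that] f'(2)[OF that] by (simp add: algebra_simps)
    qed
    then show ?thesis by simp
  qed
  from Suc.IH[OF f'(1) this] obtain h where h: "h \<in> RF V" "\<forall>p\<in>pts. f' p = (p a - p b) ^ k * h p" by blast
  then show ?case using f'(2) by (intro bexI[OF _ h(1)]) auto
qed

text \<open>Different differences are coprime, so their powers split off one after another;
  excluding \<open>(b, a)\<close> keeps a factor from occurring twice up to sign.\<close>

lemma RF_divide_prod:
  assumes V: "finite V" and f: "f \<in> RF V" and "finite S"
    and S: "\<And>a b. (a, b) \<in> S \<Longrightarrow> a \<in> V \<and> b \<in> V \<and> a \<noteq> b \<and> (b, a) \<notin> S"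
    and dvd: "\<And>a b. (a, b) \<in> S \<Longrightarrow> \<exists>g\<in>RF V. \<forall>p\<in>pts. f p = (p a - p b) ^ k * g p"
  shows "\<exists>g\<in>RF V. \<forall>p\<in>pts. f p = (\<Prod>(a, b)\<in>S. (p a - p b) ^ k) * g p"
  using assms(3,4,5)
proof (induction S rule: finite_induct)
  case empty
  then show ?case using f by auto
next
  case (insert e S)
  obtain a b where e: "e = (a, b)" by (cases e)
  have ab: "a \<in> V" "b \<in> V" "a \<noteq> b" "(b, a) \<notin> S" using insert.prems(1)[of a b] e by auto
  have SV: "c \<in> V \<and> d \<in> V \<and> c \<noteq> d" if "(c, d) \<in> S" for c d using insert.prems(1) that by blast
  define u where "u = (\<lambda>p. \<Prod>(a, b)\<in>S. (p a - p b :: 'k) ^ k)"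
  have "\<exists>g\<in>RF V. \<forall>p\<in>pts. f p = u p * g p"
    unfolding u_def using insert.prems by (intro insert.IH) blast+
  then obtain g where g: "g \<in> RF V" "\<forall>p\<in>pts. f p = u p * g p" by blast
  obtain h where h: "h \<in> RF V" "\<forall>p\<in>pts. f p = (p a - p b) ^ k * h p"
    using insert.prems(2)[of a b] e by auto
  obtain r where r: "r \<in> pts" "inj_on r V" using exists_inj_point[OF V] by blast
  \<comment> \<open>The only coincidence among the coordinates in \<open>V\<close> at this point is
    that of \<open>a\<close> and \<open>b\<close>, so no difference taken from \<open>S\<close>
    vanishes here.\<close>
  let ?q = "r(a := r b)"
  have "?q \<in> pts" using r pts_update pts_E by blast
  moreover have "?q c - ?q d \<noteq> 0" if "(c, d) \<in> S" for c d
    using SV[OF that] that r(2) ab insert.hyps(2) e by (auto simp: inj_on_def)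
  then have "u ?q \<noteq> 0" using insert.hyps by (auto simp: u_def)
  moreover have "u \<in> RF V" unfolding u_def
    using SV by (intro RF_prod) (auto intro!: RF_intros split: prod.splits)
  moreover have "u p * g p = (p a - p b) ^ k * h p" if "p \<in> pts" for p
    using g(2) h(2) that by auto
  ultimately obtain w where w: "w \<in> RF V" "\<forall>p\<in>pts. g p = (p a - p b) ^ k * w p"
    using RF_divide_coprime[OF V ab(1-3), of u ?q g h k] g(1) h(1) by auto
  have "f p = (\<Prod>(a, b)\<in>insert e S. (p a - p b) ^ k) * w p" if "p \<in> pts" for p
    using g(2) w(2) that insert.hyps by (simp add: u_def e mult.assoc mult.left_commute)
  then show ?case using w(1) by blast
qed

end

section \<open>Symmetrization by divided differences\<close>

context point_functions
begin

definition inv_under :: "(nat + nat) set \<Rightarrow> ('k valuation \<Rightarrow> 'k) \<Rightarrow> bool" where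
  "inv_under K f \<longleftrightarrow> (\<forall>\<pi>. \<pi> permutes K \<longrightarrow> (\<forall>p\<in>pts. f (p \<circ> \<pi>) = f p))"

lemma inv_underD: "inv_under K f \<Longrightarrow> \<pi> permutes K \<Longrightarrow> p \<in> pts \<Longrightarrow> f (p \<circ> \<pi>) = f p"
  by (auto simp: inv_under_def)

text \<open>Pairing off the factors of (a, b) and (b, a) gives, up to sign, the square of a
  Vandermonde product. \<open>S\<close> keeps one ordered pair of each kind, and the constant
  \<open>c\<close> that is built is that sign.\<close>

lemma prod_ordered_pairs:
  assumes "finite (I :: (nat + nat) set)"
  shows "\<exists>S c. finite S \<and> S \<subseteq> I \<times> I \<and> (\<forall>a b. (a, b) \<in> S \<longrightarrow> a \<noteq> b \<and> (b, a) \<notin> S) \<and> c \<noteq> 0 \<and>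
    (\<forall>p. (\<Prod>i\<in>I. \<Prod>l\<in>I - {i}. p l - p i :: 'k) = c * (\<Prod>(a, b)\<in>S. (p a - p b) ^ 2))"
  using assms
proof (induction I rule: finite_induct)
  case empty
  show ?case by (intro exI[of _ "{}"] exI[of _ 1]) auto
next
  case (insert v I)
  then obtain S c where S: "finite S" "S \<subseteq> I \<times> I" "\<forall>a b. (a, b) \<in> S \<longrightarrow> a \<noteq> b \<and> (b, a) \<notin> S" "c \<noteq> 0"
    "\<And>p. (\<Prod>i\<in>I. \<Prod>l\<in>I - {i}. p l - p i :: 'k) = c * (\<Prod>(a, b)\<in>S. (p a - p b) ^ 2)" by blast
  have "(\<Prod>i\<in>insert v I. \<Prod>l\<in>insert v I - {i}. p l - p i) =
    (c * (- 1) ^ card I) * (\<Prod>(a, b)\<in>S \<union> Pair v ` I. (p a - p b) ^ 2)" for p :: "'k valuation"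
  proof -
    have sq: "(\<Prod>l\<in>I. (p v - p l) ^ 2) = (\<Prod>l\<in>I. p v - p l) * (\<Prod>l\<in>I. p v - p l)"
      by (simp only: power2_eq_square prod.distrib)
    have "(\<Prod>l\<in>insert v I - {i}. p l - p i) = (p v - p i) * (\<Prod>l\<in>I - {i}. p l - p i)" if "i \<in> I" for i
    proof -
      have "insert v I - {i} = insert v (I - {i})" using that insert.hyps by auto
      then show ?thesis using insert.hyps by simp
    qed
    then have "(\<Prod>i\<in>I. \<Prod>l\<in>insert v I - {i}. p l - p i) =
      (\<Prod>i\<in>I. p v - p i) * (\<Prod>i\<in>I. \<Prod>l\<in>I - {i}. p l - p i)"
      by (simp add: prod.distrib)
    then have "(\<Prod>i\<in>insert v I. \<Prod>l\<in>insert v I - {i}. p l - p i) =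
      (\<Prod>l\<in>I. p l - p v) * ((\<Prod>i\<in>I. p v - p i) * (c * (\<Prod>(a, b)\<in>S. (p a - p b) ^ 2)))"
      using insert.hyps S(5) by simp
    also have "(\<Prod>l\<in>I. p l - p v) = (\<Prod>l\<in>I. (- 1) * (p v - p l))" by (intro prod.cong) auto
    also have "\<dots> = (- 1) ^ card I * (\<Prod>l\<in>I. p v - p l)" by (simp only: prod.distrib prod_constant)
    also have "(- 1) ^ card I * (\<Prod>l\<in>I. p v - p l) * ((\<Prod>i\<in>I. p v - p i) * (c * (\<Prod>(a, b)\<in>S. (p a - p b) ^ 2))) =
      (c * (- 1) ^ card I) * ((\<Prod>(a, b)\<in>S. (p a - p b) ^ 2) * (\<Prod>l\<in>I. (p v - p l) ^ 2))"
      unfolding sq by (simp only: mult_ac)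
    also have "(\<Prod>l\<in>I. (p v - p l) ^ 2) = (\<Prod>(a, b)\<in>Pair v ` I. (p a - p b) ^ 2)"
      by (subst prod.reindex) (auto simp: inj_on_def)
    also have "(\<Prod>(a, b)\<in>S. (p a - p b) ^ 2) * (\<Prod>(a, b)\<in>Pair v ` I. (p a - p b) ^ 2) =
      (\<Prod>(a, b)\<in>S \<union> Pair v ` I. (p a - p b) ^ 2)"
      using S insert.hyps by (intro prod.union_disjoint[symmetric]) auto
    finally show ?thesis .
  qed
  then show ?case using S insert.hyps
    by (intro exI[of _ "S \<union> Pair v ` I"] exI[of _ "c * (- 1) ^ card I"]) auto
qed

text \<open>Up to sign this is the derivative at \<open>p i\<close> of the monic polynomial with
  roots \<open>p l\<close> for \<open>l\<close> in \<open>I\<close>, the denominator in Lagrange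
  interpolation.\<close>

definition diffs :: "(nat + nat) set \<Rightarrow> nat + nat \<Rightarrow> 'k valuation \<Rightarrow> 'k" where
  "diffs I i p = (\<Prod>l\<in>I - {i}. p l - p i)"

lemma diffs_RF: "i \<in> I \<Longrightarrow> I \<subseteq> V \<Longrightarrow> diffs I i \<in> RF V"
  unfolding diffs_def[abs_def] by (intro RF_intros) auto

lemma diffs_nonzero: "finite I \<Longrightarrow> inj_on p I \<Longrightarrow> i \<in> I \<Longrightarrow> diffs I i p \<noteq> 0"
  by (auto simp: diffs_def inj_on_def)

lemma permutes_bij_betw_remove: "\<pi> permutes I \<Longrightarrow> bij_betw \<pi> (I - {i}) (I - {\<pi> i})"
  using permutes_imp_bij[of \<pi> I] permutes_inj[of \<pi> I]
  by (auto simp: bij_betw_def inj_on_def image_set_diff permutes_image)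

lemma diffs_permutes: "\<pi> permutes I \<Longrightarrow> diffs I i (p \<circ> \<pi>) = diffs I (\<pi> i) p"
  unfolding diffs_def by (subst prod.reindex_bij_betw[OF permutes_bij_betw_remove, symmetric]) auto

text \<open>Points with distinct coordinates in \<open>I\<close> are dense, being the nonvanishing
  set of the product of all \<open>diffs\<close>; there quotients by \<open>diffs\<close> are
  meaningful.\<close>

lemma RF_eq_on_injective:
  assumes V: "finite V" and IV: "I \<subseteq> V" and fg: "f \<in> RF V" "g \<in> RF V"
    and eq: "\<And>p. p \<in> pts \<Longrightarrow> inj_on p I \<Longrightarrow> f p = g p" and p: "p \<in> pts"
  shows "f p = g p"
proof -
  obtain q where q: "q \<in> pts" "inj_on q V" using exists_inj_point[OF V] by blast
  have I: "finite I" using V IV by (rule finite_subset[rotated])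
  show ?thesis
  proof (rule RF_density[OF V fg _ q(1) _ _ p])
    show "(\<lambda>p. \<Prod>i\<in>I. diffs I i p) \<in> RF V" using IV by (intro RF_prod diffs_RF) auto
    show "(\<Prod>i\<in>I. diffs I i q) \<noteq> 0"
      using I diffs_nonzero[OF I inj_on_subset[OF q(2) IV]] by auto
    fix r assume r: "r \<in> pts" "(\<Prod>i\<in>I. diffs I i r) \<noteq> 0"
    have "inj_on r I"
    proof (rule inj_onI, rule ccontr)
      fix x y assume "x \<in> I" "y \<in> I" "r x = r y" "x \<noteq> y"
      then have "diffs I x r = 0" using I by (auto simp: diffs_def)
      then show False using r(2) I \<open>x \<in> I\<close> by auto
    qed
    then show "f r = g r" using eq r by blast
  qed
qed

text \<open>The transpositions of \<open>c\<close> with \<open>i\<close> represent the cosets of the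
  stabilizer of \<open>c\<close> among the permutations of \<open>I\<close>. The two arguments
  differ by \<kappa>, which fixes \<open>c\<close> and so leaves \<Psi> unchanged.\<close>

lemma inv_under_transposes:
  assumes \<Psi>: "inv_under (I - {c}) \<Psi>" and c: "c \<in> I" and \<pi>: "\<pi> permutes I" and i: "i \<in> I" and p: "p \<in> pts"
  shows "\<Psi> (p \<circ> \<pi> \<circ> transpose c i) = \<Psi> (p \<circ> transpose c (\<pi> i))"
proof -
  define \<kappa> where "\<kappa> = transpose c (\<pi> i) \<circ> \<pi> \<circ> transpose c i"
  have "\<pi> i \<in> I" using \<pi> i by (simp add: permutes_in_image)
  then have "\<kappa> permutes I"
    unfolding \<kappa>_def using c i \<pi> by (intro permutes_compose permutes_swap_id) auto
  moreover have "\<kappa> c = c" by (simp add: \<kappa>_def)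
  ultimately have \<kappa>: "\<kappa> permutes (I - {c})" by (auto intro: permutes_superset)
  have "p \<circ> \<pi> \<circ> transpose c i = (p \<circ> transpose c (\<pi> i)) \<circ> \<kappa>"
    by (auto simp: \<kappa>_def fun_eq_iff)
  then show ?thesis using inv_underD[OF \<Psi> \<kappa> pts_comp[OF p]] by metis
qed

text \<open>Over the product of all \<open>diffs\<close> as common denominator, the numerator
  \<open>N\<close> is symmetric and vanishes where two coordinates agree. Its quotient by their
  difference is therefore antisymmetric and vanishes there again, so the square of each difference
  divides \<open>N\<close>; up to a constant, the denominator is the product of these
  squares.\<close>

lemma symmetrizer:
  assumes V: "finite V" and IV: "I \<subseteq> V" and c: "c \<in> I" and \<Psi>: "\<Psi> \<in> RF V" and inv: "inv_under (I - {c}) \<Psi>"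
  shows "\<exists>f\<in>RF V. \<forall>p\<in>pts. inj_on p I \<longrightarrow> f p = (\<Sum>i\<in>I. \<Psi> (p \<circ> transpose c i) / diffs I i p)"
proof -
  have I: "finite I" using V IV by (rule finite_subset[rotated])
  define N where "N = (\<lambda>p. \<Sum>i\<in>I. \<Psi> (p \<circ> transpose c i) * (\<Prod>k\<in>I - {i}. diffs I k p))"
  have NRF: "N \<in> RF V"
    unfolding N_def using IV c
    by (intro RF_sum RF.mult RF_prod RF_comp[OF \<Psi>] diffs_RF) (auto simp: transpose_def)
  have Nsym: "N (p \<circ> \<pi>) = N p" if \<pi>: "\<pi> permutes I" and p: "p \<in> pts" for p \<pi>
  proof -
    have "N (p \<circ> \<pi>) = (\<Sum>i\<in>I. \<Psi> (p \<circ> transpose c (\<pi> i)) * (\<Prod>k\<in>I - {\<pi> i}. diffs I k p))"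
      unfolding N_def
    proof (intro sum.cong refl arg_cong2[of _ _ _ _ "(*)"])
      fix i assume "i \<in> I"
      then show "\<Psi> (p \<circ> \<pi> \<circ> transpose c i) = \<Psi> (p \<circ> transpose c (\<pi> i))"
        by (rule inv_under_transposes[OF inv c \<pi> _ p])
      show "(\<Prod>k\<in>I - {i}. diffs I k (p \<circ> \<pi>)) = (\<Prod>k\<in>I - {\<pi> i}. diffs I k p)"
        unfolding diffs_permutes[OF \<pi>]
        by (rule prod.reindex_bij_betw[OF permutes_bij_betw_remove[OF \<pi>]])
    qed
    also have "\<dots> = N p" unfolding N_def by (subst (2) sum.permute[OF \<pi>]) (simp add: o_def)
    finally show ?thesis .
  qed
  have dvd: "\<exists>g\<in>RF V. \<forall>p\<in>pts. N p = (p a - p b) ^ 2 * g p" if ab: "a \<in> I" "b \<in> I" "a \<noteq> b" for a b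
  proof -
    have abV: "a \<in> V" "b \<in> V" using ab IV by auto
    have "N p = 0" if p: "p a = p b" for p
      unfolding N_def
    proof (intro sum.neutral ballI)
      fix i assume i: "i \<in> I"
      have "diffs I a p = 0" "diffs I b p = 0" using ab I p by (auto simp: diffs_def)
      \<comment> \<open>A summand of \<open>N\<close> omits only one of the \<open>diffs\<close>, so
        it still contains that of \<open>a\<close> or that of \<open>b\<close>.\<close>
      moreover have "a \<in> I - {i} \<or> b \<in> I - {i}" using ab by auto
      ultimately have "(\<Prod>k\<in>I - {i}. diffs I k p) = 0" using I by (auto intro!: prod_zero)
      then show "\<Psi> (p \<circ> transpose c i) * (\<Prod>k\<in>I - {i}. diffs I k p) = 0" by simp
    qed
    then obtain M where M: "M \<in> RF V" "\<And>p. p \<in> pts \<Longrightarrow> N p = (p a - p b) * M p"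
      using RF_divide[OF NRF abV] by blast
    let ?\<tau> = "transpose a b"
    have \<tau>: "?\<tau> permutes I" using ab by (intro permutes_swap_id)
    have anti: "M (p \<circ> ?\<tau>) = - M p" if p: "p \<in> pts" for p
    proof (rule RF_eq_on_injective[OF V IV _ _ _ p])
      show "(\<lambda>p. M (p \<circ> ?\<tau>)) \<in> RF V" using abV by (intro RF_comp[OF M(1)]) (auto simp: transpose_def)
      show "(\<lambda>p. - M p) \<in> RF V" by (intro RF_uminus M)
      fix r assume r: "r \<in> pts" "inj_on r I"
      have "(r b - r a) * M (r \<circ> ?\<tau>) = (r a - r b) * M r"
        using M(2)[OF r(1)] M(2)[OF pts_comp[OF r(1)], of ?\<tau>] Nsym[OF \<tau> r(1)] by simp
      then have "(r a - r b) * (M (r \<circ> ?\<tau>) + M r) = 0" by (simp add: algebra_simps)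
      moreover have "r a - r b \<noteq> 0" using r ab by (auto simp: inj_on_def)
      ultimately show "M (r \<circ> ?\<tau>) = - M r" by (simp add: eq_neg_iff_add_eq_0)
    qed
    have "M p = 0" if p: "p \<in> pts" "p a = p b" for p
    proof -
      \<comment> \<open>A point with equal coordinates is fixed by the transposition, so
        antisymmetry gives \<open>2 * M p = 0\<close>, and 2 is invertible.\<close>
      have "p \<circ> ?\<tau> = p" using p(2) by (auto simp: transpose_def)
      then have "2 * M p = 0" using anti[OF p(1)] by simp
      then show ?thesis by simp
    qed
    then obtain M' where "M' \<in> RF V" "\<And>p. p \<in> pts \<Longrightarrow> M p = (p a - p b) * M' p"
      using RF_divide[OF M(1) abV] by blast
    then show ?thesis using M(2) by (intro bexI[of _ M']) (auto simp: power2_eq_square)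
  qed
  obtain S k where S: "finite S" "S \<subseteq> I \<times> I" "\<And>a b. (a, b) \<in> S \<Longrightarrow> a \<noteq> b \<and> (b, a) \<notin> S" "k \<noteq> 0"
    "\<And>p. (\<Prod>i\<in>I. diffs I i p) = k * (\<Prod>(a, b)\<in>S. (p a - p b) ^ 2)"
    using prod_ordered_pairs[OF I] unfolding diffs_def by blast
  have "\<exists>g\<in>RF V. \<forall>p\<in>pts. N p = (\<Prod>(a, b)\<in>S. (p a - p b) ^ 2) * g p"
  proof (rule RF_divide_prod[OF V NRF S(1)])
    fix a b assume "(a, b) \<in> S"
    then have "a \<in> I" "b \<in> I" "a \<noteq> b" "(b, a) \<notin> S" using S(2,3) by auto
    then show "a \<in> V \<and> b \<in> V \<and> a \<noteq> b \<and> (b, a) \<notin> S" "\<exists>g\<in>RF V. \<forall>p\<in>pts. N p = (p a - p b) ^ 2 * g p"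
      using IV dvd by auto
  qed
  then obtain g where g: "g \<in> RF V" "\<And>p. p \<in> pts \<Longrightarrow> N p = (\<Prod>(a, b)\<in>S. (p a - p b) ^ 2) * g p" by blast
  show ?thesis
  proof (intro bexI ballI impI)
    show "(\<lambda>p. inverse k * g p) \<in> RF V" by (intro RF_intros g)
    fix p assume p: "p \<in> pts" "inj_on p I"
    have nz: "diffs I i p \<noteq> 0" if "i \<in> I" for i by (rule diffs_nonzero[OF I p(2) that])
    let ?Q = "\<Prod>i\<in>I. diffs I i p"
    have "?Q * (\<Sum>i\<in>I. \<Psi> (p \<circ> transpose c i) / diffs I i p) = N p"
      unfolding N_def sum_distrib_left
    proof (intro sum.cong refl)
      fix i assume i: "i \<in> I"
      show "?Q * (\<Psi> (p \<circ> transpose c i) / diffs I i p) = \<Psi> (p \<circ> transpose c i) * (\<Prod>k\<in>I - {i}. diffs I k p)"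
        using nz[OF i] by (subst prod.remove[OF I i]) simp
    qed
    also have "\<dots> = ?Q * (inverse k * g p)" unfolding S(5) g(2)[OF p(1)] using S(4) by simp
    finally show "inverse k * g p = (\<Sum>i\<in>I. \<Psi> (p \<circ> transpose c i) / diffs I i p)"
      using nz I by simp
  qed
qed

lemma symmetrized_inv:
  assumes V: "finite V" and IV: "I \<subseteq> V" and c: "c \<in> I" and inv: "inv_under (I - {c}) \<Psi>"
    and f: "f \<in> RF V" "\<And>p. p \<in> pts \<Longrightarrow> inj_on p I \<Longrightarrow> f p = (\<Sum>i\<in>I. \<Psi> (p \<circ> transpose c i) / diffs I i p)"
  shows "inv_under I f"
  unfolding inv_under_def
proof (intro allI impI ballI)
  fix \<pi> p assume \<pi>: "\<pi> permutes I" and p: "p \<in> pts"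
  show "f (p \<circ> \<pi>) = f p"
  proof (rule RF_eq_on_injective[OF V IV _ f(1) _ p])
    show "(\<lambda>p. f (p \<circ> \<pi>)) \<in> RF V"
      using permutes_image[OF permutes_subset[OF \<pi> IV]] by (intro RF_comp[OF f(1)]) auto
    fix p assume p: "p \<in> pts" "inj_on p I"
    have "inj_on (p \<circ> \<pi>) I"
      using p(2) \<pi> by (intro comp_inj_on) (auto simp: permutes_image permutes_inj_on)
    then have "f (p \<circ> \<pi>) = (\<Sum>i\<in>I. \<Psi> (p \<circ> \<pi> \<circ> transpose c i) / diffs I i (p \<circ> \<pi>))"
      using f(2) pts_comp[OF p(1)] by blast
    also have "\<dots> = (\<Sum>i\<in>I. \<Psi> (p \<circ> transpose c (\<pi> i)) / diffs I (\<pi> i) p)"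
      by (intro sum.cong refl) (simp add: inv_under_transposes[OF inv c \<pi> _ p(1)] diffs_permutes[OF \<pi>])
    also have "\<dots> = f p" unfolding f(2)[OF p] by (subst (2) sum.permute[OF \<pi>]) (simp add: o_def)
    finally show "f (p \<circ> \<pi>) = f p" .
  qed
qed

text \<open>A permutation of variables outside \<open>I\<close> commutes with the transpositions and
  leaves the denominators alone, so the invariance of \<Psi> under it survives.\<close>

lemma symmetrized_inv_disjoint:
  assumes V: "finite V" and IV: "I \<subseteq> V" and c: "c \<in> I" and KV: "K \<subseteq> V" "K \<inter> I = {}" and inv: "inv_under K \<Psi>"
    and f: "f \<in> RF V" "\<And>p. p \<in> pts \<Longrightarrow> inj_on p I \<Longrightarrow> f p = (\<Sum>i\<in>I. \<Psi> (p \<circ> transpose c i) / diffs I i p)"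
  shows "inv_under K f"
  unfolding inv_under_def
proof (intro allI impI ballI)
  fix \<pi> p assume \<pi>: "\<pi> permutes K" and p: "p \<in> pts"
  have fixI: "\<pi> i = i" if "i \<in> I" for i using that KV(2) permutes_not_in[OF \<pi>] by blast
  have comm: "\<pi> \<circ> transpose c i = transpose c i \<circ> \<pi>" if "i \<in> I" for i
    using fixI[OF c] fixI[OF that] permutes_inj[OF \<pi>]
    by (auto simp: fun_eq_iff transpose_def inj_def)
  show "f (p \<circ> \<pi>) = f p"
  proof (rule RF_eq_on_injective[OF V IV _ f(1) _ p])
    show "(\<lambda>p. f (p \<circ> \<pi>)) \<in> RF V"
      using permutes_image[OF permutes_subset[OF \<pi> KV(1)]] by (intro RF_comp[OF f(1)]) auto
    fix p assume p: "p \<in> pts" "inj_on p I"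
    have "inj_on (p \<circ> \<pi>) I" using p(2) fixI by (auto simp: inj_on_def)
    then have "f (p \<circ> \<pi>) = (\<Sum>i\<in>I. \<Psi> (p \<circ> \<pi> \<circ> transpose c i) / diffs I i (p \<circ> \<pi>))"
      using f(2) pts_comp[OF p(1)] by blast
    also have "\<dots> = (\<Sum>i\<in>I. \<Psi> (p \<circ> transpose c i) / diffs I i p)"
    proof (intro sum.cong refl arg_cong2[of _ _ _ _ "(/)"])
      fix i assume i: "i \<in> I"
      show "diffs I i (p \<circ> \<pi>) = diffs I i p" using fixI i by (auto simp: diffs_def intro!: prod.cong)
      show "\<Psi> (p \<circ> \<pi> \<circ> transpose c i) = \<Psi> (p \<circ> transpose c i)"
        using inv_underD[OF inv \<pi> pts_comp[OF p(1)], of "transpose c i"] comm[OF i] by (simp add: o_assoc[symmetric])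
    qed
    also have "\<dots> = f p" using f(2)[OF p] by simp
    finally show "f (p \<circ> \<pi>) = f p" .
  qed
qed

end

section \<open>Lifting supersymmetric functions\<close>

context point_functions
begin

definition lift_weight :: "(nat + nat) set \<Rightarrow> (nat + nat) set \<Rightarrow> nat + nat \<Rightarrow> nat + nat \<Rightarrow> 'k valuation \<Rightarrow> 'k" where
  "lift_weight I J i j p =
    (\<Prod>l\<in>I - {i}. (p l - \<epsilon> * p j) / (p l - p i)) * (\<Prod>l\<in>J - {j}. (p l - \<epsilon> * p i) / (p l - p j))"

text \<open>Encodes that \<open>f\<close> is L applied to \<open>g\<close>. Leaving out x_i is
  expressed by the transposition of \<open>a\<close> and \<open>i\<close>, which parks the value of
  \<open>i\<close> in the slot \<open>a\<close>, meant to be one that \<open>g\<close> does not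
  read. The formula is imposed only at distinct coordinates, since elsewhere
  \<open>lift_weight\<close> divides by zero; for finite index sets density determines the remaining
  values on \<open>pts\<close>.\<close>

definition is_lift where
  "is_lift I J a b g f \<longleftrightarrow> f \<in> RF (I \<union> J) \<and> inv_under I f \<and> inv_under J f \<and>
    (\<forall>p\<in>pts. inj_on p I \<longrightarrow> inj_on p J \<longrightarrow>
      f p = (\<Sum>i\<in>I. \<Sum>j\<in>J. lift_weight I J i j p * g (p \<circ> transpose a i \<circ> transpose b j)))"

text \<open>The double sum arises from two successive symmetrizations, over \<open>I\<close> and
  over \<open>J\<close>. The invariance required for the second one survives the first because the
  index sets are disjoint.\<close>

lemma lift_exists:
  assumes fin: "finite I" "finite J" and disj: "I \<inter> J = {}" and ab: "a \<in> I" "b \<in> J"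
    and g: "g \<in> RF ((I - {a}) \<union> (J - {b}))" and inv: "inv_under (I - {a}) g" "inv_under (J - {b}) g"
  shows "\<exists>f. is_lift I J a b g f"
proof -
  let ?V = "I \<union> J"
  have V: "finite ?V" "I \<subseteq> ?V" "J \<subseteq> ?V" using fin by auto
  have nI: "v \<notin> J" if "v \<in> I" for v using disj that by auto
  have nJ: "v \<notin> I" if "v \<in> J" for v using disj that by auto
  have gV: "g \<in> RF ?V" by (rule RF_mono[OF g]) auto
  \<comment> \<open>The numerator of the weight at \<open>i = a\<close>, \<open>j = b\<close>, times
    \<open>g\<close>; the transpositions carry it to all other pairs.\<close>
  define \<Psi> where "\<Psi> = (\<lambda>p. (\<Prod>l\<in>I - {a}. p l - \<epsilon> * p b) * (\<Prod>l\<in>J - {b}. p l - \<epsilon> * p a) * g p)"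
  have \<Psi>: "\<Psi> \<in> RF ?V" unfolding \<Psi>_def using ab by (intro RF_intros gV) auto
  have "inv_under K \<Psi>" if K: "K = I - {a} \<or> K = J - {b}" for K
    unfolding inv_under_def
  proof (intro allI impI ballI)
    fix \<pi> p assume \<pi>: "\<pi> permutes K" and p: "p \<in> pts"
    have fx: "\<pi> v = v" if "v \<notin> K" for v using permutes_not_in[OF \<pi> that] .
    have pm: "(\<Prod>l\<in>L. h (\<pi> l)) = (\<Prod>l\<in>L. h l)" if L: "L = I - {a} \<or> L = J - {b}" for L and h :: "_ \<Rightarrow> 'k"
    proof (cases "L = K")
      case True
      then show ?thesis using prod.permute[OF \<pi>, of h] by (simp add: o_def)
    next
      case False
      then have "v \<notin> K" if "v \<in> L" for v using K L nI nJ that by blast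
      then show ?thesis by (intro prod.cong refl) (simp add: fx)
    qed
    have "a \<notin> K" "b \<notin> K" using K nI nJ ab by auto
    moreover have "g (p \<circ> \<pi>) = g p" using inv_underD[OF _ \<pi> p] inv K by blast
    ultimately show "\<Psi> (p \<circ> \<pi>) = \<Psi> p"
      using pm[of "I - {a}" "\<lambda>l. p l - \<epsilon> * p b"] pm[of "J - {b}" "\<lambda>l. p l - \<epsilon> * p a"]
      by (simp add: \<Psi>_def fx)
  qed
  then have inv\<Psi>: "inv_under (I - {a}) \<Psi>" "inv_under (J - {b}) \<Psi>" by simp_all
  obtain f1 where f1: "f1 \<in> RF ?V"
    "\<And>p. p \<in> pts \<Longrightarrow> inj_on p I \<Longrightarrow> f1 p = (\<Sum>i\<in>I. \<Psi> (p \<circ> transpose a i) / diffs I i p)"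
    using symmetrizer[OF V(1,2) ab(1) \<Psi> inv\<Psi>(1)] by blast
  have inv1: "inv_under I f1" by (rule symmetrized_inv[OF V(1,2) ab(1) inv\<Psi>(1) f1])
  have "J - {b} \<subseteq> ?V" "(J - {b}) \<inter> I = {}" using disj by auto
  from symmetrized_inv_disjoint[OF V(1,2) ab(1) this inv\<Psi>(2) f1]
  have inv1': "inv_under (J - {b}) f1" .
  obtain f where f: "f \<in> RF ?V"
    "\<And>p. p \<in> pts \<Longrightarrow> inj_on p J \<Longrightarrow> f p = (\<Sum>j\<in>J. f1 (p \<circ> transpose b j) / diffs J j p)"
    using symmetrizer[OF V(1,3) ab(2) f1(1) inv1'] by blast
  have "inv_under J f" by (rule symmetrized_inv[OF V(1,3) ab(2) inv1' f])
  moreover have "inv_under I f" by (rule symmetrized_inv_disjoint[OF V(1,3) ab(2) V(2) disj inv1 f])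
  moreover have "f p = (\<Sum>i\<in>I. \<Sum>j\<in>J. lift_weight I J i j p * g (p \<circ> transpose a i \<circ> transpose b j))"
    if p: "p \<in> pts" "inj_on p I" "inj_on p J" for p
  proof -
    have eq: "f1 (p \<circ> transpose b j) / diffs J j p =
      (\<Sum>i\<in>I. lift_weight I J i j p * g (p \<circ> transpose a i \<circ> transpose b j))" if j: "j \<in> J" for j
    proof -
      have tI: "transpose b j i = i" if "i \<in> I" for i
        using that disj ab j by (auto simp: transpose_def)
      have "inj_on (p \<circ> transpose b j) I" using p(2) tI by (auto simp: inj_on_def)
      then have "f1 (p \<circ> transpose b j) =
        (\<Sum>i\<in>I. \<Psi> (p \<circ> transpose b j \<circ> transpose a i) / diffs I i (p \<circ> transpose b j))"
        using f1(2) pts_comp[OF p(1)] by blast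
      also have "\<dots> = (\<Sum>i\<in>I. diffs J j p * (lift_weight I J i j p * g (p \<circ> transpose a i \<circ> transpose b j)))"
      proof (intro sum.cong refl)
        fix i assume i: "i \<in> I"
        let ?q = "p \<circ> transpose b j \<circ> transpose a i"
        have tJ: "transpose a i l = l" if "l \<in> J" for l
          using that disj ab i by (auto simp: transpose_def)
        have q: "?q = p \<circ> transpose a i \<circ> transpose b j"
          using tI[OF i] tI[OF ab(1)] tJ[OF j] tJ[OF ab(2)] disj i ab j
          by (auto simp: fun_eq_iff transpose_def)
        have "(\<Prod>l\<in>I - {a}. ?q l - \<epsilon> * ?q b) = (\<Prod>l\<in>I - {a}. p (transpose a i l) - \<epsilon> * p j)"
          using tI tJ ab i j by (intro prod.cong refl) (auto simp: transpose_def)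
        also have "\<dots> = (\<Prod>l\<in>I - {i}. p l - \<epsilon> * p j)"
          using prod.reindex_bij_betw[OF permutes_bij_betw_remove[OF permutes_swap_id[OF ab(1) i], of a],
              of "\<lambda>l. p l - \<epsilon> * p j"] by simp
        finally have 1: "(\<Prod>l\<in>I - {a}. ?q l - \<epsilon> * ?q b) = (\<Prod>l\<in>I - {i}. p l - \<epsilon> * p j)" .
        have "(\<Prod>l\<in>J - {b}. ?q l - \<epsilon> * ?q a) = (\<Prod>l\<in>J - {b}. p (transpose b j l) - \<epsilon> * p i)"
          using tI[OF i] tJ by (intro prod.cong refl) auto
        also have "\<dots> = (\<Prod>l\<in>J - {j}. p l - \<epsilon> * p i)"
          using prod.reindex_bij_betw[OF permutes_bij_betw_remove[OF permutes_swap_id[OF ab(2) j], of b],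
              of "\<lambda>l. p l - \<epsilon> * p i"] by simp
        finally have 2: "(\<Prod>l\<in>J - {b}. ?q l - \<epsilon> * ?q a) = (\<Prod>l\<in>J - {j}. p l - \<epsilon> * p i)" .
        have 3: "diffs I i (p \<circ> transpose b j) = diffs I i p"
          using tI i by (auto simp: diffs_def intro!: prod.cong)
        have "diffs J j p \<noteq> 0" by (rule diffs_nonzero[OF fin(2) p(3) j])
        then show "\<Psi> ?q / diffs I i (p \<circ> transpose b j) =
          diffs J j p * (lift_weight I J i j p * g (p \<circ> transpose a i \<circ> transpose b j))"
          unfolding \<Psi>_def 1 2 3 lift_weight_def prod_dividef diffs_def[symmetric] unfolding q by simp
      qed
      also have "\<dots> = diffs J j p * (\<Sum>i\<in>I. lift_weight I J i j p * g (p \<circ> transpose a i \<circ> transpose b j))"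
        by (simp only: sum_distrib_left)
      finally show ?thesis using diffs_nonzero[OF fin(2) p(3) j] by simp
    qed
    have "f p = (\<Sum>j\<in>J. \<Sum>i\<in>I. lift_weight I J i j p * g (p \<circ> transpose a i \<circ> transpose b j))"
      unfolding f(2)[OF p(1,3)] by (intro sum.cong refl eq)
    then show ?thesis by (subst sum.swap)
  qed
  ultimately show ?thesis using f(1) unfolding is_lift_def by blast
qed

text \<open>Independence of t is stated as equality with the value at t = 1, because 1 lies in
  \<open>E\<close> in both cases while 0 is not on the torus. All pairs are listed, so that removing
  one index of each kind leaves a condition of the same form.\<close>

definition SA :: "(nat + nat) set \<Rightarrow> (nat + nat) set \<Rightarrow> ('k valuation \<Rightarrow> 'k) set" where
  "SA I J = {f \<in> RF (I \<union> J). inv_under I f \<and> inv_under J f \<and>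
    (\<forall>a\<in>I. \<forall>b\<in>J. \<forall>p\<in>pts. \<forall>t\<in>E. f (p(a := t, b := \<epsilon> * t)) = f (p(a := 1, b := \<epsilon>)))}"

definition restr :: "nat + nat \<Rightarrow> nat + nat \<Rightarrow> ('k valuation \<Rightarrow> 'k) \<Rightarrow> 'k valuation \<Rightarrow> 'k" where
  "restr a b f p = f (p(a := 1, b := \<epsilon>))"

lemma SA_D:
  assumes "f \<in> SA I J"
  shows SA_RF: "f \<in> RF (I \<union> J)" and SA_inv: "inv_under I f" "inv_under J f"
    and SA_restr: "a \<in> I \<Longrightarrow> b \<in> J \<Longrightarrow> p \<in> pts \<Longrightarrow> t \<in> E \<Longrightarrow> f (p(a := t, b := \<epsilon> * t)) = restr a b f p"
  using assms by (auto simp: SA_def restr_def)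

lemma SA_const: "(\<lambda>_. c) \<in> SA I J"
  by (auto simp: SA_def inv_under_def intro: RF.const)

lemma SA_add: "f \<in> SA I J \<Longrightarrow> g \<in> SA I J \<Longrightarrow> (\<lambda>p. f p + g p) \<in> SA I J"
  by (auto simp: SA_def inv_under_def simp del: fun_upd_apply intro: RF.add)

lemma SA_mult: "f \<in> SA I J \<Longrightarrow> g \<in> SA I J \<Longrightarrow> (\<lambda>p. f p * g p) \<in> SA I J"
  by (auto simp: SA_def inv_under_def simp del: fun_upd_apply intro: RF.mult)

lemma SA_uminus: "f \<in> SA I J \<Longrightarrow> (\<lambda>p. - f p) \<in> SA I J"
  using SA_mult[OF SA_const[of "-1"], of f I J] by simp

lemma SA_diff: "f \<in> SA I J \<Longrightarrow> g \<in> SA I J \<Longrightarrow> (\<lambda>p. f p - g p) \<in> SA I J"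
  using SA_add[OF _ SA_uminus, of f I J g] by simp

lemma SA_sum: "(\<And>i. i \<in> A \<Longrightarrow> f i \<in> SA I J) \<Longrightarrow> (\<lambda>p. \<Sum>i\<in>A. f i p) \<in> SA I J"
  by (induction A rule: infinite_finite_induct) (auto intro: SA_const SA_add)

lemma SA_power: "f \<in> SA I J \<Longrightarrow> (\<lambda>p. f p ^ n) \<in> SA I J"
  by (induction n) (auto intro: SA_const SA_mult)

lemma SA_ext:
  assumes "f \<in> SA I J" "\<And>p. p \<in> pts \<Longrightarrow> g p = f p"
  shows "g \<in> SA I J"
  using assms pts_comp pts_update E_mult eps_E one_E
  by (auto simp: SA_def inv_under_def simp del: fun_upd_apply intro: RF.ext[of f])

text \<open>Transpositions inside \<open>I\<close> and inside \<open>J\<close> carry any pair of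
  indices to \<open>(a, b)\<close>, so invariance reduces supersymmetry to this pair. The function
  \<open>h\<close> is the common value along the line.\<close>

lemma SA_from_pair:
  assumes f: "f \<in> RF (I \<union> J)" "inv_under I f" "inv_under J f" and disj: "I \<inter> J = {}" and ab: "a \<in> I" "b \<in> J"
    and pair: "\<And>p t. p \<in> pts \<Longrightarrow> t \<in> E \<Longrightarrow> f (p(a := t, b := \<epsilon> * t)) = h p"
    and h: "\<And>p t s. p \<in> pts \<Longrightarrow> t \<in> E \<Longrightarrow> s \<in> E \<Longrightarrow> h (p(a := t, b := s)) = h p"
  shows "f \<in> SA I J"
proof -
  have pair': "f (p(a := t, b := \<epsilon> * t)) = f (p(a := 1, b := \<epsilon>))" if "p \<in> pts" "t \<in> E" for p t
    using pair[OF that] pair[OF that(1) one_E] by simp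
  have "f (p(i := t, j := \<epsilon> * t)) = f (p(i := 1, j := \<epsilon>))"
    if ij: "i \<in> I" "j \<in> J" and p: "p \<in> pts" and t: "t \<in> E" for i j p t
  proof -
    have "f (p(i := t, j := \<epsilon> * t)) = f ((p \<circ> transpose a i \<circ> transpose b j)(a := t, b := \<epsilon> * t))"
      if t: "t \<in> E" for t
    proof -
      let ?q = "p(i := t, j := \<epsilon> * t)"
      have q: "?q \<in> pts" using p t pts_update E_mult eps_E by blast
      have "f ?q = f (?q \<circ> transpose a i \<circ> transpose b j)"
        using inv_underD[OF f(2) permutes_swap_id[OF ab(1) ij(1)] q]
          inv_underD[OF f(3) permutes_swap_id[OF ab(2) ij(2)] pts_comp[OF q]] by metis
      also have "?q \<circ> transpose a i \<circ> transpose b j = (p \<circ> transpose a i \<circ> transpose b j)(a := t, b := \<epsilon> * t)"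
        using disj ab ij by (auto simp: fun_eq_iff transpose_def)
      finally show ?thesis .
    qed
    from this[OF t] this[OF one_E] show ?thesis using pair'[OF pts_comp[OF pts_comp[OF p]] t] by simp
  qed
  then show ?thesis using f by (auto simp: SA_def simp del: fun_upd_apply)
qed

lemma restr_SA:
  assumes disj: "I \<inter> J = {}" and ab: "a \<in> I" "b \<in> J" and f: "f \<in> SA I J"
  shows "restr a b f \<in> SA (I - {a}) (J - {b})"
proof -
  have upd: "p(a := 1, b := \<epsilon>) \<in> pts" if "p \<in> pts" for p using that pts_update one_E eps_E by blast
  have "restr a b f \<in> RF ((I - {a}) \<union> (J - {b}))"
    unfolding restr_def[abs_def]
  proof (rule RF_subst[OF SA_RF[OF f] upd])
    fix v assume v: "v \<in> I \<union> J"
    show "(\<exists>c. \<forall>p\<in>pts. (p(a := 1, b := \<epsilon>)) v = c) \<or>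
      (\<exists>c. \<exists>u\<in>I - {a} \<union> (J - {b}). \<forall>p\<in>pts. (p(a := 1, b := \<epsilon>)) v = c * p u)"
    proof (cases "v = a \<or> v = b")
      case False
      then show ?thesis using v by (intro disjI2 exI[of _ 1] bexI[of _ v]) auto
    qed auto
  qed
  moreover have "inv_under (K - {c}) (restr a b f)" if K: "inv_under K f" "a \<notin> K - {c}" "b \<notin> K - {c}" for K c
    unfolding inv_under_def
  proof (intro allI impI ballI)
    fix \<pi> p assume \<pi>: "\<pi> permutes K - {c}" and p: "p \<in> pts"
    have "(p \<circ> \<pi>)(a := 1, b := \<epsilon>) = p(a := 1, b := \<epsilon>) \<circ> \<pi>"
      using permutes_not_in[OF \<pi> K(2)] permutes_not_in[OF \<pi> K(3)] permutes_inj[OF \<pi>]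
      by (auto simp: fun_eq_iff inj_def)
    then show "restr a b f (p \<circ> \<pi>) = restr a b f p"
      unfolding restr_def using inv_underD[OF K(1) permutes_subset[OF \<pi>] upd[OF p]] by auto
  qed
  then have "inv_under (I - {a}) (restr a b f)" "inv_under (J - {b}) (restr a b f)"
    using SA_inv[OF f] disj ab by blast+
  moreover have "restr a b f (p(i := t, j := \<epsilon> * t)) = restr a b f (p(i := 1, j := \<epsilon>))"
    if ij: "i \<in> I - {a}" "j \<in> J - {b}" and p: "p \<in> pts" "t \<in> E" for i j p t
  proof -
    have "p(i := s, j := r, a := 1, b := \<epsilon>) = p(a := 1, b := \<epsilon>, i := s, j := r)" for s r
      using ij disj ab by (auto simp: fun_eq_iff)
    then show ?thesis
      using SA_restr[OF f _ _ upd[OF p(1)] p(2), of i j] ij by (simp add: restr_def del: fun_upd_apply)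
  qed
  ultimately show ?thesis by (auto simp: SA_def simp del: fun_upd_apply)
qed

text \<open>Says that \<open>h\<close> is L(\<rho> g), as a relation, because lifts are obtained
  only through existence. With an empty index set the sum in L is empty, hence the value 0.\<close>

definition is_lift_restr where
  "is_lift_restr I J g h \<longleftrightarrow> (if I = {} \<or> J = {} then h = (\<lambda>_. 0)
    else \<exists>a\<in>I. \<exists>b\<in>J. is_lift I J a b (restr a b g) h)"

lemma is_lift_restr_RF: "is_lift_restr I J g h \<Longrightarrow> h \<in> RF (I \<union> J)"
  by (auto simp: is_lift_restr_def is_lift_def RF.const split: if_splits)

text \<open>This is \<rho> L = 1 + L \<rho>, read at the points with y_b = \<epsilon> x_a. Terms
  with exactly one of \<open>i = a\<close>, \<open>j = b\<close> contain a zero factor, and the term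
  of \<open>a\<close> and \<open>b\<close> has weight 1. In the others the factors coming from
  \<open>a\<close> and \<open>b\<close> cancel, while supersymmetry turns the value of
  \<open>g\<close> into a value of its restriction. Density covers points with coinciding
  coordinates.\<close>

lemma lift_restricts:
  assumes fin: "finite I" "finite J" and disj: "I \<inter> J = {}" and ab: "a \<in> I" "b \<in> J"
    and g: "g \<in> SA (I - {a}) (J - {b})" and f: "is_lift I J a b g f"
    and h: "is_lift_restr (I - {a}) (J - {b}) g h" and p: "p \<in> pts"
  shows "f (p(b := \<epsilon> * p a)) = g p + h p"
proof -
  let ?I = "I - {a}" and ?J = "J - {b}" and ?s = "\<lambda>p. p(b := \<epsilon> * p a)"
  have fR: "f \<in> RF (I \<union> J)" using f by (simp add: is_lift_def)
  have bI: "b \<notin> I" using ab disj by auto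
  have s_pts: "?s p \<in> pts" if "p \<in> pts" for p using that pts_update pts_E E_mult eps_E by blast
  have cong: "g p = g q" if "p \<in> pts" "q \<in> pts" "\<And>v. v \<in> ?I \<union> ?J \<Longrightarrow> p v = q v" for p q
    by (rule RF_cong[OF SA_RF[OF g] that])
  have main: "f (?s p) = g p + h p" if p: "p \<in> pts" and injI: "inj_on p I" and injJ: "inj_on (?s p) J" for p
  proof -
    let ?q = "?s p"
    have q: "?q a = p a" "?q b = \<epsilon> * p a" "\<And>v. v \<noteq> b \<Longrightarrow> ?q v = p v" using ab disj by auto
    have qI: "?q i = p i" if "i \<in> I" for i using that disj ab by auto
    have eps: "\<epsilon> * (\<epsilon> * x) = x" for x using eps_sq by (metis mult.assoc mult_1)
    have injI': "inj_on ?q I" using injI qI by (auto simp: inj_on_def)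
    define T where "T = (\<lambda>i j. lift_weight I J i j ?q * g (?q \<circ> transpose a i \<circ> transpose b j))"
    have fq: "f ?q = (\<Sum>i\<in>I. \<Sum>j\<in>J. T i j)"
      using f s_pts[OF p] injI' injJ by (auto simp: is_lift_def T_def simp del: fun_upd_apply)
    have Taj: "T a j = 0" if "j \<in> ?J" for j
    proof -
      have "b \<in> J - {j}" "finite (J - {j})" "?q b - \<epsilon> * ?q a = 0" using that ab fin q by auto
      then have "(\<Prod>l\<in>J - {j}. (?q l - \<epsilon> * ?q a) / (?q l - ?q j)) = 0"
        by (intro prod_zero bexI[of _ b]) (simp_all del: fun_upd_apply)
      then show ?thesis by (simp add: T_def lift_weight_def del: fun_upd_apply)
    qed
    have Tib: "T i b = 0" if "i \<in> ?I" for i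
    proof -
      have "a \<in> I - {i}" "finite (I - {i})" "?q a - \<epsilon> * ?q b = 0" using that ab fin q eps by auto
      then have "(\<Prod>l\<in>I - {i}. (?q l - \<epsilon> * ?q b) / (?q l - ?q i)) = 0"
        by (intro prod_zero bexI[of _ a]) (simp_all del: fun_upd_apply)
      then show ?thesis by (simp add: T_def lift_weight_def del: fun_upd_apply)
    qed
    \<comment> \<open>Since \<open>\<epsilon> * (\<epsilon> * p a) = p a\<close>, the numerator and
      the denominator of each factor agree.\<close>
    have Tab: "T a b = g p"
    proof -
      have "(\<Prod>l\<in>I - {a}. (?q l - \<epsilon> * ?q b) / (?q l - ?q a)) = 1"
        using injI' ab unfolding q(1,2) eps by (intro prod.neutral) (auto simp: inj_on_def q(1) simp del: fun_upd_apply)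
      moreover have "(\<Prod>l\<in>J - {b}. (?q l - \<epsilon> * ?q a) / (?q l - ?q b)) = 1"
        using injJ ab unfolding q(1,2) by (intro prod.neutral) (auto simp: inj_on_def q(1,2) simp del: fun_upd_apply)
      moreover have "g ?q = g p" using bI by (intro cong s_pts p) auto
      ultimately show ?thesis by (simp add: T_def lift_weight_def del: fun_upd_apply)
    qed
    have "f ?q = (\<Sum>j\<in>J. T a j) + (\<Sum>i\<in>?I. \<Sum>j\<in>J. T i j)"
      unfolding fq by (rule sum.remove[OF fin(1) ab(1)])
    also have "(\<Sum>j\<in>J. T a j) = g p"
      using Taj Tab by (subst sum.remove[OF fin(2) ab(2)]) (auto simp: sum.neutral)
    also have "(\<Sum>i\<in>?I. \<Sum>j\<in>J. T i j) = (\<Sum>i\<in>?I. \<Sum>j\<in>?J. T i j)"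
    proof (rule sum.cong[OF refl])
      fix i assume "i \<in> ?I"
      then show "(\<Sum>j\<in>J. T i j) = (\<Sum>j\<in>?J. T i j)"
        using sum.remove[OF fin(2) ab(2), of "T i"] Tib by simp
    qed
    also have "(\<Sum>i\<in>?I. \<Sum>j\<in>?J. T i j) = h p"
    proof (cases "?I = {} \<or> ?J = {}")
      case True
      then have "h p = 0" using h by (simp add: is_lift_restr_def)
      moreover have "(\<Sum>i\<in>?I. \<Sum>j\<in>?J. T i j) = 0" using True by (elim disjE) (simp_all only: sum.empty sum.neutral_const)
      ultimately show ?thesis by simp
    next
      case False
      then obtain a' b' where ab': "a' \<in> ?I" "b' \<in> ?J" and lh: "is_lift ?I ?J a' b' (restr a' b' g) h"
        using h by (auto simp: is_lift_restr_def)
      have "inj_on p ?I" "inj_on p ?J"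
        using injI injJ by (auto simp: inj_on_def)
      then have "h p = (\<Sum>i\<in>?I. \<Sum>j\<in>?J. lift_weight ?I ?J i j p *
          restr a' b' g (p \<circ> transpose a' i \<circ> transpose b' j))"
        using lh p by (simp add: is_lift_def)
      also have "\<dots> = (\<Sum>i\<in>?I. \<Sum>j\<in>?J. T i j)"
      proof (intro sum.cong refl)
        fix i j assume ij: "i \<in> ?I" "j \<in> ?J"
        have nz: "p a - p i \<noteq> 0" "\<epsilon> * p a - p j \<noteq> 0"
          using injI injJ ij ab disj q by (auto simp: inj_on_def)
        have w1: "(\<Prod>l\<in>I - {i}. (?q l - \<epsilon> * ?q j) / (?q l - ?q i)) =
          (p a - \<epsilon> * p j) / (p a - p i) * (\<Prod>l\<in>?I - {i}. (p l - \<epsilon> * p j) / (p l - p i))"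
        proof -
          have "I - {i} = insert a (?I - {i})" using ab ij by auto
          moreover have "(\<Prod>l\<in>?I - {i}. (?q l - \<epsilon> * ?q j) / (?q l - ?q i)) =
            (\<Prod>l\<in>?I - {i}. (p l - \<epsilon> * p j) / (p l - p i))"
            using ij disj ab by (intro prod.cong refl) (auto simp: qI)
          ultimately show ?thesis using fin ij q qI[of i] by (simp del: fun_upd_apply)
        qed
        have w2: "(\<Prod>l\<in>J - {j}. (?q l - \<epsilon> * ?q i) / (?q l - ?q j)) =
          (\<epsilon> * p a - \<epsilon> * p i) / (\<epsilon> * p a - p j) * (\<Prod>l\<in>?J - {j}. (p l - \<epsilon> * p i) / (p l - p j))"
        proof -
          have "J - {j} = insert b (?J - {j})" using ab ij by auto
          moreover have "(\<Prod>l\<in>?J - {j}. (?q l - \<epsilon> * ?q i) / (?q l - ?q j)) =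
            (\<Prod>l\<in>?J - {j}. (p l - \<epsilon> * p i) / (p l - p j))"
            using ij disj ab by (intro prod.cong refl) (auto simp: qI)
          ultimately show ?thesis using fin ij q qI[of i] by (simp del: fun_upd_apply)
        qed
        \<comment> \<open>The contributions of \<open>a\<close> and \<open>b\<close> to the weight
          cancel because the square of \<epsilon> is 1.\<close>
        have w3: "(p a - \<epsilon> * p j) / (p a - p i) * ((\<epsilon> * p a - \<epsilon> * p i) / (\<epsilon> * p a - p j)) = 1"
        proof -
          have "\<epsilon> * p a - \<epsilon> * p i = \<epsilon> * (p a - p i)" by (simp add: algebra_simps)
          then have "(p a - \<epsilon> * p j) * (\<epsilon> * p a - \<epsilon> * p i) = ((p a - \<epsilon> * p j) * \<epsilon>) * (p a - p i)"
            by (simp only: mult.assoc)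
          moreover have "(p a - \<epsilon> * p j) * \<epsilon> = \<epsilon> * p a - p j" unfolding mult.commute[of _ \<epsilon>] right_diff_distrib eps ..
          ultimately have "(p a - \<epsilon> * p j) * (\<epsilon> * p a - \<epsilon> * p i) = (p a - p i) * (\<epsilon> * p a - p j)"
            by (simp only: mult.commute)
          then show ?thesis using nz by simp
        qed
        have r: "x * y * (z * w) = (x * z) * (y * w)" for x y z w :: 'k by (simp only: mult_ac)
        have w: "lift_weight I J i j ?q = lift_weight ?I ?J i j p"
          unfolding lift_weight_def w1 w2 by (subst r) (simp only: w3 mult_1)
        let ?x = "?q \<circ> transpose a i \<circ> transpose b j"
        have n: "i \<notin> J" "a \<notin> J" "j \<notin> I" "i \<noteq> j" "b \<noteq> i" using ij ab disj by auto
        \<comment> \<open>The slots \<open>i\<close> and \<open>j\<close> of \<open>?x\<close> hold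
          \<open>p a\<close> and \<open>\<epsilon> * p a\<close>, a pair along which
          \<open>g\<close> is constant, so both can be reset to 1 and \<epsilon>.\<close>
        have "transpose a i (transpose b j i) = a" "transpose a i (transpose b j j) = b"
          using n ab ij by (auto simp: transpose_def)
        then have x: "?x i = p a" "?x j = \<epsilon> * p a" unfolding comp_apply using q(1,2) by simp_all
        have xp: "?x \<in> pts" by (intro pts_comp s_pts p)
        have "?x(i := p a, j := \<epsilon> * p a) = ?x" using x(1,2) by (metis fun_upd_triv)
        then have "g ?x = restr i j g ?x"
          using SA_restr[OF g ij xp pts_E[OF p, of a]] by metis
        also have "\<dots> = g (?x(i := 1, j := \<epsilon>))" by (simp add: restr_def)
        \<comment> \<open>Invariance of \<open>g\<close> moves the reset pair from \<open>i\<close>,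
          \<open>j\<close> to the indices \<open>a'\<close>, \<open>b'\<close> chosen for the
          smaller lift.\<close>
        also have "\<dots> = g (?x(i := 1, j := \<epsilon>) \<circ> transpose a' i \<circ> transpose b' j)"
        proof -
          have y: "?x(i := 1, j := \<epsilon>) \<in> pts" using xp pts_update one_E eps_E by blast
          show ?thesis
            using inv_underD[OF SA_inv(1)[OF g] permutes_swap_id[OF ab'(1) ij(1)] y]
              inv_underD[OF SA_inv(2)[OF g] permutes_swap_id[OF ab'(2) ij(2)] pts_comp[OF y]] by metis
        qed
        also have "\<dots> = g ((p \<circ> transpose a' i \<circ> transpose b' j)(a' := 1, b' := \<epsilon>))"
        proof (rule cong)
          show "?x(i := 1, j := \<epsilon>) \<circ> transpose a' i \<circ> transpose b' j \<in> pts"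
            "(p \<circ> transpose a' i \<circ> transpose b' j)(a' := 1, b' := \<epsilon>) \<in> pts"
            using xp p pts_update pts_comp one_E eps_E by blast+
          fix v assume v: "v \<in> ?I \<union> ?J"
          have "x \<noteq> y" if "x \<in> I" "y \<in> J" for x y using that disj by auto
          then have ne: "i \<noteq> j" "i \<noteq> b" "i \<noteq> b'" "a \<noteq> j" "a \<noteq> b" "a \<noteq> b'" "a' \<noteq> j" "a' \<noteq> b" "a' \<noteq> b'"
            "i \<noteq> a" "a' \<noteq> a" "j \<noteq> b" "b' \<noteq> b" "v \<noteq> a" "v \<noteq> b" "v \<in> I \<Longrightarrow> v \<noteq> j \<and> v \<noteq> b'" "v \<in> J \<Longrightarrow> v \<noteq> i \<and> v \<noteq> a'"
            using v ij ab ab' by auto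
          have "v \<in> I \<or> v \<in> J" using v by auto
          then show "(?x(i := 1, j := \<epsilon>) \<circ> transpose a' i \<circ> transpose b' j) v =
            ((p \<circ> transpose a' i \<circ> transpose b' j)(a' := 1, b' := \<epsilon>)) v"
          proof
            assume "v \<in> I"
            then have "v \<noteq> j" "v \<noteq> b'" using ne by auto
            then show ?thesis using ne(1-15)[symmetric] ne(1-15)
              by (cases "v = a'"; cases "v = i") (simp_all add: transpose_def)
          next
            assume "v \<in> J"
            then have "v \<noteq> i" "v \<noteq> a'" using ne by auto
            then show ?thesis using ne(1-15)[symmetric] ne(1-15)
              by (cases "v = b'"; cases "v = j") (simp_all add: transpose_def)
          qed
        qed
        also have "\<dots> = restr a' b' g (p \<circ> transpose a' i \<circ> transpose b' j)" by (simp add: restr_def)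
        finally show "lift_weight ?I ?J i j p * restr a' b' g (p \<circ> transpose a' i \<circ> transpose b' j) = T i j"
          by (simp add: T_def w)
      qed
      finally show ?thesis by simp
    qed
    finally show ?thesis .
  qed
  let ?V = "I \<union> J"
  have V: "finite ?V" using fin by simp
  have ghV: "g \<in> RF ?V" "h \<in> RF ?V"
    using RF_mono[OF SA_RF[OF g], of ?V] RF_mono[OF is_lift_restr_RF[OF h], of ?V] by auto
  have sV: "(\<lambda>p. k (?s p)) \<in> RF ?V" if "k \<in> RF ?V" for k
    using that by (rule RF_update_coord) (use ab eps_E in auto)
  have dV: "(\<lambda>p. \<Prod>i\<in>K. diffs K i p) \<in> RF ?V" if "K \<subseteq> ?V" for K
    using that by (intro RF_prod diffs_RF) auto
  have nz: "inj_on p K" if "(\<Prod>i\<in>K. diffs K i p) \<noteq> 0" "finite K" for K p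
  proof (rule inj_onI, rule ccontr)
    fix x y assume xy: "x \<in> K" "y \<in> K" "p x = p y" "x \<noteq> y"
    then have "diffs K x p = 0" using that(2) by (auto simp: diffs_def)
    then show False using that xy by auto
  qed
  obtain q where q: "q \<in> pts" "inj_on q (I \<union> J)" using exists_inj_point[OF V] by blast
  have ep0: "\<epsilon> \<noteq> 0" using eps_sq by auto
  obtain y where y: "y \<in> pts" "inj_on y I" "inj_on (?s y) J"
  proof -
    \<comment> \<open>Values must be distinct on \<open>I\<close>, and also on \<open>J\<close>
      after \<open>b\<close> receives \<epsilon> times the value at \<open>a\<close>. Scaling the
      values on \<open>J\<close> by \<epsilon> reduces both to the distinctness of the values of
      \<open>q\<close>.\<close>
    define y where "y = (\<lambda>v. if v \<in> J then \<epsilon> * q v else q v)"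
    have "y \<in> pts" using q(1) by (auto simp: pts_def y_def intro: E_mult eps_E)
    moreover have "inj_on y I" using q(2) disj by (auto simp: inj_on_def y_def)
    moreover have "inj_on (?s y) J"
      using q(2) disj ab ep0 by (auto simp: inj_on_def y_def)
    ultimately show ?thesis by (rule that)
  qed
  show ?thesis
  proof (rule RF_density[OF V sV[OF fR] RF.add[OF ghV] _ y(1) _ _ p])
    show "(\<lambda>p. (\<Prod>i\<in>I. diffs I i p) * (\<Prod>i\<in>J. diffs J i (?s p))) \<in> RF ?V"
      by (intro RF.mult sV[OF dV] dV) auto
    show "(\<Prod>i\<in>I. diffs I i y) * (\<Prod>i\<in>J. diffs J i (?s y)) \<noteq> 0"
      using diffs_nonzero[OF fin(1) y(2)] diffs_nonzero[OF fin(2) y(3)] fin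
      by (simp del: fun_upd_apply)
    fix r assume r: "r \<in> pts" "(\<Prod>i\<in>I. diffs I i r) * (\<Prod>i\<in>J. diffs J i (?s r)) \<noteq> 0"
    then have "(\<Prod>i\<in>I. diffs I i r) \<noteq> 0" "(\<Prod>i\<in>J. diffs J i (?s r)) \<noteq> 0" by (metis mult_eq_0_iff)+
    then show "f (?s r) = g r + h r" by (intro main r nz fin)
  qed
qed

text \<open>As \<open>g\<close> and \<open>h\<close> read neither \<open>a\<close> nor
  \<open>b\<close>, the restriction formula shows that the lift does not change along x_a = t, y_b =
  \<epsilon> t.\<close>

lemma lift_SA:
  assumes fin: "finite I" "finite J" and disj: "I \<inter> J = {}" and ab: "a \<in> I" "b \<in> J"
    and g: "g \<in> SA (I - {a}) (J - {b})" and f: "is_lift I J a b g f"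
    and h: "is_lift_restr (I - {a}) (J - {b}) g h"
  shows "f \<in> SA I J" "p \<in> pts \<Longrightarrow> restr a b f p = g p + h p"
proof -
  have gh: "g (p(a := t, b := s)) + h (p(a := t, b := s)) = g p + h p" if "p \<in> pts" "t \<in> E" "s \<in> E" for p t s
  proof -
    have "p(a := t, b := s) \<in> pts" using that pts_update by blast
    then show ?thesis
      using that disj ab by (intro arg_cong2[of _ _ _ _ "(+)"] RF_cong[OF SA_RF[OF g]] RF_cong[OF is_lift_restr_RF[OF h]]) auto
  qed
  have eq: "f (p(a := t, b := \<epsilon> * t)) = g p + h p" if "p \<in> pts" "t \<in> E" for p t
  proof -
    have "p(a := t) \<in> pts" using that pts_update by blast
    moreover have "a \<noteq> b" using ab disj by auto
    then have "(p(a := t))(b := \<epsilon> * (p(a := t)) a) = p(a := t, b := \<epsilon> * t)" by simp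
    ultimately have "f (p(a := t, b := \<epsilon> * t)) = g (p(a := t)) + h (p(a := t))"
      using lift_restricts[OF fin disj ab g f h, of "p(a := t)"] by metis
    also have "\<dots> = g p + h p" using gh[OF that, of "p b"] \<open>a \<noteq> b\<close> that pts_E
      by (metis fun_upd_triv fun_upd_twist)
    finally show ?thesis .
  qed
  show "f \<in> SA I J" using f eq gh disj ab by (intro SA_from_pair[where h = "\<lambda>p. g p + h p"]) (auto simp: is_lift_def simp del: fun_upd_apply)
  show "restr a b f p = g p + h p" if "p \<in> pts" using eq[OF that one_E] by (simp add: restr_def)
qed

lemma is_lift_cong:
  assumes "is_lift I J a b g f" "\<And>p. p \<in> pts \<Longrightarrow> g p = g' p"
  shows "is_lift I J a b g' f"
  using assms pts_comp by (auto simp: is_lift_def intro!: sum.cong)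

text \<open>On \<open>SA I J\<close>, restriction followed by lifting is an operator \<open>T\<close> with \<open>c + T\<close> onto for every
  \<open>c > 0\<close>, by induction from the commutation rule \<open>restr \<circ> lift = 1 + lift \<circ> restr\<close>.\<close>

lemma shifted_lift_restr_onto:
  assumes "finite I" "finite J" "I \<inter> J = {}" "c > 0" "g \<in> SA I J"
  shows "\<exists>f h. f \<in> SA I J \<and> is_lift_restr I J f h \<and> (\<forall>p\<in>pts. of_nat c * f p + h p = g p)"
  using assms
proof (induction "card I" arbitrary: I J c g rule: less_induct)
  case less
  have c0: "of_nat c \<noteq> (0 :: 'k)" using less.prems by simp
  show ?case
  proof (cases "I = {} \<or> J = {}")
    case True
    then show ?thesis using less.prems c0
      by (intro exI[of _ "\<lambda>p. inverse (of_nat c) * g p"] exI[of _ "\<lambda>_. 0"])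
        (auto simp: is_lift_restr_def intro!: SA_mult SA_const)
  next
    case False
    then obtain a b where ab: "a \<in> I" "b \<in> J" by blast
    let ?I = "I - {a}" and ?J = "J - {b}"
    have fin: "finite ?I" "finite ?J" "?I \<inter> ?J = {}" using less.prems by auto
    have card: "card ?I < card I" using ab less.prems by (intro psubset_card_mono) auto
    note gr = restr_SA[OF less.prems(3) ab less.prems(5)]
    \<comment> \<open>Applying \<rho> to the desired equation c k + L(\<rho> k) = g shows that u =
      \<rho> k must solve (c + 1) u + L(\<rho> u) = \<rho> g, the additional u coming from \<rho> L
      = 1 + L \<rho>. The induction hypothesis supplies such a u.\<close>
    from less.hyps[OF card fin _ gr, of "Suc c"] obtain u v where
      u: "u \<in> SA ?I ?J" "is_lift_restr ?I ?J u v" "\<forall>p\<in>pts. of_nat (Suc c) * u p + v p = restr a b g p"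
      by blast
    obtain f where f: "is_lift I J a b u f"
      using lift_exists[OF less.prems(1-3) ab SA_RF[OF u(1)] SA_inv[OF u(1)]] by blast
    note fS = lift_SA[OF less.prems(1-3) ab u(1) f u(2)]
    \<comment> \<open>With \<open>f\<close> the lift of \<open>u\<close>, the equation forces this
      \<open>k\<close>; it satisfies \<rho> k = u. Dividing by \<open>c\<close> uses characteristic
      zero.\<close>
    define k where "k = (\<lambda>p. inverse (of_nat c) * (g p - f p))"
    have k: "k \<in> SA I J" unfolding k_def by (intro SA_mult SA_const SA_diff less.prems fS)
    have "u p = restr a b k p" if p: "p \<in> pts" for p
    proof -
      have "restr a b g p = (of_nat c * u p + u p) + v p"
        using bspec[OF u(3) p] by (simp only: of_nat_Suc distrib_right mult_1 add.commute)
      then have "restr a b g p - restr a b f p = of_nat c * u p" unfolding fS(2)[OF p] by simp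
      moreover have "restr a b k p = inverse (of_nat c) * (restr a b g p - restr a b f p)"
        by (simp add: restr_def k_def)
      ultimately have "restr a b k p = inverse (of_nat c) * (of_nat c * u p)" by simp
      then show ?thesis using c0 by simp
    qed
    then have "is_lift I J a b (restr a b k) f" by (rule is_lift_cong[OF f])
    then have "is_lift_restr I J k f" using ab by (auto simp: is_lift_restr_def)
    moreover have "of_nat c * k p + f p = g p" for p
      unfolding k_def using right_inverse[OF c0] by (simp only: mult.assoc[symmetric] mult_1 diff_add_cancel)
    ultimately show ?thesis using k by blast
  qed
qed

text \<open>On the smaller index sets the operator 1 + L \<rho> equals \<rho> L, so the case c = 1
  gives a \<open>u\<close> whose lift is the preimage.\<close>

theorem restr_onto:
  assumes fin: "finite I" "finite J" and disj: "I \<inter> J = {}" and ab: "a \<in> I" "b \<in> J"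
    and g: "g \<in> SA (I - {a}) (J - {b})"
  shows "\<exists>f\<in>SA I J. \<forall>p\<in>pts. restr a b f p = g p"
proof -
  have fin': "finite (I - {a})" "finite (J - {b})" "(I - {a}) \<inter> (J - {b}) = {}" using fin disj by auto
  obtain u v where u: "u \<in> SA (I - {a}) (J - {b})" "is_lift_restr (I - {a}) (J - {b}) u v"
    "\<And>p. p \<in> pts \<Longrightarrow> u p + v p = g p"
    using shifted_lift_restr_onto[OF fin' _ g, of 1] by auto
  obtain f where f: "is_lift I J a b u f"
    using lift_exists[OF fin disj ab SA_RF[OF u(1)] SA_inv[OF u(1)]] by blast
  show ?thesis using lift_SA[OF fin disj ab u(1) f u(2)] u(3) by auto
qed

end

section \<open>The Nullstellensatz for supersymmetric functions\<close>

lemma poly_funs_cong: "f \<in> poly_funs V \<Longrightarrow> (\<And>v. v \<in> V \<Longrightarrow> p v = q v) \<Longrightarrow> f p = f q"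
  by (induction rule: poly_funs.induct) auto

context point_functions
begin

lemma poly_funs_RF: "f \<in> poly_funs V \<Longrightarrow> f \<in> RF V"
  by (induction rule: poly_funs.induct) (auto intro: RF_intros)

lemma poly_funs_prod: "(\<And>i. i \<in> A \<Longrightarrow> f i \<in> poly_funs V) \<Longrightarrow> (\<lambda>p. \<Prod>i\<in>A. f i p) \<in> poly_funs V"
  by (induction A rule: infinite_finite_induct) (auto intro: poly_funs.intros)

lemma poly_funs_power: "f \<in> poly_funs V \<Longrightarrow> (\<lambda>p. f p ^ n) \<in> poly_funs V"
  by (induction n) (auto intro: poly_funs.intros)

text \<open>A power of the product of all coordinates removes the negative exponents. In case S
  there are none and \<open>K\<close> is 0, which matters because that product has zeros on affine
  space.\<close>

lemma RF_clear_denominators: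
  assumes V: "finite V" and "f \<in> RF V"
  shows "\<exists>K. \<exists>g\<in>poly_funs V. (E = UNIV \<longrightarrow> K = 0) \<and> (\<forall>p\<in>pts. (\<Prod>v\<in>V. p v) ^ K * f p = g p)"
  using assms(2)
proof (induction rule: RF.induct)
  case (const c)
  show ?case by (intro exI[of _ 0] bexI[OF _ poly_funs.const[of c]]) auto
next
  case (gen v e)
  show ?case
  proof (cases "E = UNIV")
    case True
    moreover have "E \<noteq> - {0}" using True by auto
    ultimately obtain n where "\<And>t. pw t e = t ^ n" using E_cases by blast
    then show ?thesis
      by (intro exI[of _ 0] bexI[OF _ poly_funs_power[OF poly_funs.coord[OF gen], of n]]) auto
  next
    case False
    then obtain K n where Kn: "\<And>t. t \<in> E \<Longrightarrow> t ^ K * pw t e = t ^ n" using E_cases by blast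
    show ?thesis
    proof (intro exI[of _ K] bexI conjI ballI impI)
      show "(\<lambda>p. (\<Prod>u\<in>V - {v}. p u) ^ K * p v ^ n) \<in> poly_funs V"
        by (intro poly_funs.mult poly_funs_power poly_funs_prod poly_funs.coord gen) auto
      fix p assume p: "p \<in> pts"
      have "(\<Prod>u\<in>V. p u) ^ K * pw (p v) e = (\<Prod>u\<in>V - {v}. p u) ^ K * (p v ^ K * pw (p v) e)"
        by (simp add: prod.remove[OF V gen] power_mult_distrib mult_ac)
      then show "(\<Prod>u\<in>V. p u) ^ K * pw (p v) e = (\<Prod>u\<in>V - {v}. p u) ^ K * p v ^ n"
        using Kn[OF pts_E[OF p]] by simp
    qed (use False in auto)
  qed
next
  case (add f g)
  then obtain K f' L g' where *: "f' \<in> poly_funs V" "E = UNIV \<longrightarrow> K = 0"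
      "\<And>p. p \<in> pts \<Longrightarrow> (\<Prod>v\<in>V. p v) ^ K * f p = f' p"
    and **: "g' \<in> poly_funs V" "E = UNIV \<longrightarrow> L = 0" "\<And>p. p \<in> pts \<Longrightarrow> (\<Prod>v\<in>V. p v) ^ L * g p = g' p"
    by blast
  show ?case
  proof (intro exI[of _ "K + L"] bexI conjI ballI impI)
    show "(\<lambda>p. (\<Prod>v\<in>V. p v) ^ L * f' p + (\<Prod>v\<in>V. p v) ^ K * g' p) \<in> poly_funs V"
      by (intro poly_funs.add poly_funs.mult poly_funs_power poly_funs_prod poly_funs.coord * **)
    fix p assume "p \<in> pts"
    then show "(\<Prod>v\<in>V. p v) ^ (K + L) * (f p + g p) = (\<Prod>v\<in>V. p v) ^ L * f' p + (\<Prod>v\<in>V. p v) ^ K * g' p"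
      by (simp add: *(3)[symmetric] **(3)[symmetric] power_add algebra_simps)
  qed (use * ** in auto)
next
  case (mult f g)
  then obtain K f' L g' where *: "f' \<in> poly_funs V" "E = UNIV \<longrightarrow> K = 0"
      "\<And>p. p \<in> pts \<Longrightarrow> (\<Prod>v\<in>V. p v) ^ K * f p = f' p"
    and **: "g' \<in> poly_funs V" "E = UNIV \<longrightarrow> L = 0" "\<And>p. p \<in> pts \<Longrightarrow> (\<Prod>v\<in>V. p v) ^ L * g p = g' p"
    by blast
  show ?case
  proof (intro exI[of _ "K + L"] bexI conjI ballI impI)
    show "(\<lambda>p. f' p * g' p) \<in> poly_funs V" by (intro poly_funs.mult * **)
    fix p assume "p \<in> pts"
    then show "(\<Prod>v\<in>V. p v) ^ (K + L) * (f p * g p) = f' p * g' p"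
      by (simp add: *(3)[symmetric] **(3)[symmetric] power_add algebra_simps)
  qed (use * ** in auto)
next
  case (ext f g)
  then show ?case by auto
qed

lemma prod_invertible:
  assumes "finite V" "E \<noteq> UNIV"
  shows "\<exists>f\<in>RF V. \<forall>p\<in>pts. f p * (\<Prod>v\<in>V. p v) = 1"
proof -
  obtain e where e: "\<And>t. t \<in> E \<Longrightarrow> pw t e * t = 1" using assms E_cases by blast
  have "(\<Prod>v\<in>V. pw (p v) e) * (\<Prod>v\<in>V. p v) = 1" if "p \<in> pts" for p
    unfolding prod.distrib[symmetric] using e pts_E[OF that] by (intro prod.neutral) auto
  then show ?thesis by (intro bexI[OF _ RF_prod[OF RF.gen]]) auto
qed

text \<open>In case L the torus is where the product \<open>?M\<close> of the coordinates is
  nonzero. The affine theorem is applied to \<open>f\<close> with denominators cleared and one more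
  factor \<open>?M\<close>, which makes it vanish off the torus as well; in the end the power of
  \<open>?M\<close> is inverted.\<close>

theorem Nullstellensatz_RF:
  assumes V: "finite V" and G: "G \<subseteq> RF V" and f: "f \<in> RF V"
    and van: "\<And>p. p \<in> pts \<Longrightarrow> (\<And>g. g \<in> G \<Longrightarrow> g p = 0) \<Longrightarrow> f p = 0"
  shows "\<exists>N T r. finite T \<and> T \<subseteq> G \<and> (\<forall>g\<in>T. r g \<in> RF V) \<and> (\<forall>p\<in>pts. f p ^ N = (\<Sum>g\<in>T. g p * r g p))"
proof -
  let ?M = "\<lambda>p. \<Prod>v\<in>V. p v"
  have MV: "?M \<in> poly_funs V" by (intro poly_funs_prod poly_funs.coord)
  obtain K h where h: "\<And>g. g \<in> RF V \<Longrightarrow> h g \<in> poly_funs V" "\<And>g. g \<in> RF V \<Longrightarrow> E = UNIV \<Longrightarrow> K g = 0"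
    "\<And>g p. g \<in> RF V \<Longrightarrow> p \<in> pts \<Longrightarrow> ?M p ^ K g * g p = h g p"
    using RF_clear_denominators[OF V] by metis
  \<comment> \<open>The extra factor belongs to case L only: in case S the zeros of
    \<open>?M\<close> are ordinary points and \<open>?M\<close> has no inverse.\<close>
  define d where "d = (if E = UNIV then 0 else 1 :: nat)"
  have fV: "(\<lambda>p. ?M p ^ d * h f p) \<in> poly_funs V" by (intro poly_funs.mult poly_funs_power MV h f)
  have hz: "g p = 0" if "g \<in> RF V" "p \<in> pts" "h g p = 0" "E = UNIV \<or> ?M p \<noteq> 0" for g p
    using h(2)[OF that(1)] h(3)[OF that(1,2)] that(3,4) by auto
  have hG: "h ` G \<subseteq> poly_funs V" using h(1) G by blast
  have "?M p ^ d * h f p = 0" if zero: "\<And>g. g \<in> h ` G \<Longrightarrow> g p = 0" for p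
  proof (cases "E = UNIV \<or> ?M p \<noteq> 0")
    case True
    \<comment> \<open>Functions in \<open>V\<close> do not see the other coordinates of
      \<open>p\<close>, which may be 0; replacing these by 1 moves the point into
      \<open>pts\<close>.\<close>
    define q where "q = (if E = UNIV then p else (\<lambda>v. if v \<in> V then p v else 1))"
    have q: "q \<in> pts" "?M q = ?M p" "\<And>v. v \<in> V \<Longrightarrow> q v = p v"
      using True V E_cases by (auto simp: q_def pts_def prod_zero_iff intro!: prod.cong)
    have "g q = 0" if g: "g \<in> G" for g
    proof (rule hz[of g q])
      show "h g q = 0" using zero[of "h g"] g poly_funs_cong[OF h(1)[of g], of q p] q(3) G by auto
    qed (use g G q True in auto)
    then have "f q = 0" using van[OF q(1)] by blast
    then have "h f q = 0" using h(3)[OF f q(1)] by simp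
    then have "h f p = 0" using poly_funs_cong[OF h(1)[OF f], of q p] q(3) by simp
    then show ?thesis by simp
  qed (auto simp: d_def)
  from Nullstellensatz_poly_funs[OF V hG fV this] obtain N T r where T: "finite T" "T \<subseteq> h ` G"
    "\<forall>g\<in>T. r g \<in> poly_funs V" "\<And>p. (?M p ^ d * h f p) ^ N = (\<Sum>g\<in>T. g p * r g p)" by blast
  \<comment> \<open>Different members of \<open>G\<close> may have the same cleared form;
    \<open>U\<close> picks one preimage for each function in \<open>T\<close>, so that sums can be
    reindexed.\<close>
  obtain U where U: "U \<subseteq> G" "inj_on h U" "T = h ` U" using T(2) by (auto simp: subset_image_inj)
  have finU: "finite U" using T(1) U by (auto dest: finite_imageD)
  \<comment> \<open>An inverse of the total power of \<open>?M\<close> that clears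
    \<open>f p ^ N\<close>; in case S its exponent is 0.\<close>
  obtain L where L: "L \<in> RF V" "\<And>p. p \<in> pts \<Longrightarrow> L p * ?M p ^ ((d + K f) * N) = 1"
  proof (cases "E = UNIV")
    case True
    then show ?thesis using h(2)[OF f True] by (intro that[OF RF.const[of 1]]) (auto simp: d_def)
  next
    case False
    obtain l where "l \<in> RF V" "\<And>p. p \<in> pts \<Longrightarrow> l p * ?M p = 1" using prod_invertible[OF V False] by blast
    then show ?thesis
      by (intro that[OF RF_power[of l V "(d + K f) * N"]]) (auto simp flip: power_mult_distrib)
  qed
  show ?thesis
  proof (intro exI[of _ N] exI[of _ U] exI[of _ "\<lambda>g p. L p * ?M p ^ K g * r (h g) p"] conjI ballI)
    show "(\<lambda>p. L p * ?M p ^ K g * r (h g) p) \<in> RF V" if "g \<in> U" for g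
      using that T(3) U by (intro RF.mult L RF_power poly_funs_RF MV) auto
    fix p assume p: "p \<in> pts"
    have "f p ^ N = L p * ?M p ^ ((d + K f) * N) * f p ^ N" using L(2)[OF p] by simp
    also have "?M p ^ ((d + K f) * N) = (?M p ^ d * ?M p ^ K f) ^ N" by (simp only: power_mult power_add)
    also have "L p * (?M p ^ d * ?M p ^ K f) ^ N * f p ^ N = L p * (?M p ^ d * (?M p ^ K f * f p)) ^ N"
      by (simp only: power_mult_distrib mult.assoc)
    also have "\<dots> = L p * (\<Sum>g\<in>T. g p * r g p)" unfolding h(3)[OF f p] T(4) ..
    also have "(\<Sum>g\<in>T. g p * r g p) = (\<Sum>g\<in>U. h g p * r (h g) p)"
      unfolding U(3) by (subst sum.reindex[OF U(2)]) simp
    also have "L p * \<dots> = (\<Sum>g\<in>U. g p * (L p * ?M p ^ K g * r (h g) p))"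
      unfolding sum_distrib_left
    proof (intro sum.cong refl)
      fix g assume "g \<in> U"
      then have "h g p = ?M p ^ K g * g p" using h(3)[OF _ p] U(1) G by auto
      then show "L p * (h g p * r (h g) p) = g p * (L p * ?M p ^ K g * r (h g) p)" by (simp add: mult_ac)
    qed
    finally show "f p ^ N = (\<Sum>g\<in>U. g p * (L p * ?M p ^ K g * r (h g) p))" .
  qed (use finU U in auto)
qed

text \<open>The Reynolds operator of the symmetric group on \<open>K\<close>, whose order is
  invertible in characteristic zero.\<close>

definition average :: "(nat + nat) set \<Rightarrow> ('k valuation \<Rightarrow> 'k) \<Rightarrow> 'k valuation \<Rightarrow> 'k" where
  "average K r p = inverse (fact (card K)) * (\<Sum>\<pi> | \<pi> permutes K. r (p \<circ> \<pi>))"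

lemma average_RF:
  assumes "r \<in> RF V" "K \<subseteq> V"
  shows "average K r \<in> RF V"
  unfolding average_def[abs_def]
proof (intro RF.mult RF.const RF_sum RF_comp[OF assms(1)])
  fix \<pi> assume "\<pi> \<in> {\<pi>. \<pi> permutes K}"
  then have "\<pi> permutes V" using assms(2) by (auto intro: permutes_subset)
  then show "\<pi> ` V \<subseteq> V" by (simp add: permutes_image)
qed

lemma average_inv: "inv_under K (average K r)"
  unfolding inv_under_def
proof (intro allI impI ballI)
  fix \<pi> p assume \<pi>: "\<pi> permutes K"
  show "average K r (p \<circ> \<pi>) = average K r p"
    unfolding average_def comp_assoc setum_permutations_compose_left[OF \<pi>, of "\<lambda>\<sigma>. r (p \<circ> \<sigma>)"] ..
qed

text \<open>Permutations of disjoint sets commute, so averaging over one factor of W preserves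
  invariance under the other.\<close>

lemma average_inv_disjoint:
  assumes "inv_under L r" "K \<inter> L = {}"
  shows "inv_under L (average K r)"
  unfolding inv_under_def
proof (intro allI impI ballI)
  fix \<kappa> p assume \<kappa>: "\<kappa> permutes L" and p: "p \<in> pts"
  have "r (p \<circ> \<kappa> \<circ> \<pi>) = r (p \<circ> \<pi>)" if \<pi>: "\<pi> permutes K" for \<pi>
  proof -
    have KL: "x \<notin> L" if "x \<in> K" for x using that assms(2) by blast
    have LK: "x \<notin> K" if "x \<in> L" for x using that assms(2) by blast
    have "\<kappa> \<circ> \<pi> = \<pi> \<circ> \<kappa>"
    proof
      fix v
      show "(\<kappa> \<circ> \<pi>) v = (\<pi> \<circ> \<kappa>) v"
        using KL LK \<kappa> \<pi> permutes_in_image[OF \<kappa>, of v] permutes_in_image[OF \<pi>, of v]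
          permutes_not_in[OF \<pi>, of "\<kappa> v"] permutes_not_in[OF \<kappa>, of "\<pi> v"]
        by (cases "v \<in> K"; cases "v \<in> L") (auto simp: permutes_not_in)
    qed
    then have "p \<circ> \<kappa> \<circ> \<pi> = p \<circ> \<pi> \<circ> \<kappa>" by (simp add: comp_assoc)
    then show ?thesis using inv_underD[OF assms(1) \<kappa> pts_comp[OF p]] by simp
  qed
  then show "average K r (p \<circ> \<kappa>) = average K r p" by (simp add: average_def)
qed

text \<open>Averaging is linear over invariant functions; since \<open>h\<close> and all
  \<open>g\<close> are invariant, averaging the identity affects only the coefficients.\<close>

lemma average_combination:
  assumes K: "finite K" and h: "inv_under K h" and g: "\<And>g. g \<in> T \<Longrightarrow> inv_under K g"
    and eq: "\<And>p. p \<in> pts \<Longrightarrow> h p = (\<Sum>g\<in>T. g p * r g p)" and p: "p \<in> pts"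
  shows "h p = (\<Sum>g\<in>T. g p * average K (r g) p)"
proof -
  have "(\<Sum>g\<in>T. g p * average K (r g) p) =
    (\<Sum>g\<in>T. inverse (fact (card K)) * (\<Sum>\<pi> | \<pi> permutes K. g p * r g (p \<circ> \<pi>)))"
    by (simp add: average_def sum_distrib_left mult_ac)
  also have "\<dots> = inverse (fact (card K)) * (\<Sum>\<pi> | \<pi> permutes K. \<Sum>g\<in>T. g p * r g (p \<circ> \<pi>))"
    by (simp only: sum_distrib_left) (rule sum.swap)
  also have "(\<Sum>\<pi> | \<pi> permutes K. \<Sum>g\<in>T. g p * r g (p \<circ> \<pi>)) = (\<Sum>\<pi> | \<pi> permutes K. h p)"
  proof (rule sum.cong[OF refl])
    fix \<pi> assume "\<pi> \<in> {\<pi>. \<pi> permutes K}"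
    then have \<pi>: "\<pi> permutes K" by simp
    have "h p = (\<Sum>g\<in>T. g (p \<circ> \<pi>) * r g (p \<circ> \<pi>))"
      using eq[OF pts_comp[OF p]] inv_underD[OF h \<pi> p] by simp
    also have "\<dots> = (\<Sum>g\<in>T. g p * r g (p \<circ> \<pi>))"
      using inv_underD[OF g \<pi> p] by (intro sum.cong refl) simp
    finally show "(\<Sum>g\<in>T. g p * r g (p \<circ> \<pi>)) = h p" by simp
  qed
  also have "\<dots> = fact (card K) * h p" using card_permutations[OF refl K] by simp
  finally show ?thesis by simp
qed

theorem Nullstellensatz_SA:
  assumes "finite I" "finite J" "I \<inter> J = {}" "G \<subseteq> SA I J" "f \<in> SA I J"
    and "\<And>p. p \<in> pts \<Longrightarrow> (\<And>g. g \<in> G \<Longrightarrow> g p = 0) \<Longrightarrow> f p = 0"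
  shows "\<exists>N T r. finite T \<and> T \<subseteq> G \<and> (\<forall>g\<in>T. r g \<in> SA I J) \<and> (\<forall>p\<in>pts. f p ^ N = (\<Sum>g\<in>T. g p * r g p))"
  using assms
proof (induction "card I" arbitrary: I J G f rule: less_induct)
  case less
  note fin = less.prems(1,2) and disj = less.prems(3) and G = less.prems(4) and f = less.prems(5)
  have V: "finite (I \<union> J)" using fin by simp
  have "G \<subseteq> RF (I \<union> J)" using G SA_RF by blast
  from Nullstellensatz_RF[OF V this SA_RF[OF f] less.prems(6)] obtain N T s where
    T: "finite T" "T \<subseteq> G" "\<And>g. g \<in> T \<Longrightarrow> s g \<in> RF (I \<union> J)"
    and s: "\<And>p. p \<in> pts \<Longrightarrow> f p ^ N = (\<Sum>g\<in>T. g p * s g p)" by blast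
  define r where "r = (\<lambda>g. average J (average I (s g)))"
  have r: "r g \<in> RF (I \<union> J)" "inv_under I (r g)" "inv_under J (r g)" if "g \<in> T" for g
    unfolding r_def using disj that
    by (auto intro!: average_RF T average_inv average_inv_disjoint)
  have TSA: "g \<in> SA I J" if "g \<in> T" for g using that T G by blast
  note fN = SA_power[OF f, of N]
  have fr: "f p ^ N = (\<Sum>g\<in>T. g p * r g p)" if p: "p \<in> pts" for p
  proof -
    have eq: "f p ^ N = (\<Sum>g\<in>T. g p * average I (s g) p)" if "p \<in> pts" for p
      by (rule average_combination[OF fin(1) SA_inv(1)[OF fN] SA_inv(1)[OF TSA] s that])
    show ?thesis unfolding r_def
      by (rule average_combination[OF fin(2) SA_inv(2)[OF fN] SA_inv(2)[OF TSA] eq p])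
  qed
  show ?case
  proof (cases "I = {} \<or> J = {}")
    \<comment> \<open>With one kind of variable missing, supersymmetry is vacuous and the averaged
      coefficients already lie in the algebra.\<close>
    case True
    have "r g \<in> SA I J" if "g \<in> T" for g
      unfolding SA_def mem_Collect_eq
    proof (intro conjI ballI r[OF that])
      fix a b assume "a \<in> I" "b \<in> J"
      then show "r g (p(a := t, b := \<epsilon> * t)) = r g (p(a := 1, b := \<epsilon>))" for p t
        using True by blast
    qed
    then show ?thesis using T(1,2) fr by (intro exI[of _ N] exI[of _ T] exI[of _ r]) simp
  next
    case False
    then obtain a b where ab: "a \<in> I" "b \<in> J" by blast
    let ?I = "I - {a}" and ?J = "J - {b}"
    have fin': "finite ?I" "finite ?J" "?I \<inter> ?J = {}" using fin disj by auto
    have card: "card ?I < card I" using ab fin by (intro psubset_card_mono) auto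
    have G': "restr a b ` G \<subseteq> SA ?I ?J" using restr_SA[OF disj ab] G by blast
    \<comment> \<open>A common zero of the restrictions becomes a common zero of \<open>G\<close>
      once \<open>a\<close> is set to 1 and \<open>b\<close> to \<epsilon>.\<close>
    have "restr a b f p = 0" if p: "p \<in> pts" "\<And>g. g \<in> restr a b ` G \<Longrightarrow> g p = 0" for p
      unfolding restr_def
    proof (rule less.prems(6))
      show "p(a := 1, b := \<epsilon>) \<in> pts" using p(1) pts_update one_E eps_E by blast
      fix g assume "g \<in> G"
      then have "restr a b g p = 0" using p(2) by blast
      then show "g (p(a := 1, b := \<epsilon>)) = 0" by (simp only: restr_def)
    qed
    from less.hyps[OF card fin' G' restr_SA[OF disj ab f] this] obtain M T' c where
      T': "finite T'" "T' \<subseteq> restr a b ` G" "\<And>g. g \<in> T' \<Longrightarrow> c g \<in> SA ?I ?J"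
      "\<And>p. p \<in> pts \<Longrightarrow> restr a b f p ^ M = (\<Sum>g\<in>T'. g p * c g p)" by blast
    obtain U where U: "U \<subseteq> G" "inj_on (restr a b) U" "T' = restr a b ` U"
      using T'(2) by (auto simp: subset_image_inj)
    have finU: "finite U" using T'(1) U by (auto dest: finite_imageD)
    have "\<forall>g\<in>U. \<exists>d. d \<in> SA I J \<and> (\<forall>p\<in>pts. restr a b d p = c (restr a b g) p)"
      using restr_onto[OF fin disj ab] T'(3) U(3) by blast
    then obtain d where d: "\<And>g. g \<in> U \<Longrightarrow> d g \<in> SA I J"
      "\<And>g p. g \<in> U \<Longrightarrow> p \<in> pts \<Longrightarrow> restr a b (d g) p = c (restr a b g) p" by metis
    have USA: "g \<in> SA I J" if "g \<in> U" for g using that U G by blast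
    define h where "h = (\<lambda>p. f p ^ M - (\<Sum>g\<in>U. g p * d g p))"
    have h: "h \<in> SA I J" unfolding h_def by (intro SA_diff SA_power SA_sum SA_mult f USA d)
    have hr0: "restr a b h p = 0" if p: "p \<in> pts" for p
    proof -
      have "restr a b h p = restr a b f p ^ M - (\<Sum>g\<in>U. restr a b g p * restr a b (d g) p)"
        by (simp add: h_def restr_def)
      also have "(\<Sum>g\<in>U. restr a b g p * restr a b (d g) p) = (\<Sum>g\<in>U. restr a b g p * c (restr a b g) p)"
        using d(2) p by (intro sum.cong refl) simp
      also have "\<dots> = (\<Sum>g\<in>T'. g p * c g p)" unfolding U(3) by (subst sum.reindex[OF U(2)]) simp
      finally show ?thesis using T'(4)[OF p] by simp
    qed
    \<comment> \<open>\<open>r g\<close> is invariant under W only, but its product with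
      \<open>h\<close> vanishes along x_a = t, y_b = \<epsilon> t and so is constant there.\<close>
    have hr: "(\<lambda>p. h p * r g p) \<in> SA I J" if g: "g \<in> T" for g
    proof (rule SA_from_pair[OF _ _ _ disj ab, where h = "\<lambda>_. 0"])
      show "(\<lambda>p. h p * r g p) \<in> RF (I \<union> J)" by (intro RF.mult SA_RF h r g)
      show "inv_under I (\<lambda>p. h p * r g p)" "inv_under J (\<lambda>p. h p * r g p)"
        using SA_inv[OF h] r[OF g] by (auto simp: inv_under_def)
      show "h (p(a := t, b := \<epsilon> * t)) * r g (p(a := t, b := \<epsilon> * t)) = 0" if "p \<in> pts" "t \<in> E" for p t
        using SA_restr[OF h ab that] hr0[OF that(1)] by simp
    qed simp
    \<comment> \<open>\<open>f ^ (N + M)\<close> is \<open>f ^ N * h\<close> plus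
      \<open>f ^ N\<close> times the combination over \<open>U\<close>; the former is expanded over
      \<open>T\<close>, and a function may occur in both sets.\<close>
    define k where "k = (\<lambda>g p. (if g \<in> T then h p * r g p else 0) + (if g \<in> U then f p ^ N * d g p else 0))"
    have kSA: "k g \<in> SA I J" for g
    proof -
      have "(\<lambda>p. if g \<in> T then h p * r g p else 0) \<in> SA I J"
        using hr[of g] SA_const[of 0] by (cases "g \<in> T") auto
      moreover have "(\<lambda>p. if g \<in> U then f p ^ N * d g p else 0) \<in> SA I J"
        using SA_mult[OF fN d(1)[of g]] SA_const[of 0] by (cases "g \<in> U") auto
      ultimately show ?thesis unfolding k_def by (rule SA_add)
    qed
    have comb: "f p ^ (N + M) = (\<Sum>g\<in>T \<union> U. g p * k g p)" if p: "p \<in> pts" for p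
    proof -
      have "f p ^ (N + M) = h p * f p ^ N + (\<Sum>g\<in>U. g p * d g p) * f p ^ N"
        by (simp add: h_def power_add algebra_simps)
      also have "h p * f p ^ N = (\<Sum>g\<in>T. g p * (h p * r g p))"
        unfolding fr[OF p] by (simp add: sum_distrib_left mult_ac)
      also have "\<dots> = (\<Sum>g\<in>T \<union> U. g p * (if g \<in> T then h p * r g p else 0))"
        using T(1) finU by (intro sum.mono_neutral_cong_left) auto
      also have "(\<Sum>g\<in>U. g p * d g p) * f p ^ N = (\<Sum>g\<in>U. g p * (f p ^ N * d g p))"
        by (simp add: sum_distrib_left mult_ac)
      also have "\<dots> = (\<Sum>g\<in>T \<union> U. g p * (if g \<in> U then f p ^ N * d g p else 0))"
        using T(1) finU by (intro sum.mono_neutral_cong_left) auto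
      finally show ?thesis by (simp add: k_def distrib_left sum.distrib)
    qed
    have "finite (T \<union> U)" "T \<union> U \<subseteq> G" using T finU U by auto
    then show ?thesis using kSA comb by (intro exI[of _ "N + M"] exI[of _ "T \<union> U"] exI[of _ k]) simp
  qed
qed

end

section \<open>Evaluation of generalized polynomials\<close>

abbreviation keys :: "('a \<Rightarrow>\<^sub>0 'b::zero) \<Rightarrow> 'a set" where "keys \<equiv> Poly_Mapping.keys"
abbreviation lookup :: "('a \<Rightarrow>\<^sub>0 'b::zero) \<Rightarrow> 'a \<Rightarrow> 'b" where "lookup \<equiv> Poly_Mapping.lookup"
abbreviation single :: "'a \<Rightarrow> 'b::zero \<Rightarrow> 'a \<Rightarrow>\<^sub>0 'b" where "single \<equiv> Poly_Mapping.single"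
abbreviation map_key :: "('a \<Rightarrow> 'b) \<Rightarrow> ('b \<Rightarrow>\<^sub>0 'c::zero) \<Rightarrow> 'a \<Rightarrow>\<^sub>0 'c" where "map_key \<equiv> Poly_Mapping.map_key"

definition polys_on :: "(nat + nat) set \<Rightarrow> ('e::zero, 'k::zero) gpoly set" where
  "polys_on V = {f. \<forall>\<mu>\<in>keys f. keys \<mu> \<subseteq> V}"

lemma polys_on_single: "keys \<mu> \<subseteq> V \<Longrightarrow> single \<mu> c \<in> polys_on V"
  by (simp add: polys_on_def)

lemma polys_on_add: "f \<in> polys_on V \<Longrightarrow> g \<in> polys_on V \<Longrightarrow> f + g \<in> polys_on V"
  for f :: "('e::zero, 'k::monoid_add) gpoly"
  using keys_add[of f g] unfolding polys_on_def by blast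

lemma polys_on_mult: "f \<in> polys_on V \<Longrightarrow> g \<in> polys_on V \<Longrightarrow> f * g \<in> polys_on V"
  for f :: "('e::monoid_add, 'k::semiring_0) gpoly"
proof -
  assume fg: "f \<in> polys_on V" "g \<in> polys_on V"
  have "keys \<mu> \<subseteq> V" if \<mu>: "\<mu> \<in> keys (f * g)" for \<mu>
  proof -
    obtain a b where "\<mu> = a + b" "a \<in> keys f" "b \<in> keys g"
      using \<mu> keys_mult[of f g] by blast
    then show ?thesis using fg keys_add[of a b] unfolding polys_on_def by blast
  qed
  then show ?thesis by (simp add: polys_on_def)
qed

lemma polys_on_uminus: "f \<in> polys_on V \<Longrightarrow> - f \<in> polys_on V"
  for f :: "('e::zero, 'k::ab_group_add) gpoly"
  by (simp add: polys_on_def in_keys_iff)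

lemma polys_on_diff: "f \<in> polys_on V \<Longrightarrow> g \<in> polys_on V \<Longrightarrow> f - g \<in> polys_on V"
  for f :: "('e::zero, 'k::ab_group_add) gpoly"
  using polys_on_add[OF _ polys_on_uminus, of f V g] by simp

lemma gpoly_sum_monomials: "f = (\<Sum>\<mu>\<in>keys f. single \<mu> (lookup f \<mu>))"
  for f :: "'a \<Rightarrow>\<^sub>0 'b::comm_monoid_add"
  by (rule poly_mapping_eqI)
    (auto simp: lookup_sum lookup_single when_def sum.delta in_keys_iff split: if_splits)

context point_functions
begin

definition mon :: "((nat + nat) \<Rightarrow>\<^sub>0 'e) \<Rightarrow> 'k valuation \<Rightarrow> 'k" where
  "mon \<mu> p = (\<Prod>v\<in>keys \<mu>. pw (p v) (lookup \<mu> v))"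

text \<open>One evaluation for both cases: the powers of the two instances turn it into
  \<open>eval_poly\<close> and \<open>eval_laurent\<close>.\<close>

definition gev :: "('e, 'k) gpoly \<Rightarrow> 'k valuation \<Rightarrow> 'k" where
  "gev f p = (\<Sum>\<mu>\<in>keys f. lookup f \<mu> * mon \<mu> p)"

lemma mon_superset:
  "finite A \<Longrightarrow> keys \<mu> \<subseteq> A \<Longrightarrow> mon \<mu> p = (\<Prod>v\<in>A. pw (p v) (lookup \<mu> v))"
  unfolding mon_def by (intro prod.mono_neutral_left) (auto simp: in_keys_iff pw_0)

text \<open>The point must lie in \<open>pts\<close>, because at 0 powers with negative exponents
  are not additive in the exponent.\<close>

lemma mon_add:
  assumes p: "p \<in> pts"
  shows "mon (\<mu> + \<nu>) p = mon \<mu> p * mon \<nu> p"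
proof -
  let ?A = "keys \<mu> \<union> keys \<nu>"
  have "mon (\<mu> + \<nu>) p = (\<Prod>v\<in>?A. pw (p v) (lookup (\<mu> + \<nu>) v))"
    using keys_add[of \<mu> \<nu>] by (intro mon_superset) auto
  also have "\<dots> = mon \<mu> p * mon \<nu> p"
    by (simp add: mon_superset[of ?A] lookup_add pw_add[OF pts_E[OF p]] prod.distrib)
  finally show ?thesis .
qed

lemma gev_superset:
  "finite A \<Longrightarrow> keys f \<subseteq> A \<Longrightarrow> gev f p = (\<Sum>\<mu>\<in>A. lookup f \<mu> * mon \<mu> p)"
  unfolding gev_def by (intro sum.mono_neutral_left) (auto simp: in_keys_iff)

lemma gev_add: "gev (f + g) p = gev f p + gev g p"
proof -
  let ?A = "keys f \<union> keys g"
  have "gev (f + g) p = (\<Sum>\<mu>\<in>?A. lookup (f + g) \<mu> * mon \<mu> p)"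
    using keys_add[of f g] by (intro gev_superset) auto
  also have "\<dots> = gev f p + gev g p"
    by (simp add: gev_superset[of ?A] lookup_add distrib_right sum.distrib)
  finally show ?thesis .
qed

lemma gev_0: "gev 0 p = 0"
  by (simp add: gev_def)

lemma gev_sum: "gev (sum f A) p = (\<Sum>i\<in>A. gev (f i) p)"
  by (induction A rule: infinite_finite_induct) (auto simp: gev_0 gev_add)

lemma gev_uminus: "gev (- f) p = - gev f p"
  using gev_add[of "- f" f p] by (simp add: gev_0 eq_neg_iff_add_eq_0)

lemma gev_diff: "gev (f - g) p = gev f p - gev g p"
  using gev_add[of f "- g" p] by (simp add: gev_uminus)

lemma gev_single: "gev (single \<mu> c) p = c * mon \<mu> p"
  by (cases "c = 0") (auto simp: gev_def)

lemma gev_mult: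
  assumes p: "p \<in> pts"
  shows "gev (f * g) p = gev f p * gev g p"
proof -
  let ?s = "\<lambda>f \<mu>. single \<mu> (lookup f \<mu>)"
  have "f * g = (\<Sum>\<mu>\<in>keys f. ?s f \<mu>) * (\<Sum>\<mu>\<in>keys g. ?s g \<mu>)"
    using gpoly_sum_monomials[of f] gpoly_sum_monomials[of g] by simp
  also have "gev \<dots> p = gev f p * gev g p"
    by (simp add: sum_product gev_sum mult_single gev_single mon_add[OF p])
      (simp add: gev_def sum_product mult_ac)
  finally show ?thesis .
qed

lemma gev_1: "gev 1 p = 1"
  using gev_single[of 0 1 p] by (simp add: mon_def single_one)

lemma gev_power: "p \<in> pts \<Longrightarrow> gev (f ^ n) p = gev f p ^ n"
  by (induction n) (auto simp: gev_1 gev_mult)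

lemma gev_RF: "f \<in> polys_on V \<Longrightarrow> gev f \<in> RF V"
  unfolding gev_def[abs_def] mon_def
  by (intro RF_sum RF.mult RF.const RF_prod RF.gen) (auto simp: polys_on_def)

lemma gev_cong: "f \<in> polys_on V \<Longrightarrow> (\<And>v. v \<in> V \<Longrightarrow> p v = q v) \<Longrightarrow> gev f p = gev f q"
  unfolding gev_def mon_def by (intro sum.cong refl arg_cong2[of _ _ _ _ "(*)"] prod.cong) (auto simp: polys_on_def subset_iff)

text \<open>Functions obtained by division, lifting or averaging are turned back into polynomials by
  this converse of \<open>gev_RF\<close>.\<close>

lemma RF_gev:
  assumes "F \<in> RF V"
  shows "\<exists>f\<in>polys_on V. \<forall>p\<in>pts. gev f p = F p"
  using assms
proof (induction rule: RF.induct)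
  case (const c)
  show ?case by (intro bexI[of _ "single 0 c"] polys_on_single) (auto simp: gev_single mon_def)
next
  case (gen v e)
  show ?case
  proof (cases "e = 0")
    case True
    then show ?thesis
      by (intro bexI[of _ "single 0 1"] polys_on_single) (auto simp: gev_1 pw_0)
  next
    case False
    then show ?thesis using gen
      by (intro bexI[of _ "single (single v e) 1"] polys_on_single)
        (auto simp: gev_single mon_def)
  qed
next
  case (add F G)
  then show ?case using polys_on_add by (metis gev_add)
next
  case (mult F G)
  then show ?case using polys_on_mult by (metis gev_mult)
next
  case (ext F G)
  then show ?case by metis
qed

lemma pw_monomials_independent:
  assumes "finite V" "finite M" "inj_on (\<lambda>\<mu>. restrict \<mu> V) M"
    and "\<And>p. p \<in> pts \<Longrightarrow> (\<Sum>\<mu>\<in>M. c \<mu> * (\<Prod>v\<in>V. pw (p v) (\<mu> v))) = 0" and "\<mu> \<in> M"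
  shows "c \<mu> = 0"
  using assms
proof (induction V arbitrary: M \<mu> rule: finite_induct)
  case empty
  have "M \<subseteq> {\<mu>}" using empty.prems(2,4) by (auto simp: inj_on_def)
  then have "M = {\<mu>}" using empty.prems(4) by auto
  then show ?case using empty.prems(3)[of "\<lambda>_. 1"] one_E by (auto simp: pts_def)
next
  case (insert v V)
  define N where "N = {\<nu> \<in> M. \<nu> v = \<mu> v}"
  show ?case
  proof (rule insert.IH[of N])
    show "finite N" "\<mu> \<in> N" using insert.prems by (auto simp: N_def)
    show "inj_on (\<lambda>\<mu>. restrict \<mu> V) N"
    proof (rule inj_onI)
      fix \<alpha> \<beta> assume ab: "\<alpha> \<in> N" "\<beta> \<in> N" "restrict \<alpha> V = restrict \<beta> V"
      have "\<alpha> u = \<beta> u" if "u \<in> V" for u using ab(3) that by (metis restrict_apply')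
      then have "restrict \<alpha> (insert v V) = restrict \<beta> (insert v V)"
        using ab(1,2) by (intro restrict_ext) (auto simp: N_def)
      then show "\<alpha> = \<beta>" using inj_onD[OF insert.prems(2)] ab(1,2) unfolding N_def by blast
    qed
    fix p assume p: "p \<in> pts"
    let ?m = "\<lambda>\<nu>. \<Prod>u\<in>V. pw (p u) (\<nu> u)"
    let ?C = "\<lambda>e. \<Sum>\<nu> | \<nu> \<in> M \<and> \<nu> v = e. c \<nu> * ?m \<nu>"
    have eq: "(\<Sum>e\<in>(\<lambda>\<nu>. \<nu> v) ` M. ?C e * pw t e) = 0" if t: "t \<in> E" for t
    proof -
      have m: "(\<Prod>u\<in>insert v V. pw ((p(v := t)) u) (\<nu> u)) = ?m \<nu> * pw t (\<nu> v)" for \<nu>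
      proof -
        have "(\<Prod>u\<in>V. pw ((p(v := t)) u) (\<nu> u)) = ?m \<nu>"
          using insert.hyps by (intro prod.cong) auto
        then show ?thesis using insert.hyps by simp
      qed
      have "0 = (\<Sum>\<nu>\<in>M. c \<nu> * (?m \<nu> * pw t (\<nu> v)))"
        using insert.prems(3)[OF pts_update[OF p t], of v] by (simp only: m)
      also have "\<dots> = (\<Sum>e\<in>(\<lambda>\<nu>. \<nu> v) ` M. \<Sum>\<nu> | \<nu> \<in> M \<and> \<nu> v = e. c \<nu> * (?m \<nu> * pw t (\<nu> v)))"
        by (rule sum.image_gen[OF insert.prems(1)])
      also have "\<dots> = (\<Sum>e\<in>(\<lambda>\<nu>. \<nu> v) ` M. ?C e * pw t e)"
        by (intro sum.cong refl) (simp add: sum_distrib_right mult.assoc)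
      finally show ?thesis by simp
    qed
    then have "{t \<in> E. (\<Sum>e\<in>(\<lambda>\<nu>. \<nu> v) ` M. ?C e * pw t e) = 0} = E" by auto
    then have "infinite {t \<in> E. (\<Sum>e\<in>(\<lambda>\<nu>. \<nu> v) ` M. ?C e * pw t e) = 0}" using infinite_E by simp
    then have "?C (\<mu> v) = 0"
      using insert.prems(1,4) by (intro pw_indep[of "(\<lambda>\<nu>. \<nu> v) ` M" ?C]) auto
    then show "(\<Sum>\<nu>\<in>N. c \<nu> * ?m \<nu>) = 0" by (simp add: N_def)
  qed
qed

text \<open>Independence of monomials, applied to the difference and the finitely many variables in
  it. Identities of polynomials can from here on be checked pointwise.\<close>

lemma gev_inject:
  assumes "\<And>p. p \<in> pts \<Longrightarrow> gev f p = gev g p"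
  shows "f = g"
proof -
  let ?d = "f - g"
  let ?K = "keys ?d"
  define V where "V = (\<Union>\<mu>\<in>?K. keys \<mu>)"
  have V: "finite V" by (simp add: V_def)
  have inj: "inj_on lookup ?K" by (simp add: inj_on_def poly_mapping.lookup_inject)
  have "lookup ?d \<mu> = 0" if "\<mu> \<in> ?K" for \<mu>
  proof -
    let ?c = "\<lambda>\<nu>. lookup ?d (Abs_poly_mapping \<nu>)"
    have "?c (lookup \<mu>) = 0"
    proof (rule pw_monomials_independent[OF V])
      show "finite (lookup ` ?K)" "lookup \<mu> \<in> lookup ` ?K"
        using that by auto
      show "inj_on (\<lambda>\<mu>. restrict \<mu> V) (lookup ` ?K)"
      proof (rule inj_onI)
        fix a b assume ab: "a \<in> lookup ` ?K" "b \<in> lookup ` ?K"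
          "restrict a V = restrict b V"
        then have "a v = 0" "b v = 0" if "v \<notin> V" for v using that by (auto simp: V_def in_keys_iff)
        moreover have "a v = b v" if "v \<in> V" for v using ab(3) that by (metis restrict_apply')
        ultimately show "a = b" by fastforce
      qed
      fix p assume p: "p \<in> pts"
      have "(\<Sum>\<nu>\<in>lookup ` ?K. ?c \<nu> * (\<Prod>v\<in>V. pw (p v) (\<nu> v))) =
        (\<Sum>\<mu>\<in>?K. lookup ?d \<mu> * (\<Prod>v\<in>V. pw (p v) (lookup \<mu> v)))"
        by (subst sum.reindex[OF inj]) (simp add: poly_mapping.lookup_inverse)
      also have "\<dots> = gev ?d p" unfolding gev_def
        by (intro sum.cong refl arg_cong2[of _ _ _ _ "(*)"] mon_superset[symmetric] V) (auto simp: V_def)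
      also have "\<dots> = 0" using assms[OF p] by (simp add: gev_diff)
      finally show "(\<Sum>\<nu>\<in>lookup ` ?K. ?c \<nu> * (\<Prod>v\<in>V. pw (p v) (\<nu> v))) = 0" .
    qed
    then show ?thesis by (simp add: poly_mapping.lookup_inverse)
  qed
  then have "lookup ?d \<mu> = 0" for \<mu> by (cases "\<mu> \<in> ?K") (simp_all add: in_keys_iff)
  then have "?d = 0" by (intro poly_mapping_eqI) (simp only: lookup_zero)
  then show ?thesis by simp
qed

text \<open>The coefficient of \<open>permute_vars \<pi> f\<close> at \<mu> is that of
  \<open>f\<close> at \<mu> composed with \<pi>. So \<open>Var v\<close> becomes
  \<open>Var (\<pi> v)\<close>, whose value at \<open>p\<close> is
  \<open>(p \<circ> \<pi>) v\<close>.\<close>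

lemma gev_permute_vars:
  assumes "bij \<pi>"
  shows "gev (permute_vars \<pi> f) p = gev f (p \<circ> \<pi>)"
proof -
  let ?m = "map_key \<pi> :: ((nat + nat) \<Rightarrow>\<^sub>0 'e) \<Rightarrow> _"
  have \<pi>: "inj \<pi>" "surj \<pi>" using assms by (auto simp: bij_def)
  have lm: "lookup (?m \<mu>) v = lookup \<mu> (\<pi> v)" for \<mu> v
    using \<pi> by (simp add: Poly_Mapping.map_key.rep_eq)
  have injm: "inj ?m"
  proof (rule injI, rule poly_mapping_eqI)
    fix \<mu> \<nu> v assume "?m \<mu> = ?m \<nu>"
    then have "lookup \<mu> (\<pi> (inv_into UNIV \<pi> v)) = lookup \<nu> (\<pi> (inv_into UNIV \<pi> v))" using lm by metis
    then show "lookup \<mu> v = lookup \<nu> v" using \<pi> by (simp add: surj_f_inv_f)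
  qed
  have surjm: "surj ?m"
  proof (rule surjI)
    show "?m (map_key (inv_into UNIV \<pi>) \<nu>) = \<nu>" for \<nu>
      using \<pi> by (subst map_key_compose) (auto simp: surj_imp_inj_inv map_key_id[unfolded id_def[symmetric]] inj_imp_surj_inv o_def map_key_id)
  qed
  have lf: "lookup (permute_vars \<pi> f) \<mu> = lookup f (?m \<mu>)" for \<mu>
    unfolding permute_vars_def using injm by (simp add: Poly_Mapping.map_key.rep_eq)
  have keys: "keys f = ?m ` keys (permute_vars \<pi> f)"
  proof (intro Set.set_eqI iffI)
    fix \<nu> assume \<nu>: "\<nu> \<in> keys f"
    obtain \<mu> where "\<nu> = ?m \<mu>" using surjm unfolding surj_def by blast
    then show "\<nu> \<in> ?m ` keys (permute_vars \<pi> f)" using \<nu> by (auto simp: in_keys_iff lf)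
  qed (auto simp: in_keys_iff lf)
  have mon: "mon \<mu> p = mon (?m \<mu>) (p \<circ> \<pi>)" for \<mu>
  proof -
    have "keys \<mu> = \<pi> ` keys (?m \<mu>)"
    proof (intro Set.set_eqI iffI)
      fix v assume v: "v \<in> keys \<mu>"
      obtain u where "v = \<pi> u" using \<pi> unfolding surj_def by blast
      then show "v \<in> \<pi> ` keys (?m \<mu>)" using v by (auto simp: in_keys_iff lm)
    qed (auto simp: in_keys_iff lm)
    then show ?thesis unfolding mon_def
      using \<pi> by (simp add: prod.reindex inj_on_subset lm)
  qed
  have "gev f (p \<circ> \<pi>) = (\<Sum>\<mu>\<in>keys (permute_vars \<pi> f).
      lookup f (?m \<mu>) * mon (?m \<mu>) (p \<circ> \<pi>))"
    unfolding gev_def keys using injm by (subst sum.reindex) (auto intro: inj_on_subset)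
  then show ?thesis by (simp add: gev_def lf mon)
qed

end

section \<open>Transport to polynomial algebras\<close>

lemma subring_of_type_simps [simp]:
  "carrier (subring_of_type S) = S"
  "monoid.mult (subring_of_type S) = (*)"
  "monoid.one (subring_of_type S) = 1"
  "ring.zero (subring_of_type S) = 0"
  "ring.add (subring_of_type S) = (+)"
  by (simp_all add: subring_of_type_def ring_of_type_algebra_def)

lemma subring_of_type_pow: "f [^]\<^bsub>subring_of_type S\<^esub> (N :: nat) = f ^ N"
  by (induction N) (simp_all add: nat_pow_def mult.commute power_commutes)

lemma ring_subring_of_type:
  assumes S: "is_subring S"
  shows "ring (subring_of_type S)"
proof (rule ringI)
  show "abelian_group (subring_of_type S)"
  proof (rule abelian_groupI)
    fix x assume "x \<in> carrier (subring_of_type S)"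
    then show "\<exists>y\<in>carrier (subring_of_type S). y \<oplus>\<^bsub>subring_of_type S\<^esub> x = \<zero>\<^bsub>subring_of_type S\<^esub>"
      using subring_uminus[OF S] by (intro bexI[of _ "- x"]) auto
  qed (use subring_add[OF S] subring_zero[OF S] in \<open>auto simp: add_ac\<close>)
  show "Group.monoid (subring_of_type S)"
    using subring_mult[OF S] subring_one[OF S] by (intro Group.monoidI) (auto simp: mult.assoc)
qed (auto simp: algebra_simps)

lemma ideal_subring_of_type_iff:
  assumes S: "is_subring S"
  shows "ideal K (subring_of_type S) \<longleftrightarrow> ideal_in S K"
proof
  let ?R = "subring_of_type S"
  assume "ideal K ?R"
  then interpret ideal K ?R .
  show "ideal_in S K"
    using a_subset additive_subgroup.zero_closed[OF is_additive_subgroup]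
      additive_subgroup.a_closed[OF is_additive_subgroup] I_l_closed by (auto simp: ideal_in_def)
next
  let ?R = "subring_of_type S"
  assume K: "ideal_in S K"
  interpret ring ?R by (rule ring_subring_of_type[OF S])
  show "ideal K ?R"
  proof (rule idealI[OF ring_axioms])
    show "subgroup K (add_monoid ?R)"
    proof (rule subgroup.intro)
      fix x assume x: "x \<in> K"
      then have xS: "x \<in> S" by (rule ideal_in_subset[OF K])
      have "\<ominus>\<^bsub>?R\<^esub> x = - x"
        using xS subring_uminus[OF S xS] by (intro minus_equality) auto
      moreover have "- x \<in> K"
        using ideal_in_mult[OF K subring_uminus[OF S subring_one[OF S]] x] by simp
      ultimately show "inv\<^bsub>add_monoid ?R\<^esub> x \<in> K" by (simp add: a_inv_def)
    qed (use K in \<open>auto simp: ideal_in_def\<close>)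
  qed (use ideal_in_mult[OF K] ideal_in_mult'[OF K] in auto)
qed

text \<open>An ideal is contained in its radical, with exponent 1, so only the opposite inclusion is
  a condition.\<close>

lemma radical_ideals_subring_of_type:
  assumes "is_subring S"
  shows "K \<in> radical_ideals (subring_of_type S) \<longleftrightarrow>
    ideal_in S K \<and> (\<forall>f\<in>S. \<forall>N>0. f ^ N \<in> K \<longrightarrow> f \<in> K)"
proof -
  have "K = radical (subring_of_type S) K \<longleftrightarrow> (\<forall>f\<in>S. \<forall>N>0. f ^ N \<in> K \<longrightarrow> f \<in> K)"
    if K: "ideal_in S K"
  proof -
    have "K \<subseteq> radical (subring_of_type S) K"
      using ideal_in_subset[OF K] unfolding radical_def subring_of_type_pow
      by (auto intro: exI[of _ "1 :: nat"])
    then have "K = radical (subring_of_type S) K \<longleftrightarrow> radical (subring_of_type S) K \<subseteq> K" by blast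
    also have "\<dots> \<longleftrightarrow> (\<forall>f\<in>S. \<forall>N>0. f ^ N \<in> K \<longrightarrow> f \<in> K)"
      unfolding radical_def subring_of_type_pow by auto
    finally show ?thesis .
  qed
  then show ?thesis
    unfolding radical_ideals_def by (auto simp: ideal_subring_of_type_iff[OF assms])
qed

lemma variables_eq: "variables m n = Inl ` {1..m} \<union> Inr ` {1..n}"
  by (simp add: variables_def Plus_def)

lemma polys_in_eq: "polys_in m n = polys_on (variables m n)"
  by (simp add: polys_in_def polys_on_def)

lemma bij_imp_permutes_univ:
  assumes "bij \<pi>" "\<And>x. x \<notin> A \<Longrightarrow> \<pi> x = x"
  shows "\<pi> permutes A"
  using assms unfolding permutes_def bij_def by (metis injD surjD)

lemma map_sum_permutes:
  assumes "(\<sigma> :: 'a \<Rightarrow> 'a) permutes A"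
  shows "(map_sum \<sigma> id :: 'a + 'b \<Rightarrow> _) permutes Inl ` A" "(map_sum id \<sigma> :: 'c + 'a \<Rightarrow> _) permutes Inr ` A"
proof -
  have bij: "bij (map_sum \<sigma> id :: 'a + 'b \<Rightarrow> _)" "bij (map_sum id \<sigma> :: 'c + 'a \<Rightarrow> _)"
    by (rule o_bij[of "map_sum (inv_into UNIV \<sigma>) id"] o_bij[of "map_sum id (inv_into UNIV \<sigma>)"];
        simp add: map_sum.comp permutes_inv_o[OF assms] map_sum.id)+
  show "(map_sum \<sigma> id :: 'a + 'b \<Rightarrow> _) permutes Inl ` A"
  proof (rule bij_imp_permutes_univ[OF bij(1)])
    show "map_sum \<sigma> id v = v" if "v \<notin> Inl ` A" for v :: "'a + 'b"
      using that permutes_not_in[OF assms] by (cases v) auto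
  qed
  show "(map_sum id \<sigma> :: 'c + 'a \<Rightarrow> _) permutes Inr ` A"
  proof (rule bij_imp_permutes_univ[OF bij(2)])
    show "map_sum id \<sigma> v = v" if "v \<notin> Inr ` A" for v :: "'c + 'a"
      using that permutes_not_in[OF assms] by (cases v) auto
  qed
qed

lemma permutes_image_inj:
  assumes \<iota>: "inj \<iota>" and \<pi>: "\<pi> permutes \<iota> ` A"
  obtains \<sigma> where "\<sigma> permutes A" "\<And>i. \<pi> (\<iota> i) = \<iota> (\<sigma> i)"
proof -
  have ex: "\<exists>k. \<pi> (\<iota> i) = \<iota> k" for i
    using permutes_in_image[OF \<pi>, of "\<iota> i"] permutes_not_in[OF \<pi>, of "\<iota> i"] by (cases "\<iota> i \<in> \<iota> ` A") auto
  then obtain \<sigma> where \<sigma>: "\<And>i. \<pi> (\<iota> i) = \<iota> (\<sigma> i)" by metis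
  have "inj \<sigma>"
    using \<iota> permutes_inj[OF \<pi>] \<sigma> by (metis injD injI)
  moreover have "\<exists>i. y = \<sigma> i" for y
  proof -
    obtain v where v: "\<pi> v = \<iota> y" using surjD[OF permutes_surj[OF \<pi>], of "\<iota> y"] by metis
    then have "v \<in> range \<iota>" using permutes_not_in[OF \<pi>, of v] by (cases "v \<in> \<iota> ` A") auto
    then show ?thesis using v \<sigma> injD[OF \<iota>] by (metis rangeE)
  qed
  moreover have "\<sigma> i = i" if "i \<notin> A" for i
    using \<sigma>[of i] permutes_not_in[OF \<pi>, of "\<iota> i"] that injD[OF \<iota>] by (metis inj_image_mem_iff[OF \<iota>])
  ultimately have "\<sigma> permutes A" by (intro bij_imp_permutes_univ) (auto simp: bij_def surj_def)
  then show ?thesis using \<sigma> that by blast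
qed

context point_functions
begin

definition SA_polys :: "nat \<Rightarrow> nat \<Rightarrow> ('e, 'k) gpoly set" where
  "SA_polys m n = {f \<in> polys_in m n. gev f \<in> SA (Inl ` {1..m}) (Inr ` {1..n})}"

text \<open>W is generated by its two factors: \<open>map_sum \<sigma> \<tau>\<close> is a composite
  of permutations that move only the x or only the y. Since values on \<open>pts\<close> determine
  polynomials, invariance of \<open>f\<close> is invariance of its function.\<close>

lemma W_invariants_iff:
  "f \<in> W_invariants m n \<longleftrightarrow>
    f \<in> polys_in m n \<and> inv_under (Inl ` {1..m}) (gev f) \<and> inv_under (Inr ` {1..n}) (gev f)"
proof (cases "f \<in> polys_in m n")
  case True
  have perm: "permute_vars \<pi> f = f \<longleftrightarrow> (\<forall>p\<in>pts. gev f (p \<circ> \<pi>) = gev f p)" if "bij \<pi>" for \<pi>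
    using gev_permute_vars[OF that, of f] gev_inject[of "permute_vars \<pi> f" f] by auto
  have id: "id permutes A" for A :: "nat set" by (rule permutes_id)
  show ?thesis
  proof
    assume f: "f \<in> W_invariants m n"
    have W: "gev f (p \<circ> map_sum \<sigma> \<tau>) = gev f p"
      if "\<sigma> permutes {1..m}" "\<tau> permutes {1..n}" "bij (map_sum \<sigma> \<tau>)" "p \<in> pts" for \<sigma> \<tau> p
      using f that perm[OF that(3)] by (auto simp: W_invariants_def)
    have "inv_under (Inl ` {1..m}) (gev f)"
      unfolding inv_under_def
    proof (intro allI impI ballI)
      fix \<pi> :: "nat + nat \<Rightarrow> nat + nat" and p assume \<pi>: "\<pi> permutes Inl ` {1..m}" and p: "p \<in> pts"
      obtain \<sigma> where \<sigma>: "\<sigma> permutes {1..m}" "\<And>i. \<pi> (Inl i) = Inl (\<sigma> i)"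
        by (rule permutes_image_inj[OF inj_Inl \<pi>]) blast
      have "\<pi> v = map_sum \<sigma> id v" for v using \<sigma>(2) permutes_not_in[OF \<pi>, of v] by (cases v) auto
      then have "\<pi> = map_sum \<sigma> id" by blast
      with \<sigma>(1) show "gev f (p \<circ> \<pi>) = gev f p" using W[OF _ id _ p] permutes_bij[OF \<pi>] by blast
    qed
    moreover have "inv_under (Inr ` {1..n}) (gev f)"
      unfolding inv_under_def
    proof (intro allI impI ballI)
      fix \<pi> :: "nat + nat \<Rightarrow> nat + nat" and p assume \<pi>: "\<pi> permutes Inr ` {1..n}" and p: "p \<in> pts"
      obtain \<sigma> where \<sigma>: "\<sigma> permutes {1..n}" "\<And>i. \<pi> (Inr i) = Inr (\<sigma> i)"
        by (rule permutes_image_inj[OF inj_Inr \<pi>]) blast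
      have "\<pi> v = map_sum id \<sigma> v" for v using \<sigma>(2) permutes_not_in[OF \<pi>, of v] by (cases v) auto
      then have "\<pi> = map_sum id \<sigma>" by blast
      with \<sigma>(1) show "gev f (p \<circ> \<pi>) = gev f p" using W[OF id _ _ p] permutes_bij[OF \<pi>] by blast
    qed
    ultimately show "f \<in> polys_in m n \<and> inv_under (Inl ` {1..m}) (gev f) \<and> inv_under (Inr ` {1..n}) (gev f)"
      using True by blast
  next
    assume f: "f \<in> polys_in m n \<and> inv_under (Inl ` {1..m}) (gev f) \<and> inv_under (Inr ` {1..n}) (gev f)"
    have "permute_vars (map_sum \<sigma> \<tau>) f = f" if st: "\<sigma> permutes {1..m}" "\<tau> permutes {1..n}" for \<sigma> \<tau>
    proof -
      have eq: "map_sum \<sigma> \<tau> = map_sum \<sigma> id \<circ> map_sum id \<tau>"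
        by (auto simp: fun_eq_iff map_sum.compositionality[symmetric] sum.map_comp)
      note m = map_sum_permutes(1)[OF st(1)] map_sum_permutes(2)[OF st(2)]
      have "bij (map_sum \<sigma> \<tau>)" unfolding eq by (intro bij_comp permutes_bij[OF m(1)] permutes_bij[OF m(2)])
      moreover have "gev f (p \<circ> map_sum \<sigma> \<tau>) = gev f p" if p: "p \<in> pts" for p
        using inv_underD[OF _ m(2) pts_comp[OF p], of "gev f" "map_sum \<sigma> id"] inv_underD[OF _ m(1) p, of "gev f"] f
        unfolding eq by (simp add: comp_assoc)
      ultimately show ?thesis using perm by blast
    qed
    then show "f \<in> W_invariants m n" using True by (auto simp: W_invariants_def)
  qed
qed (auto simp: W_invariants_def)

lemma SA_polys_iff:
  "f \<in> SA_polys m n \<longleftrightarrow> f \<in> W_invariants m n \<and>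
    (\<forall>i\<in>{1..m}. \<forall>j\<in>{1..n}. \<forall>p\<in>pts. \<forall>t\<in>E.
      gev f (p(Inl i := t, Inr j := \<epsilon> * t)) = gev f (p(Inl i := 1, Inr j := \<epsilon>)))"
  unfolding SA_polys_def SA_def W_invariants_iff
  using gev_RF[of f "variables m n"] by (auto simp: variables_eq polys_in_eq simp del: fun_upd_apply)

lemma is_subring_SA_polys: "is_subring (SA_polys m n)"
  unfolding is_subring_def
proof (intro conjI ballI)
  let ?I = "Inl ` {1..m} :: (nat + nat) set" and ?J = "Inr ` {1..n} :: (nat + nat) set"
  have "gev 1 \<in> SA ?I ?J" by (rule SA_ext[OF SA_const[of 1]]) (simp add: gev_1)
  moreover have "(1 :: ('e, 'k) gpoly) \<in> polys_on (variables m n)"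
    unfolding single_one[symmetric] by (rule polys_on_single) simp
  ultimately show "1 \<in> SA_polys m n" by (simp add: SA_polys_def polys_in_eq)
  fix f g :: "('e, 'k) gpoly" assume fg: "f \<in> SA_polys m n" "g \<in> SA_polys m n"
  then have fg': "gev f \<in> SA ?I ?J" "gev g \<in> SA ?I ?J" by (auto simp: SA_polys_def)
  have "gev (f - g) \<in> SA ?I ?J" by (rule SA_ext[OF SA_diff[OF fg']]) (simp add: gev_diff)
  then show "f - g \<in> SA_polys m n" using fg by (auto simp: SA_polys_def polys_in_eq polys_on_diff)
  have "gev (f * g) \<in> SA ?I ?J" by (rule SA_ext[OF SA_mult[OF fg']]) (simp add: gev_mult)
  then show "f * g \<in> SA_polys m n" using fg by (auto simp: SA_polys_def polys_in_eq polys_on_mult)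
qed

text \<open>The coefficients from \<open>Nullstellensatz_SA\<close> are functions. Each is realized
  by a polynomial, which lies in the algebra because membership depends on values, and
  \<open>gev_inject\<close> transfers the identity.\<close>

lemma SA_polys_Nullstellensatz:
  assumes K: "ideal_in (SA_polys m n) K" and f: "f \<in> SA_polys m n"
    and van: "\<And>p. p \<in> pts \<Longrightarrow> (\<And>g. g \<in> K \<Longrightarrow> gev g p = 0) \<Longrightarrow> gev f p = 0"
  shows "\<exists>N>0. f ^ N \<in> K"
proof -
  let ?I = "Inl ` {1..m} :: (nat + nat) set" and ?J = "Inr ` {1..n} :: (nat + nat) set"
  have "gev ` K \<subseteq> SA ?I ?J" using ideal_in_subset[OF K] by (auto simp: SA_polys_def)
  moreover have "gev f \<in> SA ?I ?J" using f by (simp add: SA_polys_def)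
  ultimately have "\<exists>N T r. finite T \<and> T \<subseteq> gev ` K \<and> (\<forall>g\<in>T. r g \<in> SA ?I ?J) \<and>
      (\<forall>p\<in>pts. gev f p ^ N = (\<Sum>g\<in>T. g p * r g p))"
    using van by (intro Nullstellensatz_SA) blast+
  then obtain N T r where T: "finite T" "T \<subseteq> gev ` K" "\<And>g. g \<in> T \<Longrightarrow> r g \<in> SA ?I ?J"
    "\<And>p. p \<in> pts \<Longrightarrow> gev f p ^ N = (\<Sum>g\<in>T. g p * r g p)"
    by blast
  obtain U where U: "U \<subseteq> K" "inj_on gev U" "T = gev ` U" using T(2) by (auto simp: subset_image_inj)
  have "\<exists>a\<in>SA_polys m n. \<forall>p\<in>pts. gev a p = r (gev g) p" if g: "g \<in> U" for g
  proof -
    have r: "r (gev g) \<in> SA ?I ?J" using T(3) U(3) g by blast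
    obtain a where a: "a \<in> polys_on (?I \<union> ?J)" "\<And>p. p \<in> pts \<Longrightarrow> gev a p = r (gev g) p"
      using RF_gev[OF SA_RF[OF r]] by blast
    have "gev a \<in> SA ?I ?J" by (rule SA_ext[OF r a(2)])
    then show ?thesis using a by (intro bexI[of _ a]) (auto simp: SA_polys_def polys_in_eq variables_eq)
  qed
  then obtain a where a: "\<And>g. g \<in> U \<Longrightarrow> a g \<in> SA_polys m n"
    "\<And>g p. g \<in> U \<Longrightarrow> p \<in> pts \<Longrightarrow> gev (a g) p = r (gev g) p" by metis
  have "f ^ N = (\<Sum>g\<in>U. g * a g)"
  proof (rule gev_inject)
    fix p assume p: "p \<in> pts"
    have "gev (f ^ N) p = (\<Sum>g\<in>T. g p * r g p)" using T(4)[OF p] by (simp add: gev_power[OF p])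
    also have "\<dots> = (\<Sum>g\<in>U. gev g p * r (gev g) p)" unfolding U(3) by (subst sum.reindex[OF U(2)]) simp
    also have "\<dots> = (\<Sum>g\<in>U. gev g p * gev (a g) p)" using a(2) p by (intro sum.cong refl) simp
    finally show "gev (f ^ N) p = gev (\<Sum>g\<in>U. g * a g) p" by (simp add: gev_sum gev_mult[OF p])
  qed
  moreover have "(\<Sum>g\<in>A. g * a g) \<in> K" if "A \<subseteq> U" for A
    using that
  proof (induction A rule: infinite_finite_induct)
    case (insert x A)
    then show ?case
      using ideal_in_add[OF K] ideal_in_mult'[OF K _ a(1)] U(1) by auto
  qed (auto intro: ideal_in_zero[OF K])
  ultimately have "f ^ N \<in> K" by auto
  \<comment> \<open>The exponent found may be 0, while the radical asks for a positive one.\<close>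
  then have "f ^ Suc N \<in> K" using ideal_in_mult[OF K f] by simp
  then show ?thesis by blast
qed

text \<open>Only \<open>VZ\<close> uses the Nullstellensatz; the other parts are the Galois
  connection between vanishing ideals and zero loci.\<close>

theorem SA_polys_correspondence:
  fixes m n :: nat
  defines "A \<equiv> subring_of_type (SA_polys m n)"
    and "Y \<equiv> ({1..m} \<rightarrow>\<^sub>E E) \<times> ({1..n} \<rightarrow>\<^sub>E E)"
    and "ev \<equiv> \<lambda>f (p :: 'k point). gev f (case_sum (fst p) (snd p))"
  shows "bij_betw (vanishing_ideal A ev) (superalgebraic_sets A Y ev) (radical_ideals A) \<and>
      bij_betw (zero_locus Y ev) (radical_ideals A) (superalgebraic_sets A Y ev) \<and>
      (\<forall>V\<in>superalgebraic_sets A Y ev. zero_locus Y ev (vanishing_ideal A ev V) = V) \<and>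
      (\<forall>I\<in>radical_ideals A. vanishing_ideal A ev (zero_locus Y ev I) = I) \<and>
      antimono_on (superalgebraic_sets A Y ev) (vanishing_ideal A ev) \<and>
      antimono_on (radical_ideals A) (zero_locus Y ev)"
proof -
  let ?S = "SA_polys m n"
  note S = is_subring_SA_polys[of m n]
  have carrier: "carrier A = ?S" by (simp add: A_def)
  \<comment> \<open>Points of \<open>Y\<close> are \<open>undefined\<close> off the index range.
    They are extended by 1, which lies in \<open>E\<close>; polynomials in the given variables do
    not notice.\<close>
  have to_pts: "\<exists>p\<in>pts. \<forall>f\<in>?S. ev f y = gev f p" if y: "y \<in> Y" for y
  proof -
    let ?q = "case_sum (fst y) (snd y)"
    let ?p = "\<lambda>v. if v \<in> variables m n then ?q v else 1"
    have "?p \<in> pts"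
      using y one_E unfolding pts_def Y_def variables_eq by (auto split: sum.splits)
    moreover have "ev f y = gev f ?p" if "f \<in> ?S" for f
      unfolding ev_def using that by (intro gev_cong[of f "variables m n"]) (auto simp: SA_polys_def polys_in_eq)
    ultimately show ?thesis by blast
  qed
  have from_pts: "\<exists>y\<in>Y. \<forall>f\<in>?S. ev f y = gev f p" if p: "p \<in> pts" for p
  proof -
    let ?y = "(restrict (\<lambda>i. p (Inl i)) {1..m}, restrict (\<lambda>j. p (Inr j)) {1..n})"
    have "?y \<in> Y" using p by (auto simp: Y_def pts_def)
    moreover have "ev f ?y = gev f p" if "f \<in> ?S" for f
      unfolding ev_def using that
      by (intro gev_cong[of f "variables m n"]) (auto simp: SA_polys_def polys_in_eq variables_eq)
    ultimately show ?thesis by blast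
  qed
  have ZV: "zero_locus Y ev (vanishing_ideal A ev V) = V" if V: "V \<in> superalgebraic_sets A Y ev" for V
  proof -
    obtain J where "J \<subseteq> ?S" "V = zero_locus Y ev J"
      using V by (auto simp: superalgebraic_sets_def carrier)
    then show ?thesis unfolding zero_locus_def vanishing_ideal_def carrier by blast
  qed
  have VZ: "vanishing_ideal A ev (zero_locus Y ev K) = K" if K: "K \<in> radical_ideals A" for K
  proof
    have KI: "ideal_in ?S K" and rad: "\<And>f N. f \<in> ?S \<Longrightarrow> N > 0 \<Longrightarrow> f ^ N \<in> K \<Longrightarrow> f \<in> K"
      using K unfolding A_def radical_ideals_subring_of_type[OF S] by auto
    show "K \<subseteq> vanishing_ideal A ev (zero_locus Y ev K)"
      using ideal_in_subset[OF KI] by (auto simp: vanishing_ideal_def zero_locus_def carrier)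
    show "vanishing_ideal A ev (zero_locus Y ev K) \<subseteq> K"
    proof
      fix f assume "f \<in> vanishing_ideal A ev (zero_locus Y ev K)"
      then have f: "f \<in> ?S" "\<And>y. y \<in> Y \<Longrightarrow> (\<And>g. g \<in> K \<Longrightarrow> ev g y = 0) \<Longrightarrow> ev f y = 0"
        by (auto simp: vanishing_ideal_def zero_locus_def carrier)
      have "gev f p = 0" if p: "p \<in> pts" "\<And>g. g \<in> K \<Longrightarrow> gev g p = 0" for p
      proof -
        obtain y where "y \<in> Y" "\<forall>f\<in>?S. ev f y = gev f p" using from_pts[OF p(1)] by blast
        then show ?thesis using f p(2) ideal_in_subset[OF KI] by metis
      qed
      then show "f \<in> K" using SA_polys_Nullstellensatz[OF KI f(1)] rad[OF f(1)] by blast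
    qed
  qed
  have Vrad: "vanishing_ideal A ev V \<in> radical_ideals A" if V: "V \<in> superalgebraic_sets A Y ev" for V
  proof -
    have VY: "V \<subseteq> Y" using V by (auto simp: superalgebraic_sets_def zero_locus_def)
    have ev: "ev (f + g) y = ev f y + ev g y" "ev (f * g) y = ev f y * ev g y" "ev (f ^ N) y = ev f y ^ N" "ev 0 y = 0"
      if y: "y \<in> Y" and fg: "f \<in> ?S" "g \<in> ?S" for f g y N
    proof -
      obtain p where p: "p \<in> pts" "\<forall>f\<in>?S. ev f y = gev f p" using to_pts[OF y] by blast
      show "ev (f + g) y = ev f y + ev g y" "ev (f * g) y = ev f y * ev g y" "ev (f ^ N) y = ev f y ^ N" "ev 0 y = 0"
        using fg p subring_add[OF S] subring_mult[OF S] subring_power[OF S] subring_zero[OF S]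
        by (simp_all add: gev_add gev_mult gev_power gev_0)
    qed
    have "ideal_in ?S (vanishing_ideal A ev V)"
      unfolding ideal_in_def vanishing_ideal_def carrier
      using VY ev subring_zero[OF S] subring_add[OF S] subring_mult[OF S]
      by (auto simp: subset_iff)
    moreover have "f \<in> vanishing_ideal A ev V" if "f \<in> ?S" "N > 0" "f ^ N \<in> vanishing_ideal A ev V" for f N
      using that ev(3)[of _ f f N] VY by (auto simp: vanishing_ideal_def carrier subset_iff)
    ultimately show ?thesis unfolding A_def radical_ideals_subring_of_type[OF S] by blast
  qed
  have Zsup: "zero_locus Y ev K \<in> superalgebraic_sets A Y ev" if K: "K \<in> radical_ideals A" for K
  proof -
    have "K \<subseteq> ?S" using K ideal_in_subset unfolding A_def radical_ideals_subring_of_type[OF S] by blast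
    then show ?thesis by (auto simp: superalgebraic_sets_def carrier)
  qed
  have "bij_betw (vanishing_ideal A ev) (superalgebraic_sets A Y ev) (radical_ideals A)"
    by (rule bij_betw_byWitness[where f' = "zero_locus Y ev"]) (use ZV VZ Vrad Zsup in auto)
  moreover have "bij_betw (zero_locus Y ev) (radical_ideals A) (superalgebraic_sets A Y ev)"
    by (rule bij_betw_byWitness[where f' = "vanishing_ideal A ev"]) (use ZV VZ Vrad Zsup in auto)
  moreover have "antimono_on (superalgebraic_sets A Y ev) (vanishing_ideal A ev)"
    "antimono_on (radical_ideals A) (zero_locus Y ev)"
    unfolding monotone_on_def vanishing_ideal_def zero_locus_def by blast+
  ultimately show ?thesis using ZV VZ by blast
qed

end

section \<open>Supersymmetric and Laurent supersymmetric polynomials\<close>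

context point_functions
begin

text \<open>Supersymmetric polynomials are defined through x_1 and y_1 alone; invariance under W
  extends the condition to all pairs.\<close>

lemma SA_polys_iff_first_pair:
  "f \<in> SA_polys m n \<longleftrightarrow> f \<in> W_invariants m n \<and> (1 \<le> m \<longrightarrow> 1 \<le> n \<longrightarrow> (\<forall>p\<in>pts. \<forall>t\<in>E.
      gev f (p(Inl 1 := t, Inr 1 := \<epsilon> * t)) = gev f (p(Inl 1 := 1, Inr 1 := \<epsilon>))))"
    (is "_ \<longleftrightarrow> ?W \<and> (_ \<longrightarrow> _ \<longrightarrow> ?P)")
proof (cases "1 \<le> m \<and> 1 \<le> n")
  case True
  let ?I = "Inl ` {1..m} :: (nat + nat) set" and ?J = "Inr ` {1..n} :: (nat + nat) set"
  have ab: "Inl 1 \<in> ?I" "Inr 1 \<in> ?J" using True by auto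
  have "f \<in> SA_polys m n" if W: ?W and P: ?P
  proof -
    have f: "f \<in> polys_in m n" "inv_under ?I (gev f)" "inv_under ?J (gev f)"
      using W by (auto simp: W_invariants_iff)
    have "gev f \<in> SA ?I ?J"
    proof (rule SA_from_pair[OF _ f(2,3) _ ab, where h = "\<lambda>p. gev f (p(Inl 1 := 1, Inr 1 := \<epsilon>))"])
      show "gev f \<in> RF (?I \<union> ?J)" using f(1) by (intro gev_RF) (simp add: polys_in_eq variables_eq)
      show "gev f (p(Inl 1 := t, Inr 1 := \<epsilon> * t)) = gev f (p(Inl 1 := 1, Inr 1 := \<epsilon>))"
        if "p \<in> pts" "t \<in> E" for p t using P that by blast
      have "p(Inl 1 := t, Inr 1 := s, Inl 1 := 1, Inr 1 := \<epsilon>) = p(Inl 1 := 1, Inr 1 := \<epsilon>)" for p :: "'k valuation" and s t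
        by auto
      then show "gev f (p(Inl 1 := t, Inr 1 := s, Inl 1 := 1, Inr 1 := \<epsilon>)) = gev f (p(Inl 1 := 1, Inr 1 := \<epsilon>))" for p s t
        by metis
    qed auto
    then show ?thesis using f(1) by (simp add: SA_polys_def)
  qed
  moreover have "?W" "?P" if "f \<in> SA_polys m n" using that True unfolding SA_polys_iff by auto
  ultimately show ?thesis using True by blast
next
  case False
  then have "\<not> (i \<in> {1..m} \<and> j \<in> {1..n})" for i j by auto
  then show ?thesis using False unfolding SA_polys_iff by blast
qed

end

section \<open>The two instances: affine space and the torus\<close>

lemma point_functions_poly:
  "point_functions (UNIV :: 'k::{alg_closed_field, field_char_0} set) ((^) :: 'k \<Rightarrow> nat \<Rightarrow> 'k) (- 1)"
proof
  fix S :: "nat set" and c :: "nat \<Rightarrow> 'k" and e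
  assume S: "finite S" and inf: "infinite {t \<in> UNIV. (\<Sum>e\<in>S. c e * t ^ e) = 0}" and e: "e \<in> S"
  define q where "q = (\<Sum>e\<in>S. monom (c e) e)"
  have "poly q t = (\<Sum>e\<in>S. c e * t ^ e)" for t by (simp add: q_def poly_sum poly_monom)
  then have "q = 0" using inf poly_roots_finite[of q] by auto
  moreover have "coeff q e = c e" using S e by (simp add: q_def coeff_sum coeff_monom)
  ultimately show "c e = 0" by simp
next
  fix e :: nat
  have "t ^ e - s ^ e = (t - s) * (\<Sum>i<e. 1 * t ^ i * s ^ (e - Suc i))" for s t :: 'k
    by (simp add: power_diff_sumr2 mult.commute)
  then show "\<exists>A c a b. finite (A :: nat set) \<and>
      (\<forall>s\<in>UNIV. \<forall>t\<in>UNIV. t ^ e - s ^ e = (t - s) * (\<Sum>i\<in>A. c i * t ^ a i * s ^ b i :: 'k))"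
    by (intro exI[of _ "{..<e}"] exI[of _ "\<lambda>_. 1"] exI[of _ "\<lambda>i. i"] exI[of _ "\<lambda>i. e - Suc i"]) blast
qed (auto simp: power_add power_mult_distrib)

lemma point_functions_laurent:
  "point_functions (- {0} :: 'k::{alg_closed_field, field_char_0} set) ((powi) :: 'k \<Rightarrow> int \<Rightarrow> 'k) 1"
proof
  fix S :: "int set" and c :: "int \<Rightarrow> 'k" and e
  assume S: "finite S" and inf: "infinite {t \<in> - {0}. (\<Sum>e\<in>S. c e * t powi e) = 0}" and e: "e \<in> S"
  \<comment> \<open>A common shift that makes all exponents in \<open>S\<close> nonnegative, so that
    the roots of an ordinary polynomial can be counted.\<close>
  define K where "K = (\<Sum>e\<in>S. \<bar>e\<bar>)"
  have K: "e + K \<ge> 0" if "e \<in> S" for e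
    using member_le_sum[of e S abs] S that by (simp add: K_def)
  define q where "q = (\<Sum>e\<in>S. monom (c e) (nat (e + K)))"
  have q: "poly q t = t powi K * (\<Sum>e\<in>S. c e * t powi e)" if "t \<noteq> 0" for t
    unfolding q_def poly_sum poly_monom sum_distrib_left
  proof (intro sum.cong refl)
    fix e assume "e \<in> S"
    then have "t ^ nat (e + K) = t powi (e + K)" using K by (simp add: power_int_def)
    then show "c e * t ^ nat (e + K) = t powi K * (c e * t powi e)"
      using that by (simp add: power_int_add mult_ac)
  qed
  have "q = 0"
  proof (rule ccontr)
    assume "q \<noteq> 0"
    then have "finite {t. poly q t = 0}" by (rule poly_roots_finite)
    moreover have "{t \<in> - {0}. (\<Sum>e\<in>S. c e * t powi e) = 0} \<subseteq> {t. poly q t = 0}" by (auto simp: q)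
    ultimately show False using inf finite_subset by blast
  qed
  moreover have "coeff q (nat (e + K)) = c e"
  proof -
    have "coeff q (nat (e + K)) = (\<Sum>d\<in>S. if d = e then c d else 0)"
      unfolding q_def coeff_sum coeff_monom using K e by (intro sum.cong refl) (auto simp: eq_nat_nat_iff)
    then show ?thesis using S e by simp
  qed
  ultimately show "c e = 0" by simp
next
  fix e :: int
  show "\<exists>A c a b. finite (A :: nat set) \<and>
      (\<forall>s\<in>- {0}. \<forall>t\<in>- {0}. t powi e - s powi e = (t - s) * (\<Sum>i\<in>A. c i * t powi a i * s powi b i :: 'k))"
  proof (cases "e \<ge> 0")
    case True
    have e: "t powi e = t ^ nat e" for t :: 'k using True by (simp add: power_int_def)
    have "t powi e - s powi e = (t - s) * (\<Sum>i<nat e. 1 * t powi int i * s powi int (nat e - Suc i))" for s t :: 'k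
      unfolding e power_int_of_nat mult_1 power_diff_sumr2 by (simp only: mult.commute)
    then show ?thesis
      by (intro exI[of _ "{..<nat e}"] exI[of _ "\<lambda>_. 1"] exI[of _ "\<lambda>i. int i"] exI[of _ "\<lambda>i. int (nat e - Suc i)"]) blast
  next
    case False
    define n where "n = nat (- e)"
    have "t powi e - s powi e = (t - s) * (\<Sum>i<n. - 1 * t powi (- int (Suc i)) * s powi (- int (n - i)))"
      if st: "s \<noteq> 0" "t \<noteq> 0" for s t :: 'k
    proof -
      \<comment> \<open>For a negative exponent the factorization of a difference of powers is
        applied to the inverses, and \<open>u - v\<close> is the multiple of \<open>t - s\<close> by
        the negative of \<open>u * v\<close>.\<close>
      define u v where "u = inverse t" and "v = inverse s"
      have "t powi e = u ^ n" "s powi e = v ^ n"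
        using False by (simp_all add: power_int_def n_def u_def v_def power_inverse)
      then have "t powi e - s powi e = (u - v) * (\<Sum>i<n. v ^ (n - Suc i) * u ^ i)"
        by (simp add: power_diff_sumr2)
      also have "u - v = (t - s) * (- (u * v))" using st by (simp add: u_def v_def field_simps)
      also have "(t - s) * (- (u * v)) * (\<Sum>i<n. v ^ (n - Suc i) * u ^ i) =
        (t - s) * (\<Sum>i<n. - (u * v) * (v ^ (n - Suc i) * u ^ i))"
        by (simp only: sum_distrib_left mult.assoc)
      also have "(\<Sum>i<n. - (u * v) * (v ^ (n - Suc i) * u ^ i)) =
        (\<Sum>i<n. - 1 * t powi (- int (Suc i)) * s powi (- int (n - i)))"
      proof (rule sum.cong[OF refl])
        fix i assume "i \<in> {..<n}"
        then have "Suc (n - Suc i) = n - i" by auto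
        then have "v * v ^ (n - Suc i) = v ^ (n - i)" by (metis power_Suc)
        moreover have "u ^ Suc i = t powi (- int (Suc i))" "v ^ (n - i) = s powi (- int (n - i))"
          by (simp_all only: u_def v_def power_int_minus power_int_of_nat power_inverse)
        ultimately show "- (u * v) * (v ^ (n - Suc i) * u ^ i) = - 1 * t powi (- int (Suc i)) * s powi (- int (n - i))"
          by (metis (no_types, lifting) minus_mult_commute mult.assoc mult.commute mult_1 mult_minus_left power_Suc)
      qed
      finally show ?thesis .
    qed
    then show ?thesis
      by (intro exI[of _ "{..<n}"] exI[of _ "\<lambda>_. - 1"] exI[of _ "\<lambda>i. - int (Suc i)"] exI[of _ "\<lambda>i. - int (n - i)"]) auto
  qed
next
  have "t powi - 1 * t = 1" if "t \<in> - {0}" for t :: 'k using that by (simp add: power_int_minus)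
  moreover have "\<exists>K n. \<forall>t\<in>- {0}. t ^ K * t powi e = (t :: 'k) ^ n" for e :: int
  proof (cases "e \<ge> 0")
    case True
    then show ?thesis by (intro exI[of _ 0] exI[of _ "nat e"]) (simp add: power_int_def)
  next
    case False
    then have "t ^ nat (- e) * t powi e = t ^ 0" if "t \<noteq> 0" for t :: 'k
      using that by (simp add: power_int_def power_inverse)
    then show ?thesis by (intro exI[of _ "nat (- e)"] exI[of _ 0]) auto
  qed
  ultimately show "(- {0} :: 'k set) = UNIV \<and> (\<forall>e. \<exists>n. \<forall>t :: 'k. t powi e = t ^ n) \<or>
    (- {0} :: 'k set) = - {0} \<and> (\<exists>e. \<forall>t\<in>- {0}. t powi e * t = (1 :: 'k)) \<and>
      (\<forall>e. \<exists>K n. \<forall>t\<in>- {0}. t ^ K * t powi e = (t :: 'k) ^ n)" by blast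
qed (auto simp: power_int_add power_int_mult_distrib)

interpretation S: point_functions "UNIV :: 'k::{alg_closed_field, field_char_0} set" "(^) :: 'k \<Rightarrow> nat \<Rightarrow> 'k" "- 1"
  by (rule point_functions_poly)

interpretation L: point_functions "- {0} :: 'k::{alg_closed_field, field_char_0} set" "(powi) :: 'k \<Rightarrow> int \<Rightarrow> 'k" 1
  by (rule point_functions_laurent)

section \<open>Case S: the substitution x_1 = t, y_1 = -t\<close>

lemma S_pts: "S.pts = UNIV"
  by (simp add: S.pts_def)

lemma gev_poly_subst_t:
  fixes f :: "(nat, 'k::{alg_closed_field, field_char_0}) gpoly"
  shows "S.gev (poly (subst_t f) (Const t)) p = S.gev f (p(Inl 1 := t, Inr 1 := - t))"
proof -
  define \<rho> :: "nat + nat \<Rightarrow> (nat, 'k) gpoly poly" where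
    "\<rho> = (\<lambda>v. [:Var v:])(Inl 1 := [:0, 1:], Inr 1 := - [:0, 1:])"
  let ?q = "p(Inl 1 := t, Inr 1 := - t)"
  have C: "S.gev (Const c) p = c" for c by (simp add: Const_def S.gev_single S.mon_def)
  have V: "S.gev (Var v) p = p v" for v by (simp add: Var_def S.gev_single S.mon_def)
  have \<rho>: "S.gev (poly (\<rho> v) (Const t)) p = ?q v" for v by (simp add: \<rho>_def C V S.gev_uminus)
  have prod: "S.gev (prod g A) p = (\<Prod>v\<in>A. S.gev (g v) p)" for g :: "nat + nat \<Rightarrow> (nat, 'k) gpoly" and A
    by (induction A rule: infinite_finite_induct) (auto simp: S.gev_1 S.gev_mult S_pts)
  have pow: "S.gev (g ^ k) p = S.gev g p ^ k" for g k by (simp add: S.gev_power S_pts)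
  show ?thesis
    unfolding subst_t_def \<rho>_def[symmetric] subst_poly_def poly_sum S.gev_sum S.gev_def[of f] S.mon_def
    by (intro sum.cong refl) (simp add: S.gev_mult S_pts C poly_prod prod pow \<rho> poly_power del: fun_upd_apply)
qed

text \<open>At each \<open>p\<close> the coefficients specialize to a univariate polynomial over an
  infinite field. If its values are constant, its higher coefficients vanish, and a coefficient that
  vanishes at every \<open>p\<close> is zero.\<close>

lemma degree_zero_iff_gev_constant:
  fixes q :: "(nat, 'k::{alg_closed_field, field_char_0}) gpoly poly"
  shows "degree q = 0 \<longleftrightarrow> (\<forall>p t. S.gev (poly q (Const t)) p = S.gev (poly q (Const 1)) p)"
proof
  assume "degree q = 0"
  then obtain c where "q = [:c:]" by (auto elim: degree_eq_zeroE)
  then show "\<forall>p t. S.gev (poly q (Const t)) p = S.gev (poly q (Const 1)) p" by simp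
next
  assume const: "\<forall>p t. S.gev (poly q (Const t)) p = S.gev (poly q (Const 1)) p"
  have C: "S.gev (Const c) p = c" for c and p :: "'k valuation" by (simp add: Const_def S.gev_single S.mon_def)
  have "coeff q i = 0" if i: "i > 0" for i
  proof (rule S.gev_inject)
    fix p :: "'k valuation"
    let ?m = "map_poly (\<lambda>c. S.gev c p) q"
    have ev: "poly ?m t = S.gev (poly q (Const t)) p" for t
      by (induction q rule: pCons_induct) (auto simp: map_poly_pCons S.gev_0 S.gev_add S.gev_mult S_pts C)
    have "poly ?m t = poly [:poly ?m 1:] t" for t using const by (simp add: ev)
    then have "?m = [:poly ?m 1:]" using poly_eq_poly_eq_iff by blast
    then have "coeff ?m i = coeff [:poly ?m 1:] i" by simp
    then have "coeff ?m i = 0" using i by (simp add: coeff_pCons split: nat.splits)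
    then show "S.gev (coeff q i) p = S.gev 0 p" by (simp add: coeff_map_poly S.gev_0)
  qed
  then show "degree q = 0" using leading_coeff_0_iff by fastforce
qed

lemma supersym_polys_eq: "supersym_polys m n = S.SA_polys m n"
proof (rule Set.set_eqI)
  fix f :: "(nat, 'k::{alg_closed_field, field_char_0}) gpoly"
  have "degree (subst_t f) = 0 \<longleftrightarrow>
    (\<forall>p\<in>S.pts. \<forall>t\<in>UNIV. S.gev f (p(Inl 1 := t, Inr 1 := - 1 * t)) = S.gev f (p(Inl 1 := 1, Inr 1 := - 1)))"
    unfolding degree_zero_iff_gev_constant gev_poly_subst_t by (simp add: S_pts)
  then show "f \<in> supersym_polys m n \<longleftrightarrow> f \<in> S.SA_polys m n"
    unfolding supersym_polys_def S.SA_polys_iff_first_pair by simp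
qed

section \<open>Case L: the derivation along the diagonal\<close>

definition euler_deriv :: "nat + nat \<Rightarrow> nat + nat \<Rightarrow> (int, 'k::field) gpoly \<Rightarrow> (int, 'k) gpoly" where
  "euler_deriv a b f = (\<Sum>\<mu>\<in>keys f.
    single \<mu> (of_int (lookup \<mu> a + lookup \<mu> b) * lookup f \<mu>))"

text \<open>Multiplying by the variable undoes the shift of the exponent, so monomials are
  eigenvectors, with the sum of their two exponents as eigenvalue.\<close>

lemma euler_deriv_eq: "Var a * partial_deriv a f + Var b * partial_deriv b f = euler_deriv a b f"
proof -
  have 1: "Var v * partial_deriv v f = (\<Sum>\<mu>\<in>keys f.
      single \<mu> (of_int (lookup \<mu> v) * lookup f \<mu>))" for v
    by (simp add: Var_def partial_deriv_def sum_distrib_left mult_single)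
  show ?thesis
    unfolding 1 euler_deriv_def sum.distrib[symmetric]
    by (intro sum.cong refl) (simp add: single_add[symmetric] algebra_simps)
qed

lemma L_mon_diagonal:
  fixes p :: "nat + nat \<Rightarrow> 'k::{alg_closed_field, field_char_0}"
  assumes ab: "a \<noteq> b" and t: "t \<noteq> 0"
  shows "L.mon \<mu> (p(a := t, b := t)) =
    t powi (lookup \<mu> a + lookup \<mu> b) * L.mon \<mu> (p(a := 1, b := 1))"
proof -
  let ?K = "keys \<mu>" and ?l = "lookup \<mu>"
  let ?A = "insert a (insert b (?K - {a, b}))"
  have "L.mon \<mu> (p(a := s, b := s)) = s powi ?l a * (s powi ?l b * (\<Prod>v\<in>?K - {a, b}. p v powi ?l v))" for s
  proof -
    have "L.mon \<mu> (p(a := s, b := s)) = (\<Prod>v\<in>?A. (p(a := s, b := s)) v powi ?l v)"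
      by (rule L.mon_superset) auto
    also have "\<dots> = s powi ?l a * (s powi ?l b * (\<Prod>v\<in>?K - {a, b}. (p(a := s, b := s)) v powi ?l v))"
      using ab by simp
    also have "(\<Prod>v\<in>?K - {a, b}. (p(a := s, b := s)) v powi ?l v) = (\<Prod>v\<in>?K - {a, b}. p v powi ?l v)"
      by (intro prod.cong) auto
    finally show ?thesis .
  qed
  then show ?thesis using t by (simp add: power_int_add)
qed

text \<open>On the diagonal x_a = x_b = t the function is the sum of the
  \<open>C p d * t powi d\<close>, where \<open>C p d\<close> gathers the monomials with exponent
  sum \<open>d\<close>, and the derivation acts as t d/dt. In characteristic zero either condition
  says that \<open>C p d\<close> vanishes for all nonzero \<open>d\<close>.\<close>

lemma euler_deriv_vanishes_iff:
  fixes f :: "(int, 'k::{alg_closed_field, field_char_0}) gpoly"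
  assumes ab: "a \<noteq> b"
  shows "(\<forall>p\<in>L.pts. p a = p b \<longrightarrow> L.gev (euler_deriv a b f) p = 0) \<longleftrightarrow>
    (\<forall>p\<in>L.pts. \<forall>t\<in>- {0}. L.gev f (p(a := t, b := t)) = L.gev f (p(a := 1, b := 1)))"
proof -
  let ?K = "keys f"
  define e where "e = (\<lambda>\<mu> :: (nat + nat) \<Rightarrow>\<^sub>0 int. lookup \<mu> a + lookup \<mu> b)"
  define C where "C = (\<lambda>p d. \<Sum>\<mu> | \<mu> \<in> ?K \<and> e \<mu> = d. lookup f \<mu> * L.mon \<mu> (p(a := 1, b := 1)))"
  have ev_f: "L.gev f (p(a := t, b := t)) = (\<Sum>d\<in>e ` ?K. C p d * t powi d)" if "t \<noteq> 0" for p t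
  proof -
    have "L.gev f (p(a := t, b := t)) =
      (\<Sum>\<mu>\<in>?K. lookup f \<mu> * L.mon \<mu> (p(a := 1, b := 1)) * t powi e \<mu>)"
      by (simp add: L.gev_def L_mon_diagonal[OF ab that] e_def mult_ac)
    also have "\<dots> = (\<Sum>d\<in>e ` ?K. \<Sum>\<mu> | \<mu> \<in> ?K \<and> e \<mu> = d.
        lookup f \<mu> * L.mon \<mu> (p(a := 1, b := 1)) * t powi e \<mu>)"
      by (rule sum.image_gen) simp
    also have "\<dots> = (\<Sum>d\<in>e ` ?K. C p d * t powi d)"
      unfolding C_def sum_distrib_right by (intro sum.cong refl) auto
    finally show ?thesis .
  qed
  have ev_d: "L.gev (euler_deriv a b f) (p(a := t, b := t)) = (\<Sum>d\<in>e ` ?K. of_int d * C p d * t powi d)"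
    if "t \<noteq> 0" for p t
  proof -
    have "L.gev (euler_deriv a b f) (p(a := t, b := t)) =
      (\<Sum>\<mu>\<in>?K. of_int (e \<mu>) * (lookup f \<mu> * L.mon \<mu> (p(a := 1, b := 1))) * t powi e \<mu>)"
      by (simp add: euler_deriv_def L.gev_sum L.gev_single L_mon_diagonal[OF ab that] e_def mult_ac)
    also have "\<dots> = (\<Sum>d\<in>e ` ?K. \<Sum>\<mu> | \<mu> \<in> ?K \<and> e \<mu> = d.
        of_int (e \<mu>) * (lookup f \<mu> * L.mon \<mu> (p(a := 1, b := 1))) * t powi e \<mu>)"
      by (rule sum.image_gen) simp
    also have "\<dots> = (\<Sum>d\<in>e ` ?K. of_int d * C p d * t powi d)"
      unfolding C_def sum_distrib_right sum_distrib_left by (intro sum.cong refl) auto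
    finally show ?thesis .
  qed
  have zero: "c d = 0" if "finite D" "d \<in> D" "\<And>t. t \<noteq> 0 \<Longrightarrow> (\<Sum>d\<in>D. c d * t powi d) = 0"
    for D and c :: "int \<Rightarrow> 'k" and d
  proof (rule L.pw_indep[OF that(1) _ that(2)])
    have "{t \<in> - {0}. (\<Sum>d\<in>D. c d * t powi d) = 0} = - {0}" using that(3) by auto
    then show "infinite {t \<in> - {0}. (\<Sum>d\<in>D. c d * t powi d) = 0}" using L.infinite_E by metis
  qed
  show ?thesis
  proof (intro iffI ballI impI)
    fix p :: "'k valuation" and t :: 'k
    assume van: "\<forall>p\<in>L.pts. p a = p b \<longrightarrow> L.gev (euler_deriv a b f) p = 0" and p: "p \<in> L.pts" and t: "t \<in> - {0}"
    have "L.gev (euler_deriv a b f) (p(a := t, b := t)) = 0" if "t \<noteq> 0" for t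
    proof -
      have "p(a := t, b := t) \<in> L.pts" using p that by (auto simp: L.pts_def)
      then show ?thesis using van ab by auto
    qed
    then have "of_int d * C p d = 0" if "d \<in> e ` ?K" for d
      using that by (intro zero[of "e ` ?K" d "\<lambda>d. of_int d * C p d"]) (auto simp: ev_d)
    then have z: "d = 0 \<or> C p d = 0" if "d \<in> e ` ?K" for d using that by force
    have "L.gev f (p(a := t, b := t)) = (\<Sum>d\<in>e ` ?K. C p d * t powi d)" using t by (intro ev_f) simp
    also have "\<dots> = (\<Sum>d\<in>e ` ?K. C p d * 1 powi d)"
    proof (rule sum.cong[OF refl])
      fix d assume "d \<in> e ` ?K"
      then show "C p d * t powi d = C p d * 1 powi d" using z[of d] by auto
    qed
    also have "\<dots> = L.gev f (p(a := 1, b := 1))" by (rule ev_f[OF one_neq_zero, symmetric])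
    finally show "L.gev f (p(a := t, b := t)) = L.gev f (p(a := 1, b := 1))" .
  next
    fix p :: "'k valuation"
    assume const: "\<forall>p\<in>L.pts. \<forall>t\<in>- {0}. L.gev f (p(a := t, b := t)) = L.gev f (p(a := 1, b := 1))"
      and p: "p \<in> L.pts" "p a = p b"
    define k where "k = L.gev f (p(a := 1, b := 1))"
    \<comment> \<open>The exponent 0 is added so that the constant \<open>k\<close> can be compared
      coefficientwise even if no monomial has exponent sum 0.\<close>
    let ?D = "insert 0 (e ` ?K)"
    have C0: "C p d = 0" if "d \<notin> e ` ?K" for d using that by (auto simp: C_def intro!: sum.neutral)
    have z: "C p d - (if d = 0 then k else 0) = 0" if "d \<in> ?D" for d
    proof (rule zero[OF _ that])
      fix t :: 'k assume t: "t \<noteq> 0"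
      have "(\<Sum>d\<in>?D. C p d * t powi d) = (\<Sum>d\<in>e ` ?K. C p d * t powi d)"
        using C0 by (intro sum.mono_neutral_right) auto
      also have "\<dots> = L.gev f (p(a := t, b := t))" by (rule ev_f[OF t, symmetric])
      also have "\<dots> = k" using const p(1) t unfolding k_def by blast
      also have "k = (\<Sum>d\<in>?D. if d = 0 then k else 0)" by (subst sum.delta) simp_all
      also have "\<dots> = (\<Sum>d\<in>?D. (if d = 0 then k else 0) * t powi d)" by (intro sum.cong refl) simp
      finally show "(\<Sum>d\<in>?D. (C p d - (if d = 0 then k else 0)) * t powi d) = 0"
        by (simp only: left_diff_distrib sum_subtractf diff_self)
    qed simp
    have dC: "of_int d * C p d = 0" if "d \<in> e ` ?K" for d
      using z[of d] that by (cases "d = 0") simp_all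
    have "p a \<noteq> 0" using p(1) by (simp add: L.pts_def)
    then have "L.gev (euler_deriv a b f) (p(a := p a, b := p a)) = (\<Sum>d\<in>e ` ?K. of_int d * C p d * p a powi d)"
      by (rule ev_d)
    also have "\<dots> = 0" by (intro sum.neutral ballI) (simp only: dC mult_zero_left)
    finally have "L.gev (euler_deriv a b f) (p(a := p a, b := p a)) = 0" .
    moreover have "p(a := p a, b := p a) = p" using p(2) by auto
    ultimately show "L.gev (euler_deriv a b f) p = 0" by simp
  qed
qed

text \<open>The factor theorem \<open>RF_divide\<close> gives the quotient as a function,
  \<open>RF_gev\<close> realizes it by a Laurent polynomial, and \<open>gev_inject\<close> turns the
  division into an identity in the ring.\<close>

lemma euler_deriv_in_ideal_iff:
  fixes f :: "(int, 'k::{alg_closed_field, field_char_0}) gpoly"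
  assumes f: "f \<in> polys_in m n" and ab: "a \<in> variables m n" "b \<in> variables m n"
  shows "euler_deriv a b f \<in> PIdl\<^bsub>laurent_ring m n\<^esub> (Var a - Var b) \<longleftrightarrow>
    (\<forall>p\<in>L.pts. p a = p b \<longrightarrow> L.gev (euler_deriv a b f) p = 0)"
proof -
  have V: "L.gev (Var v) p = p v" for v and p :: "'k valuation" by (simp add: Var_def L.gev_single L.mon_def)
  have Pidl: "PIdl\<^bsub>laurent_ring m n\<^esub> (Var a - Var b) = {g * (Var a - Var b) | g. g \<in> polys_in m n}"
    by (simp add: cgenideal_def laurent_ring_def)
  have "euler_deriv a b f \<in> polys_on (variables m n)"
  proof -
    have "keys (euler_deriv a b f) \<subseteq> keys f"
      unfolding euler_deriv_def by (rule order_trans[OF keys_sum]) auto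
    then show ?thesis using f by (auto simp: polys_in_eq polys_on_def)
  qed
  note RF = L.gev_RF[OF this]
  show ?thesis
  proof
    assume "euler_deriv a b f \<in> PIdl\<^bsub>laurent_ring m n\<^esub> (Var a - Var b)"
    then show "\<forall>p\<in>L.pts. p a = p b \<longrightarrow> L.gev (euler_deriv a b f) p = 0"
      by (auto simp: Pidl L.gev_mult L.gev_diff V)
  next
    assume "\<forall>p\<in>L.pts. p a = p b \<longrightarrow> L.gev (euler_deriv a b f) p = 0"
    then obtain q where q: "q \<in> L.RF (variables m n)"
      "\<And>p. p \<in> L.pts \<Longrightarrow> L.gev (euler_deriv a b f) p = (p a - p b) * q p"
      using L.RF_divide[OF RF ab] by blast
    obtain g where g: "g \<in> polys_on (variables m n)" "\<And>p. p \<in> L.pts \<Longrightarrow> L.gev g p = q p"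
      using L.RF_gev[OF q(1)] by blast
    have "euler_deriv a b f = g * (Var a - Var b)"
      by (rule L.gev_inject) (simp add: q(2) g(2) L.gev_mult L.gev_diff V)
    then show "euler_deriv a b f \<in> PIdl\<^bsub>laurent_ring m n\<^esub> (Var a - Var b)"
      using g(1) by (auto simp: Pidl polys_in_eq)
  qed
qed

lemma laurent_supersym_polys_eq: "laurent_supersym_polys m n = L.SA_polys m n"
proof (rule Set.set_eqI)
  fix f :: "(int, 'k::{alg_closed_field, field_char_0}) gpoly"
  have "Var (Inl i) * partial_deriv (Inl i) f + Var (Inr j) * partial_deriv (Inr j) f
      \<in> PIdl\<^bsub>laurent_ring m n\<^esub> (Var (Inl i) - Var (Inr j)) \<longleftrightarrow>
    (\<forall>p\<in>L.pts. \<forall>t\<in>- {0}. L.gev f (p(Inl i := t, Inr j := 1 * t)) = L.gev f (p(Inl i := 1, Inr j := 1)))"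
    if "f \<in> W_invariants m n" "i \<in> {1..m}" "j \<in> {1..n}" for i j
  proof -
    have f: "f \<in> polys_in m n" using that(1) by (simp add: W_invariants_def)
    have "Inl i \<in> variables m n" "Inr j \<in> variables m n" using that by (auto simp: variables_eq)
    from euler_deriv_in_ideal_iff[OF f this] show ?thesis
      unfolding euler_deriv_eq mult_1 by (subst euler_deriv_vanishes_iff[symmetric]) auto
  qed
  then show "f \<in> laurent_supersym_polys m n \<longleftrightarrow> f \<in> L.SA_polys m n"
    unfolding laurent_supersym_polys_def L.SA_polys_iff mem_Collect_eq
    by (intro conj_cong refl ball_cong) blast
qed

lemma eval_poly_eq: "eval_poly = (\<lambda>f p. S.gev f (case_sum (fst p) (snd p)))"
  by (auto simp: fun_eq_iff eval_poly_def subst_poly_def S.gev_def S.mon_def)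

lemma eval_laurent_eq: "eval_laurent = (\<lambda>f p. L.gev f (case_sum (fst p) (snd p)))"
  by (auto simp: fun_eq_iff eval_laurent_def L.gev_def L.mon_def)

theorem theorem6p2:
  fixes m n :: nat
    and A\<^sub>S :: "(nat, 'k::{alg_closed_field, field_char_0}) gpoly ring"
    and A\<^sub>L :: "(int, 'k) gpoly ring"
    and X\<^sub>S X\<^sub>L :: "'k point set"
  defines "A\<^sub>S \<equiv> supersym_ring m n" and "X\<^sub>S \<equiv> affine_points m n"
    and "A\<^sub>L \<equiv> laurent_supersym_ring m n" and "X\<^sub>L \<equiv> torus_points m n"
  shows
    "(bij_betw (vanishing_ideal A\<^sub>S eval_poly)
        (superalgebraic_sets A\<^sub>S X\<^sub>S eval_poly) (radical_ideals A\<^sub>S) \<and>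
      bij_betw (zero_locus X\<^sub>S eval_poly)
        (radical_ideals A\<^sub>S) (superalgebraic_sets A\<^sub>S X\<^sub>S eval_poly) \<and>
      (\<forall>V\<in>superalgebraic_sets A\<^sub>S X\<^sub>S eval_poly.
        zero_locus X\<^sub>S eval_poly (vanishing_ideal A\<^sub>S eval_poly V) = V) \<and>
      (\<forall>I\<in>radical_ideals A\<^sub>S.
        vanishing_ideal A\<^sub>S eval_poly (zero_locus X\<^sub>S eval_poly I) = I) \<and>
      antimono_on (superalgebraic_sets A\<^sub>S X\<^sub>S eval_poly) (vanishing_ideal A\<^sub>S eval_poly) \<and>
      antimono_on (radical_ideals A\<^sub>S) (zero_locus X\<^sub>S eval_poly))
     \<and>
     (bij_betw (vanishing_ideal A\<^sub>L eval_laurent)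
        (superalgebraic_sets A\<^sub>L X\<^sub>L eval_laurent) (radical_ideals A\<^sub>L) \<and>
      bij_betw (zero_locus X\<^sub>L eval_laurent)
        (radical_ideals A\<^sub>L) (superalgebraic_sets A\<^sub>L X\<^sub>L eval_laurent) \<and>
      (\<forall>V\<in>superalgebraic_sets A\<^sub>L X\<^sub>L eval_laurent.
        zero_locus X\<^sub>L eval_laurent (vanishing_ideal A\<^sub>L eval_laurent V) = V) \<and>
      (\<forall>I\<in>radical_ideals A\<^sub>L.
        vanishing_ideal A\<^sub>L eval_laurent (zero_locus X\<^sub>L eval_laurent I) = I) \<and>
      antimono_on (superalgebraic_sets A\<^sub>L X\<^sub>L eval_laurent) (vanishing_ideal A\<^sub>L eval_laurent) \<and>
      antimono_on (radical_ideals A\<^sub>L) (zero_locus X\<^sub>L eval_laurent))"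
  unfolding A\<^sub>S_def X\<^sub>S_def A\<^sub>L_def X\<^sub>L_def supersym_ring_def laurent_supersym_ring_def
    affine_points_def torus_points_def supersym_polys_eq laurent_supersym_polys_eq
    eval_poly_eq eval_laurent_eq
  by (rule conjI[OF S.SA_polys_correspondence L.SA_polys_correspondence])

end
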